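(* Let $0<q<\infty$, let $m\geq 1$ be an integer, and let $\omega$ be a radial weight. Then the following conditions are equivalent: (a) for any analytic function $f$ on $\mathbb{D}$, $f\in AT^{\infty}_q(\omega)$ if and only if the function $z\mapsto f^{(m)}(z)(1-|z|)^m$ belongs to $T^{\infty}_q(\omega)$, and $$\|f\|_{AT^{\infty}_q(\omega)}\asymp\sum_{j=0}^{m-1}\left|f^{(j)}(0)\right|+\left\|f^{(m)}(\cdot)(1-|\cdot|)^m\right\|_{T^{\infty}_q(\omega)},$$ with implied constants independent of $f$; (b) $\omega\in\mathcal{D}$.
   Context: $\mathbb{D}$ is the open unit disk of $\mathbb{C}$, $dA$ is Lebesgue area measure on $\mathbb{D}$, and $\mathcal{H}(\mathbb{D})$ is the space of analytic functions on $\mathbb{D}$. Weights: a weight is a function $\omega:\mathbb{D}\to[0,\infty)$ integrable over $\mathbb{D}$ and not a.e. zero; it is radial if $\omega(z)=\omega(|z|)$ for all $z$. For a radial weight put $\widehat{\omega}(z)=\int_{|z|}^1\omega(s)\,ds$, which is assumed finite for all $z\in\mathbb{D}$ (including $z=0$). A radial weight $\omega$ is in $\widehat{\mathcal{D}}$ if there is $C\ge1$ with $\widehat{\omega}(r)\le C\widehat{\omega}\left(\frac{1+r}{2}\right)$ for all $0\le r<1$; it is in $\check{\mathcal{D}}$ if there are $K>1$ and $C>1$ with $\widehat{\omega}(r)\ge C\widehat{\omega}\left(1-\frac{1-r}{K}\right)$ for all $0\le r<1$. $\mathcal{D}:=\widehat{\mathcal{D}}\cap\check{\mathcal{D}}$.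 Tent spaces: the Carleson squares are $S(0):=\mathbb{D}$ and $S(re^{i\theta}):=\{\rho e^{it}:r\le\rho<1,\ |t-\theta|\le\frac{1-r}{2}\}$ for $0<r<1$. For $0<q<\infty$, $T^{\infty}_q(\omega)$ consists of the measurable functions $f$ on $\mathbb{D}$ with $$\|f\|_{T^{\infty}_q(\omega)}:=\sup_{a\in\mathbb{D}}\left(\frac{1}{1-|a|}\int_{S(a)}|f|^q\,\omega\,dA\right)^{1/q}<\infty,$$ and $AT^{\infty}_q(\omega):=T^{\infty}_q(\omega)\cap\mathcal{H}(\mathbb{D})$ with the inherited (quasi-)norm. $A\asymp B$ means $C^{-1}A\le B\le CA$ for a constant $C>0$. *)

theory Defs
  imports "HOL-Analysis.Analysis"
begin

abbreviation unit_disk :: "complex set" where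
  "unit_disk \<equiv> ball 0 1"

text \<open>A weight is only relevant on the disk; it is modelled as a total function whose
  values outside the disk are arbitrary. Its values on the radius \<open>[0,1)\<close> are
  \<open>\<omega> (of_real s)\<close>.\<close>

definition weight :: "(complex \<Rightarrow> real) \<Rightarrow> bool" where
  "weight \<omega> \<longleftrightarrow>
     (\<forall>z\<in>unit_disk. 0 \<le> \<omega> z) \<and>
     set_integrable lebesgue unit_disk \<omega> \<and>
     \<not> (AE z in lebesgue_on unit_disk. \<omega> z = 0)"

definition radial :: "(complex \<Rightarrow> real) \<Rightarrow> bool" where
  "radial \<omega> \<longleftrightarrow> (\<forall>z\<in>unit_disk. \<omega> z = \<omega> (of_real (norm z)))"

definition finite_tails :: "(complex \<Rightarrow> real) \<Rightarrow> bool" where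
  "finite_tails \<omega> \<longleftrightarrow>
     (\<forall>z\<in>unit_disk. set_integrable lebesgue {norm z..<1} (\<lambda>s. \<omega> (of_real s)))"

text \<open>The standing assumption that the tail integrals are finite is part of what is meant
  by a radial weight. It does not follow from integrability over the disk, since \<open>dA\<close> has
  the factor \<open>s\<close> in polar coordinates.\<close>

definition radial_weight :: "(complex \<Rightarrow> real) \<Rightarrow> bool" where
  "radial_weight \<omega> \<longleftrightarrow> weight \<omega> \<and> radial \<omega> \<and> finite_tails \<omega>"

definition tail :: "(complex \<Rightarrow> real) \<Rightarrow> complex \<Rightarrow> real" where
  "tail \<omega> z = (LINT s:{norm z..<1}|lebesgue. \<omega> (of_real s))"

definition D_hat :: "(complex \<Rightarrow> real) set" where
  "D_hat = {\<omega>. radial_weight \<omega> \<and>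
     (\<exists>C\<ge>1. \<forall>r::real. 0 \<le> r \<and> r < 1 \<longrightarrow>
        tail \<omega> (of_real r) \<le> C * tail \<omega> (of_real ((1 + r) / 2)))}"

definition D_check :: "(complex \<Rightarrow> real) set" where
  "D_check = {\<omega>. radial_weight \<omega> \<and>
     (\<exists>K>1. \<exists>C>1. \<forall>r::real. 0 \<le> r \<and> r < 1 \<longrightarrow>
        tail \<omega> (of_real r) \<ge> C * tail \<omega> (of_real (1 - (1 - r) / K)))}"

definition D_class :: "(complex \<Rightarrow> real) set" where
  "D_class = D_hat \<inter> D_check"

text \<open>As \<open>t\<close> ranges over all reals, the choice of the argument of \<open>a\<close> is immaterial.\<close>

definition carleson_square :: "complex \<Rightarrow> complex set" where
  "carleson_square a =
     (if a = 0 then unit_disk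
      else {rcis \<rho> t | \<rho> t. norm a \<le> \<rho> \<and> \<rho> < 1 \<and> \<bar>t - Arg a\<bar> \<le> (1 - norm a) / 2})"

text \<open>Intended for exponents \<open>p > 0\<close> only.\<close>

definition ennreal_powr :: "ennreal \<Rightarrow> real \<Rightarrow> ennreal" where
  "ennreal_powr x p = (if x = \<infinity> then \<infinity> else ennreal (enn2real x powr p))"

definition tent_norm :: "real \<Rightarrow> (complex \<Rightarrow> real) \<Rightarrow> (complex \<Rightarrow> complex) \<Rightarrow> ennreal" where
  "tent_norm q \<omega> f =
     (SUP a\<in>unit_disk.
        ennreal_powr
          (ennreal (1 / (1 - norm a)) *
            (\<integral>\<^sup>+z\<in>carleson_square a. ennreal (norm (f z) powr q * \<omega> z) \<partial>lebesgue))
          (1 / q))"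

definition tent_space :: "real \<Rightarrow> (complex \<Rightarrow> real) \<Rightarrow> (complex \<Rightarrow> complex) set" where
  "tent_space q \<omega> =
     {f. f \<in> borel_measurable (lebesgue_on unit_disk) \<and> tent_norm q \<omega> f < \<infinity>}"

definition analytic_tent_space :: "real \<Rightarrow> (complex \<Rightarrow> real) \<Rightarrow> (complex \<Rightarrow> complex) set" where
  "analytic_tent_space q \<omega> = {f \<in> tent_space q \<omega>. f holomorphic_on unit_disk}"

definition weighted_deriv :: "nat \<Rightarrow> (complex \<Rightarrow> complex) \<Rightarrow> complex \<Rightarrow> complex" where
  "weighted_deriv m f z = (deriv ^^ m) f z * of_real ((1 - norm z) ^ m)"

end

(*
  The kernel P_a(z) = (1 - |a|) / |1 - cnj a z|^2 is comparable to 1 / (1 - |a|) on the Carleson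
  square of a, it is dominated by a geometric series of such squares, and P_a = |h_a|^q for a
  holomorphic h_a.  So the q-th power of the tent norm of f is comparable to the supremum over a of
  the integral of |f h_a|^q against the weight, and since the weight is radial, only the circle means
  of |f h_a|^q matter; these increase with the radius.

  If the weight lies in D, its masses W_j on the annuli 1 - K^-j <= |z| < 1 - K^-(j+1) decay
  geometrically, but not faster.  Hence an increasing function of the radius may be moved by a bounded
  number of annuli.  With the Cauchy estimates this bounds the derivative by the function.  Conversely,
  f is summed radially over the annuli.  By (x + y)^q <= g x^q + C y^q with g > 1 chosen such that the
  product of g and the decay rate of W_j is below 1, the sum converges; inside the disk of radius |a|
  the growth of f is bounded pointwise instead.

  For the necessity of D, the norm equivalence is tested on monomials z^n.  It gives two inequalities
  between the moments of the weight, which locate the mass of r^(nq) at distance comparable to 1/n from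
  the boundary, on both sides.
*)
theory Submission
  imports Defs "HOL-Complex_Analysis.Complex_Analysis"
begin

text \<open>The obstacle is the squares: their indicators destroy the monotonicity of circle means
  in the radius, and q < 1 rules out convexity and duality. Absorbing the kernel into a holomorphic
  factor keeps |f|^q P_a the q-th power of a modulus, so that monotonicity, obtained from a maximum
  principle for sums of such powers, is available for every q > 0 together with the localisation to
  a square. The price is that the kernel changes along a radius. From the annulus containing |a|
  outwards it changes by a bounded factor and can be frozen at one radius; further inside it does
  not, and there f is bounded at each point b by the kernel integrals centred at b itself. Only
  first derivatives are integrated; higher orders follow because the weight times (1 - r)^p
  satisfies annulus bounds of the same kind. The inequalities hold between possibly infinite
  quantities, so that membership in the space and comparison of norms are obtained together. For the
  converse, z^n has radial modulus, and for such functions the supremum over squares collapses to an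
  integral over the radius.\<close>

section \<open>Polar coordinates\<close>

lemma nn_integral_lborel_translate:
  fixes f :: "complex \<Rightarrow> ennreal"
  assumes "f \<in> borel_measurable borel"
  shows "(\<integral>\<^sup>+x. f (c + x) \<partial>lborel) = (\<integral>\<^sup>+x. f x \<partial>lborel)"
proof -
  have "(\<integral>\<^sup>+x. f x \<partial>lborel) = (\<integral>\<^sup>+x. f x \<partial>(distr lborel borel ((+) c)))"
    by (simp add: lborel_distr_plus)
  also have "\<dots> = (\<integral>\<^sup>+x. f (c + x) \<partial>lborel)"
    using assms by (intro nn_integral_distr) auto
  finally show ?thesis ..
qed

lemma nn_integral_lborel_reflect:
  fixes f :: "complex \<Rightarrow> ennreal"
  assumes "f \<in> borel_measurable borel"
  shows "(\<integral>\<^sup>+x. f (c - x) \<partial>lborel) = (\<integral>\<^sup>+x. f x \<partial>lborel)"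
proof -
  have *: "(lborel :: complex measure) = distr lborel borel (\<lambda>x. c + (-1) *\<^sub>R x)"
    by (subst lborel_affine[of "-1" c]) (simp_all add: density_1)
  have "(\<integral>\<^sup>+x. f x \<partial>lborel) = (\<integral>\<^sup>+x. f x \<partial>(distr lborel borel (\<lambda>x. c + (-1) *\<^sub>R x)))"
    using * by simp
  also have "\<dots> = (\<integral>\<^sup>+x. f (c + (-1) *\<^sub>R x) \<partial>lborel)"
    using assms by (intro nn_integral_distr) auto
  finally show ?thesis by simp
qed

text \<open>By Tonelli, averaging the integrand over the translates by the unit ball \<open>B\<close> turns the
  rotation into a rotation of \<open>B\<close>.\<close>

lemma nn_integral_lborel_rotate:
  fixes f :: "complex \<Rightarrow> ennreal"
  assumes f [measurable]: "f \<in> borel_measurable borel" and c: "norm c = 1"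
  shows "(\<integral>\<^sup>+x. f (c * x) \<partial>lborel) = (\<integral>\<^sup>+x. f x \<partial>lborel)"
proof -
  define B where "B = ball (0::complex) 1"
  have B[measurable]: "B \<in> sets borel" by (simp add: B_def)
  define b where "b = emeasure lborel B"
  have b: "b \<noteq> 0" "b \<noteq> \<infinity>"
    using content_ball_pos[of 1 "0::complex"] emeasure_bounded_finite[of B]
    by (auto simp: b_def B_def measure_def)
  have c0: "c \<noteq> 0" using c by auto
  have "(\<integral>\<^sup>+x. f (c * x) \<partial>lborel) * b = (\<integral>\<^sup>+x. (\<integral>\<^sup>+y. f (c * x) * indicator B y \<partial>lborel) \<partial>lborel)"
    by (simp add: nn_integral_cmult b_def nn_integral_multc)
  also have "\<dots> = (\<integral>\<^sup>+y. (\<integral>\<^sup>+x. f (c * x) * indicator B y \<partial>lborel) \<partial>lborel)"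
    by (rule lborel_pair.Fubini') measurable
  also have "\<dots> = (\<integral>\<^sup>+y. (\<integral>\<^sup>+x. f (c * (y/c + x)) * indicator B y \<partial>lborel) \<partial>lborel)"
  proof (rule nn_integral_cong)
    fix y
    show "(\<integral>\<^sup>+x. f (c * x) * indicator B y \<partial>lborel) = (\<integral>\<^sup>+x. f (c * (y/c + x)) * indicator B y \<partial>lborel)"
      by (rule nn_integral_lborel_translate[symmetric, where f = "\<lambda>x. f (c * x) * indicator B y"]) measurable
  qed
  also have "\<dots> = (\<integral>\<^sup>+y. (\<integral>\<^sup>+x. f (y + c * x) * indicator B y \<partial>lborel) \<partial>lborel)"
    using c0 by (simp add: distrib_left)
  also have "\<dots> = (\<integral>\<^sup>+x. (\<integral>\<^sup>+y. f (y + c * x) * indicator B y \<partial>lborel) \<partial>lborel)"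
    by (rule lborel_pair.Fubini') measurable
  also have "\<dots> = (\<integral>\<^sup>+x. (\<integral>\<^sup>+y. f y * indicator B (y - c * x) \<partial>lborel) \<partial>lborel)"
  proof (rule nn_integral_cong)
    fix x
    show "(\<integral>\<^sup>+y. f (y + c * x) * indicator B y \<partial>lborel) = (\<integral>\<^sup>+y. f y * indicator B (y - c * x) \<partial>lborel)"
      using nn_integral_lborel_translate[where f = "\<lambda>y. f y * indicator B (y - c * x)" and c = "c * x"]
      by (simp add: add.commute)
  qed
  also have "\<dots> = (\<integral>\<^sup>+y. (\<integral>\<^sup>+x. f y * indicator B (y - c * x) \<partial>lborel) \<partial>lborel)"
    by (rule lborel_pair.Fubini') measurable
  also have "\<dots> = (\<integral>\<^sup>+y. (\<integral>\<^sup>+x. f y * indicator B (y/c - x) \<partial>lborel) \<partial>lborel)"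
  proof -
    have "norm (y - c * x) = norm (y/c - x)" for x y
    proof -
      have "y - c * x = c * (y/c - x)" using c0 by (simp add: field_simps)
      then show ?thesis using c by (simp add: norm_mult)
    qed
    then show ?thesis by (simp add: B_def indicator_def)
  qed
  also have "\<dots> = (\<integral>\<^sup>+y. f y * b \<partial>lborel)"
  proof (rule nn_integral_cong)
    fix y
    have "(\<integral>\<^sup>+x. f y * indicator B (y/c - x) \<partial>lborel) = f y * (\<integral>\<^sup>+x. indicator B (y/c - x) \<partial>lborel)"
      by (rule nn_integral_cmult) measurable
    also have "(\<integral>\<^sup>+x. indicator B (y/c - x) \<partial>lborel) = b"
      by (subst nn_integral_lborel_reflect) (auto simp: b_def)
    finally show "(\<integral>\<^sup>+x. f y * indicator B (y/c - x) \<partial>lborel) = f y * b" .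
  qed
  also have "\<dots> = (\<integral>\<^sup>+x. f x \<partial>lborel) * b"
    by (simp add: nn_integral_multc)
  finally show ?thesis
    using b ennreal_mult_cancel_left[of b "\<integral>\<^sup>+x. f (c * x) \<partial>lborel" "\<integral>\<^sup>+x. f x \<partial>lborel"]
    by (simp add: mult.commute)
qed

text \<open>Planar measure pushed forward under \<open>norm\<close> and the density
  \<open>2 * pi * r\<close> agree on the half-lines \<open>{..<a}\<close>, where one gives the area
  of a disk and the other an elementary integral. Half-lines are stable under intersection and
  generate the Borel sets.\<close>

lemma nn_integral_lborel_norm:
  fixes h :: "real \<Rightarrow> ennreal"
  assumes h: "h \<in> borel_measurable borel"
  shows "(\<integral>\<^sup>+z. h (norm z) \<partial>(lborel :: complex measure)) =
         (\<integral>\<^sup>+r\<in>{0..}. ennreal (2 * pi * r) * h r \<partial>lborel)"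
proof -
  let ?M = "distr (lborel :: complex measure) borel norm"
  let ?N = "density lborel (\<lambda>r::real. ennreal (2 * pi * r) * indicator {0..} r)"
  have Meq: "emeasure ?M {..<a} = ennreal (pi * (max 0 a)^2)" for a :: real
  proof -
    have "emeasure ?M {..<a} = emeasure lborel (ball (0::complex) a)"
      by (subst emeasure_distr) (auto simp: ball_def intro!: arg_cong[where f="emeasure lborel"])
    also have "\<dots> = ennreal (pi * (max 0 a)^2)"
    proof (cases "a \<ge> 0")
      case True
      have "measure lborel (ball (0::complex) a) = pi * a^2"
        using content_ball[of a "0::complex"] True
        by (simp add: unit_ball_vol_numeral unit_ball_vol_2)
      then show ?thesis using True
        by (subst emeasure_eq_ennreal_measure) (auto simp: emeasure_bounded_finite[THEN less_imp_neq, unfolded infinity_ennreal_def])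
    qed (auto simp: ball_empty)
    finally show ?thesis .
  qed
  have Neq: "emeasure ?N {..<a} = ennreal (pi * (max 0 a)^2)" for a :: real
  proof -
    have "emeasure ?N {..<a} = (\<integral>\<^sup>+r. ennreal (2 * pi * r) * indicator {0..} r * indicator {..<a} r \<partial>lborel)"
      by (subst emeasure_density) auto
    also have "\<dots> = (\<integral>\<^sup>+r. ennreal (2 * pi * r) * indicator {0..max 0 a} r \<partial>lborel)"
    proof (rule nn_integral_cong_AE)
      have "AE r in lborel. r \<noteq> max 0 a" by (rule AE_lborel_singleton)
      then show "AE x in lborel. ennreal (2 * pi * x) * indicator {0..} x * indicator {..<a} x =
                 ennreal (2 * pi * x) * indicator {0..max 0 a} x"
        by eventually_elim (auto simp: indicator_def max_def split: if_splits)
    qed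
    also have "\<dots> = ennreal (pi * (max 0 a)^2 - pi * 0^2)"
      by (rule nn_integral_FTC_Icc) (auto intro!: derivative_eq_intros simp: continuous_intros)
    finally show ?thesis by simp
  qed
  have "?M = ?N"
  proof (rule measure_eqI_generator_eq[of "range (\<lambda>a. {..<a})" UNIV _ _ "\<lambda>i. {..<real i}"])
    show "Int_stable (range (\<lambda>a::real. {..<a}))"
    proof -
      have "{..<a} \<inter> {..<b} = {..<min a b}" for a b :: real by auto
      then show ?thesis by (auto simp: Int_stable_def)
    qed
    show "sets ?M = sigma_sets UNIV (range (\<lambda>a::real. {..<a}))"
      by (simp, subst borel_Iio) simp
    show "sets ?N = sigma_sets UNIV (range (\<lambda>a::real. {..<a}))"
      by (simp, subst borel_Iio) simp
    show "(\<Union>i. {..<real i}) = UNIV"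
      using reals_Archimedean2 by auto
  qed (auto simp: Meq Neq)
  then have "(\<integral>\<^sup>+r. h r \<partial>?M) = (\<integral>\<^sup>+r. h r \<partial>?N)" by simp
  then show ?thesis using h
    by (simp add: nn_integral_distr nn_integral_density mult_ac)
qed

text \<open>Arc length on the unit circle, not normalised, so that polar coordinates carry no extra
  factor. The half-open interval makes rotations and cuttings into arcs exact.\<close>

definition circ :: "(complex \<Rightarrow> ennreal) \<Rightarrow> ennreal" where
  "circ g = (\<integral>\<^sup>+t\<in>{0..<2*pi}. g (cis t) \<partial>lborel)"

lemma nn_integral_real_translate:
  fixes f :: "real \<Rightarrow> ennreal"
  assumes "f \<in> borel_measurable borel"
  shows "(\<integral>\<^sup>+x. f (c + x) \<partial>lborel) = (\<integral>\<^sup>+x. f x \<partial>lborel)"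
proof -
  have "(\<integral>\<^sup>+x. f x \<partial>lborel) = (\<integral>\<^sup>+x. f x \<partial>(distr lborel borel ((+) c)))"
    by (simp add: lborel_distr_plus)
  also have "\<dots> = (\<integral>\<^sup>+x. f (c + x) \<partial>lborel)"
    using assms by (intro nn_integral_distr) auto
  finally show ?thesis ..
qed

lemma measurable_cis [measurable]: "cis \<in> borel_measurable borel"
  by (intro borel_measurable_continuous_onI continuous_intros)

lemma circ_rotate:
  assumes [measurable]: "g \<in> borel_measurable borel" and "norm c = 1"
  shows "circ (\<lambda>z. g (c * z)) = circ g"
proof -
  define b where "b = Arg2pi c"
  have b: "0 \<le> b" "b < 2*pi" "c = cis b"
    using Arg2pi_eq[of c] assms(2) Arg2pi_ge_0[of c] Arg2pi_lt_2pi[of c]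
    by (simp_all add: b_def cis_conv_exp)
  let ?f = "\<lambda>t. g (cis t)"
  have per: "?f (2*pi + t) = ?f t" for t
    by (simp add: cis_mult[symmetric])
  have "circ (\<lambda>z. g (c * z)) = (\<integral>\<^sup>+t. ?f (b + t) * indicator {0..<2*pi} t \<partial>lborel)"
    by (simp add: circ_def b cis_mult)
  also have "\<dots> = (\<integral>\<^sup>+t. ?f (b + t) * indicator {b..<b+2*pi} (b + t) \<partial>lborel)"
    by (intro nn_integral_cong) (auto simp: indicator_def)
  also have "\<dots> = (\<integral>\<^sup>+t. ?f t * indicator {b..<b+2*pi} t \<partial>lborel)"
    by (rule nn_integral_real_translate) measurable
  also have "\<dots> = (\<integral>\<^sup>+t. ?f t * indicator {b..<2*pi} t + ?f t * indicator {2*pi..<2*pi+b} t \<partial>lborel)"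
    using b by (intro nn_integral_cong) (auto simp: indicator_def)
  also have "\<dots> = (\<integral>\<^sup>+t. ?f t * indicator {b..<2*pi} t \<partial>lborel) + (\<integral>\<^sup>+t. ?f t * indicator {2*pi..<2*pi+b} t \<partial>lborel)"
    by (rule nn_integral_add) measurable
  \<comment> \<open>The part of the shifted arc beyond \<open>2 * pi\<close> is carried back by
    periodicity.\<close>
  also have "(\<integral>\<^sup>+t. ?f t * indicator {2*pi..<2*pi+b} t \<partial>lborel) = (\<integral>\<^sup>+t. ?f t * indicator {0..<b} t \<partial>lborel)"
  proof -
    have "(\<integral>\<^sup>+t. ?f t * indicator {2*pi..<2*pi+b} t \<partial>lborel) =
          (\<integral>\<^sup>+t. ?f (2*pi + t) * indicator {2*pi..<2*pi+b} (2*pi + t) \<partial>lborel)"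
      by (rule nn_integral_real_translate[symmetric]) measurable
    also have "\<dots> = (\<integral>\<^sup>+t. ?f t * indicator {0..<b} t \<partial>lborel)"
      unfolding per by (intro nn_integral_cong) (auto simp: indicator_def)
    finally show ?thesis .
  qed
  also have "(\<integral>\<^sup>+t. ?f t * indicator {b..<2*pi} t \<partial>lborel) + (\<integral>\<^sup>+t. ?f t * indicator {0..<b} t \<partial>lborel)
     = (\<integral>\<^sup>+t. ?f t * indicator {b..<2*pi} t + ?f t * indicator {0..<b} t \<partial>lborel)"
    by (rule nn_integral_add[symmetric]) measurable
  also have "\<dots> = circ g"
    unfolding circ_def using b by (intro nn_integral_cong) (auto simp: indicator_def)
  finally show ?thesis .
qed

lemma circ_eq_norm:
  assumes [measurable]: "g \<in> borel_measurable borel"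
  shows "circ (\<lambda>u. g (z * u)) = circ (\<lambda>u. g (of_real (norm z) * u))"
proof -
  define c where "c = (if z = 0 then 1 else sgn z)"
  have c: "norm c = 1" and z: "z = of_real (norm z) * c"
    by (auto simp: c_def norm_sgn sgn_eq norm_divide)
  have "circ (\<lambda>u. g (of_real (norm z) * (c * u))) = circ (\<lambda>u. g (of_real (norm z) * u))"
    by (rule circ_rotate[where g = "\<lambda>u. g (of_real (norm z) * u)"]) (auto simp: c)
  also have "(\<lambda>u. g (of_real (norm z) * (c * u))) = (\<lambda>u. g (z * u))"
    using z by (simp add: fun_eq_iff mult.assoc[symmetric])
  finally show ?thesis .
qed

lemma circ_measurable [measurable]:
  assumes [measurable]: "case_prod g \<in> borel_measurable (M \<Otimes>\<^sub>M borel)"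
  shows "(\<lambda>x. circ (g x)) \<in> borel_measurable M"
  unfolding circ_def by measurable

lemma circ_const [simp]: "circ (\<lambda>_. c) = ennreal (2 * pi) * c"
  by (simp add: circ_def nn_integral_cmult mult.commute)

lemma circ_mono: "(\<And>u. norm u = 1 \<Longrightarrow> f u \<le> g u) \<Longrightarrow> circ f \<le> circ g"
  unfolding circ_def by (intro nn_integral_mono mult_right_mono) auto

lemma circ_cong: "(\<And>u. norm u = 1 \<Longrightarrow> f u = g u) \<Longrightarrow> circ f = circ g"
  unfolding circ_def by (intro nn_integral_cong) auto

lemma circ_cmult:
  assumes [measurable]: "f \<in> borel_measurable borel"
  shows "circ (\<lambda>u. c * f u) = c * circ f"
  unfolding circ_def by (subst nn_integral_cmult[symmetric]) (auto simp: mult_ac)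

lemma circ_add:
  assumes [measurable]: "f \<in> borel_measurable borel" "g \<in> borel_measurable borel"
  shows "circ (\<lambda>u. f u + g u) = circ f + circ g"
  unfolding circ_def by (subst nn_integral_add[symmetric]) (auto simp: distrib_right)

text \<open>Rotation invariance allows \<open>g\<close> to be replaced by its average over
  rotations. This average depends on the norm only, so the formula for functions of the norm
  applies; the factor \<open>2 * pi\<close> of the averaging cancels.\<close>

theorem nn_integral_polar:
  fixes g :: "complex \<Rightarrow> ennreal"
  assumes g [measurable]: "g \<in> borel_measurable borel"
  shows "(\<integral>\<^sup>+z. g z \<partial>lborel) = (\<integral>\<^sup>+r\<in>{0..}. ennreal r * circ (\<lambda>u. g (of_real r * u)) \<partial>lborel)"
proof -
  have "ennreal (2*pi) * (\<integral>\<^sup>+z. g z \<partial>lborel) = circ (\<lambda>u. \<integral>\<^sup>+z. g z \<partial>lborel)"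
    by simp
  also have "\<dots> = circ (\<lambda>u. \<integral>\<^sup>+z. g (u * z) \<partial>lborel)"
    by (rule circ_cong) (simp add: nn_integral_lborel_rotate)
  also have "\<dots> = (\<integral>\<^sup>+t. (\<integral>\<^sup>+z. g (cis t * z) * indicator {0..<2*pi} t \<partial>lborel) \<partial>lborel)"
    by (simp add: circ_def nn_integral_multc)
  also have "\<dots> = (\<integral>\<^sup>+z. (\<integral>\<^sup>+t. g (cis t * z) * indicator {0..<2*pi} t \<partial>lborel) \<partial>lborel)"
    by (rule lborel_pair.Fubini') measurable
  also have "\<dots> = (\<integral>\<^sup>+z. circ (\<lambda>u. g (z * u)) \<partial>lborel)"
    by (simp add: circ_def mult.commute)
  also have "\<dots> = (\<integral>\<^sup>+z. circ (\<lambda>u. g (of_real (norm z) * u)) \<partial>(lborel :: complex measure))"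
    by (subst circ_eq_norm) auto
  also have "\<dots> = (\<integral>\<^sup>+r\<in>{0..}. ennreal (2 * pi * r) * circ (\<lambda>u. g (of_real r * u)) \<partial>lborel)"
    by (rule nn_integral_lborel_norm) measurable
  also have "\<dots> = (\<integral>\<^sup>+r. ennreal (2*pi) * (ennreal r * circ (\<lambda>u. g (of_real r * u)) * indicator {0..} r) \<partial>lborel)"
    by (intro nn_integral_cong) (auto simp: indicator_def ennreal_mult mult.assoc)
  also have "\<dots> = ennreal (2*pi) * (\<integral>\<^sup>+r\<in>{0..}. ennreal r * circ (\<lambda>u. g (of_real r * u)) \<partial>lborel)"
    by (rule nn_integral_cmult) measurable
  finally show ?thesis
    by (simp add: ennreal_mult_cancel_left)
qed

section \<open>Circle means of powers of holomorphic functions\<close>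

text \<open>Near a point where F_j does not vanish, F_j^q has a holomorphic branch. With phases
  aligned at an interior maximum z0, the sum H of these branches attains there the value of the
  whole sum and is dominated by it nearby, so H is constant by the maximum modulus principle. Terms
  vanishing at z0 are left out of H: they add nothing at z0 and only enlarge the sum
  elsewhere.\<close>

lemma sum_powr_max_principle:
  fixes F :: "nat \<Rightarrow> complex \<Rightarrow> complex" and q :: real
  assumes F: "\<And>j. j < n \<Longrightarrow> F j holomorphic_on ball 0 R"
    and q: "0 < q" and rho: "0 \<le> \<rho>" "\<rho> < R"
  obtains w where "norm w = \<rho>"
    "\<And>z. norm z \<le> \<rho> \<Longrightarrow> (\<Sum>j<n. norm (F j z) powr q) \<le> (\<Sum>j<n. norm (F j w) powr q)"
proof -
  define v where "v z = (\<Sum>j<n. norm (F j z) powr q)" for z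
  have contF: "continuous_on (ball 0 R) (F j)" if "j < n" for j
    using F[OF that] by (rule holomorphic_on_imp_continuous_on)
  have contv: "continuous_on (cball 0 \<rho>) v"
    unfolding v_def using rho q
    by (intro continuous_on_sum continuous_on_powr' continuous_on_norm continuous_on_const
        continuous_on_subset[OF contF]) auto
  obtain zm where zm: "norm zm \<le> \<rho>" "\<And>z. norm z \<le> \<rho> \<Longrightarrow> v z \<le> v zm"
    using continuous_attains_sup[OF compact_cball _ contv] rho by (auto simp: cball_eq_empty)
  define S where "S = {z \<in> cball 0 \<rho>. v z = v zm}"
  have "closed S"
    unfolding S_def using continuous_closed_preimage_constant[OF contv closed_cball] by simp
  then have "compact S"
    by (metis (no_types, lifting) S_def bounded_cball bounded_subset compact_eq_bounded_closed mem_Collect_eq subsetI)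
  moreover have "zm \<in> S" using zm by (auto simp: S_def)
  \<comment> \<open>Among the maximum points one of largest modulus is taken; the contradiction will
    be a maximum point still further out.\<close>
  ultimately obtain z0 where z0: "z0 \<in> S" "\<And>z. z \<in> S \<Longrightarrow> norm z \<le> norm z0"
    using continuous_attains_sup[of S norm] by (metis continuous_on_norm_id empty_iff)
  have "norm z0 = \<rho>"
  proof (rule ccontr)
    assume "norm z0 \<noteq> \<rho>"
    then have lt: "norm z0 < \<rho>" using z0 by (auto simp: S_def)
    define J where "J = {j. j < n \<and> F j z0 \<noteq> 0}"
    have finJ: "finite J" by (auto simp: J_def)
    have "\<forall>j\<in>J. \<exists>e>0. \<forall>z\<in>ball z0 e. F j z \<noteq> 0"
    proof
      fix j assume j: "j \<in> J"
      have "open (ball 0 R \<inter> F j -` (- {0}))"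
        using j by (intro continuous_open_preimage[OF contF]) (auto simp: J_def)
      moreover have "z0 \<in> ball 0 R \<inter> F j -` (- {0})"
        using j lt rho by (auto simp: J_def)
      ultimately obtain e where "e > 0" "ball z0 e \<subseteq> ball 0 R \<inter> F j -` (- {0})"
        unfolding open_contains_ball by blast
      then show "\<exists>e>0. \<forall>z\<in>ball z0 e. F j z \<noteq> 0" by blast
    qed
    then obtain e where e: "\<And>j. j \<in> J \<Longrightarrow> e j > 0" "\<And>j z. j \<in> J \<Longrightarrow> z \<in> ball z0 (e j) \<Longrightarrow> F j z \<noteq> 0"
      by metis
    define d where "d = Min (insert (\<rho> - norm z0) (e ` J))"
    have d: "d > 0" "d \<le> \<rho> - norm z0" "\<And>j. j \<in> J \<Longrightarrow> d \<le> e j"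
      using finJ e lt by (auto simp: d_def)
    have sub: "norm z < \<rho>" if "z \<in> ball z0 d" for z
    proof -
      have "norm z \<le> norm z0 + dist z0 z" by (metis dist_norm norm_minus_commute norm_triangle_sub)
      then show ?thesis using that d by auto
    qed
    have "\<exists>g. g holomorphic_on ball z0 d \<and> (\<forall>z\<in>ball z0 d. exp (g z) = F j z)" if "j \<in> J" for j
    proof -
      have "F j holomorphic_on ball z0 d"
        using that sub rho by (intro holomorphic_on_subset[OF F]) (force simp: J_def)+
      moreover have "\<And>z. z \<in> ball z0 d \<Longrightarrow> F j z \<noteq> 0"
        using e(2)[OF that] d(3)[OF that] by auto
      moreover have "z0 \<in> ball z0 d" using d by auto
      ultimately show ?thesis
        using holomorphic_logarithm_exists[OF convex_ball open_ball, of "F j" z0 d z0] by metis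
    qed
    then obtain g where g: "\<And>j. j \<in> J \<Longrightarrow> g j holomorphic_on ball z0 d"
      "\<And>j z. j \<in> J \<Longrightarrow> z \<in> ball z0 d \<Longrightarrow> exp (g j z) = F j z"
      by metis
    \<comment> \<open>Subtracting \<open>Im (g j z0)\<close> makes every summand a positive real at
      z0, so that no cancellation occurs there.\<close>
    define H where "H z = (\<Sum>j\<in>J. exp (of_real q * (g j z - \<i> * of_real (Im (g j z0)))))" for z
    have normH: "norm (exp (of_real q * (g j z - \<i> * of_real (Im (g j z0))))) = norm (F j z) powr q"
      if "j \<in> J" "z \<in> ball z0 d" for j z
    proof -
      have "norm (F j z) = exp (Re (g j z))" using g(2)[OF that] by (metis norm_exp_eq_Re)
      then show ?thesis by (simp add: norm_exp_eq_Re powr_def)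
    qed
    have vJ: "v z \<ge> (\<Sum>j\<in>J. norm (F j z) powr q)" for z
      unfolding v_def by (rule sum_mono2) (auto simp: J_def)
    have z0b: "z0 \<in> ball z0 d" using d by auto
    have "v z0 = (\<Sum>j\<in>J. norm (F j z0) powr q)"
      unfolding v_def by (rule sum.mono_neutral_right) (auto simp: J_def)
    also have "\<dots> = norm (H z0)"
    proof -
      have "exp (of_real q * (g j z0 - \<i> * of_real (Im (g j z0)))) = of_real (norm (F j z0) powr q)"
        if "j \<in> J" for j
      proof -
        have *: "g j z0 - \<i> * of_real (Im (g j z0)) = of_real (Re (g j z0))"
          by (simp add: complex_eq_iff)
        have "norm (F j z0) = exp (Re (g j z0))" using g(2)[OF that z0b] by (metis norm_exp_eq_Re)
        then show ?thesis unfolding * by (simp add: powr_def exp_of_real[symmetric])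
      qed
      then have "H z0 = of_real (\<Sum>j\<in>J. norm (F j z0) powr q)" by (simp add: H_def)
      then show ?thesis by (simp only: norm_of_real) (simp add: sum_nonneg)
    qed
    finally have vz0: "v z0 = norm (H z0)" .
    have Hv: "norm (H z) \<le> v z" if "z \<in> ball z0 d" for z
    proof -
      have "norm (H z) \<le> (\<Sum>j\<in>J. norm (F j z) powr q)"
        unfolding H_def by (rule order_trans[OF norm_sum]) (intro sum_mono eq_refl normH that)
      then show ?thesis using vJ[of z] by simp
    qed
    have vmax: "v z \<le> v z0" if "z \<in> ball z0 d" for z
      using zm(2)[of z] sub[OF that] z0(1) by (simp add: S_def)
    have "H constant_on ball z0 d"
    proof (rule maximum_modulus_principle[OF _ open_ball connected_ball open_ball order_refl z0b])
      show "H holomorphic_on ball z0 d"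
        unfolding H_def by (intro holomorphic_intros g)
      show "norm (H z) \<le> norm (H z0)" if "z \<in> ball z0 d" for z
        using Hv[OF that] vmax[OF that] vz0 by simp
    qed
    then have Hc: "H z = H z0" if "z \<in> ball z0 d" for z
      using that z0b by (metis constant_on_def)
    define c where "c = (if z0 = 0 then 1 else sgn z0)"
    have c: "norm c = 1" "z0 = of_real (norm z0) * c"
      by (auto simp: c_def norm_sgn sgn_eq norm_divide)
    define z1 where "z1 = z0 + of_real (d/2) * c"
    have z1b: "z1 \<in> ball z0 d" using d c by (simp add: z1_def dist_norm norm_mult)
    have "z1 = of_real (norm z0 + d/2) * c"
      unfolding z1_def by (subst c(2)) (simp add: algebra_simps)
    then have "norm z1 = norm z0 + d/2"
      using d c by (simp only: norm_mult norm_of_real) simp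
    moreover have "z1 \<in> S"
      using Hv[OF z1b] Hc[OF z1b] vmax[OF z1b] vz0 sub[OF z1b] z0(1) by (auto simp: S_def)
    ultimately show False using z0(2)[of z1] d by auto
  qed
  moreover have "v z \<le> v z0" if "norm z \<le> \<rho>" for z
    using zm(2)[OF that] z0(1) by (simp add: S_def)
  ultimately show ?thesis using that[of z0] unfolding v_def by blast
qed

lemma norm_one_minus_cis_le: "norm (1 - cis s) \<le> \<bar>s\<bar>"
  using dist_exp_i_1[of s] abs_sin_x_le_abs_x[of "s/2"]
  by (simp add: cis_conv_exp norm_minus_commute)

lemma circ_split:
  assumes [measurable]: "g \<in> borel_measurable borel" and N: "0 < N"
  shows "circ g = (\<integral>\<^sup>+s\<in>{0..<2*pi/real N}. (\<Sum>j<N. g (cis s * cis (real j * (2*pi/real N)))) \<partial>lborel)"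
proof -
  define h where "h = 2*pi/real N"
  have h: "h > 0" "real N * h = 2*pi" using N by (auto simp: h_def)
  have ind: "indicator {0..<real n * h} t = (\<Sum>j<n. indicator {real j * h..<real j * h + h} t :: ennreal)" for t n
  proof (induction n)
    case (Suc n)
    have "0 \<le> h * real n" using h by simp
    then have "{0..<real (Suc n) * h} = {0..<real n * h} \<union> {real n * h..<real n * h + h}"
      using h by (subst ivl_disj_un_two(3)) (simp_all add: algebra_simps)
    then have "indicator {0..<real (Suc n) * h} t =
        (indicator {0..<real n * h} t + indicator {real n * h..<real n * h + h} t :: ennreal)"
      by (auto simp: indicator_def)
    then show ?case using Suc by simp
  qed simp
  have "circ g = (\<integral>\<^sup>+t. (\<Sum>j<N. g (cis t) * indicator {real j * h..<real j * h + h} t) \<partial>lborel)"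
    unfolding circ_def h(2)[symmetric] ind by (simp add: sum_distrib_left)
  also have "\<dots> = (\<Sum>j<N. \<integral>\<^sup>+t. g (cis t) * indicator {real j * h..<real j * h + h} t \<partial>lborel)"
    by (rule nn_integral_sum) measurable
  also have "\<dots> = (\<Sum>j<N. \<integral>\<^sup>+t. g (cis (real j * h + t)) * indicator {real j * h..<real j * h + h} (real j * h + t) \<partial>lborel)"
    by (intro sum.cong refl nn_integral_real_translate[symmetric]) measurable
  also have "\<dots> = (\<Sum>j<N. \<integral>\<^sup>+t. g (cis t * cis (real j * h)) * indicator {0..<h} t \<partial>lborel)"
    by (intro sum.cong nn_integral_cong refl arg_cong2[where f="(*)"]) (auto simp: indicator_def cis_mult add.commute)
  also have "\<dots> = (\<integral>\<^sup>+t. (\<Sum>j<N. g (cis t * cis (real j * h)) * indicator {0..<h} t) \<partial>lborel)"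
    by (rule nn_integral_sum[symmetric]) measurable
  finally show ?thesis by (simp add: h_def sum_distrib_right)
qed

text \<open>By \<open>circ_split\<close>, both circle means are averages over \<open>s\<close> of the sums of \<open>|F|\<^sup>q\<close> over
  rotated regular \<open>N\<close>-gons, to which the maximum principle applies.\<close>

lemma circ_powr_mono:
  fixes F :: "complex \<Rightarrow> complex" and q :: real
  assumes F: "F holomorphic_on ball 0 R" and q: "0 < q" and w: "norm w \<le> \<rho>" and rho: "\<rho> < R"
  shows "circ (\<lambda>u. ennreal (norm (F (w * u)) powr q)) \<le> circ (\<lambda>u. ennreal (norm (F (of_real \<rho> * u)) powr q))"
proof -
  have rho0: "0 \<le> \<rho>" using w norm_ge_zero order_trans by blast
  define g where "g z = norm (F z) powr q" for z
  \<comment> \<open>Outside the ball nothing is known about \<open>F\<close>. The cut-off function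
    is Borel and agrees with the integrand on all circles in question.\<close>
  define G where "G z = (if norm z \<le> \<rho> then ennreal (g z) else 0)" for z
  have contF: "continuous_on (ball 0 R) F"
    using F by (rule holomorphic_on_imp_continuous_on)
  have contg: "continuous_on (cball 0 \<rho>) g"
    unfolding g_def using rho q
    by (intro continuous_on_powr' continuous_on_norm continuous_on_const continuous_on_subset[OF contF]) auto
  have G[measurable]: "G \<in> borel_measurable borel"
  proof -
    have "(\<lambda>z. indicator (cball 0 \<rho>) z *\<^sub>R g z) \<in> borel_measurable borel"
      by (rule borel_measurable_continuous_on_indicator[OF _ contg]) simp
    then have "(\<lambda>z. ennreal (indicator (cball 0 \<rho>) z *\<^sub>R g z)) \<in> borel_measurable borel"
      by measurable
    also have "(\<lambda>z. ennreal (indicator (cball 0 \<rho>) z *\<^sub>R g z)) = G"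
      by (auto simp: G_def fun_eq_iff indicator_def)
    finally show ?thesis .
  qed
  have eq: "circ (\<lambda>u. ennreal (norm (F (z * u)) powr q)) = circ (\<lambda>u. G (z * u))" if "norm z \<le> \<rho>" for z
    using that by (intro circ_cong) (auto simp: G_def g_def norm_mult)
  have rot: "circ (\<lambda>u. G (z * u)) = circ (\<lambda>u. G (of_real \<rho> * u))" if "norm z = \<rho>" for z
    using circ_eq_norm[OF G, of z] that by simp
  have "circ (\<lambda>u. G (w * u)) \<le> circ (\<lambda>u. G (of_real \<rho> * u))"
  proof (rule ennreal_le_epsilon)
    fix e :: real assume e: "0 < e"
    have "uniformly_continuous_on (cball 0 \<rho>) g"
      by (rule compact_uniformly_continuous[OF contg compact_cball])
    then obtain d where d: "d > 0" "\<And>x y. norm x \<le> \<rho> \<Longrightarrow> norm y \<le> \<rho> \<Longrightarrow> norm (x - y) < d \<Longrightarrow> \<bar>g x - g y\<bar> < e / (2*pi)"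
      unfolding uniformly_continuous_on_def using e
      by (metis dist_norm divide_pos_pos mem_cball_0 mult_pos_pos pi_gt_zero real_norm_def zero_less_numeral)
    obtain N where N: "2*pi*\<rho> / d < real N" "0 < N"
      by (metis gr_zeroI less_le_trans not_less of_nat_0 reals_Archimedean2 divide_nonneg_pos d(1) mult_nonneg_nonneg pi_ge_zero rho0 zero_le_numeral)
    define h where "h = 2*pi/real N"
    have h: "h > 0" "real N * h = 2*pi" "\<rho> * h < d"
      using N d by (auto simp: h_def field_simps)
    define c where "c j = cis (real j * h)" for j
    have nc: "norm (c j) = 1" for j by (simp add: c_def)
    have holo: "(\<lambda>z. F (z * c j)) holomorphic_on ball 0 R" for j
      by (rule holomorphic_on_compose_gen[OF _ F, unfolded o_def]) (auto intro!: holomorphic_intros simp: norm_mult nc)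
    obtain w' where w': "norm w' = \<rho>"
      "\<And>z. norm z \<le> \<rho> \<Longrightarrow> (\<Sum>j<N. norm (F (z * c j)) powr q) \<le> (\<Sum>j<N. norm (F (w' * c j)) powr q)"
      using sum_powr_max_principle[where F = "\<lambda>j z. F (z * c j)" and n = N, OF holo q rho0 rho] by metis
    \<comment> \<open>The maximising polygon through \<open>w'\<close> stays fixed while the one
      through \<open>w\<close> turns by s. Turning \<open>w'\<close> as well moves each vertex by
      less than d and costs at most \<open>e / (2 * pi)\<close> per vertex; over N vertices and an
      arc of length h the costs add up to e.\<close>
    have le: "(\<Sum>j<N. G (w * (cis s * c j))) \<le> (\<Sum>j<N. G (w' * (cis s * c j))) + ennreal (real N * (e/(2*pi)))"
      if s: "0 \<le> s" "s < h" for s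
    proof -
      have 1: "(\<Sum>j<N. g (w * cis s * c j)) \<le> (\<Sum>j<N. g (w' * c j))"
        unfolding g_def using w'(2)[of "w * cis s"] w by (simp add: norm_mult)
      have "(\<Sum>j<N. g (w' * c j)) \<le> (\<Sum>j<N. g (w' * cis s * c j) + e/(2*pi))"
      proof (rule sum_mono)
        fix j
        have "norm (w' * c j - w' * cis s * c j) = \<rho> * norm (1 - cis s)"
        proof -
          have "w' * c j - w' * cis s * c j = w' * c j * (1 - cis s)" by (simp add: algebra_simps)
          then show ?thesis by (simp only: norm_mult nc w' mult_1_right)
        qed
        also have "norm (1 - cis s) \<le> s"
          using norm_one_minus_cis_le[of s] s by simp
        also have "\<rho> * s \<le> \<rho> * h" using s rho0 by (intro mult_left_mono) auto
        also have "\<dots> < d" using h by simp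
        finally have "norm (w' * c j - w' * cis s * c j) < d" using rho0 by (simp add: mult_left_mono)
        then show "g (w' * c j) \<le> g (w' * cis s * c j) + e/(2*pi)"
          using d(2)[of "w' * c j" "w' * cis s * c j"] by (simp add: norm_mult nc w')
      qed
      then have 2: "(\<Sum>j<N. g (w * cis s * c j)) \<le> (\<Sum>j<N. g (w' * cis s * c j)) + real N * (e/(2*pi))"
        using 1 by (simp add: sum.distrib)
      have G1: "(\<Sum>j<N. G (z * (cis s * c j))) = ennreal (\<Sum>j<N. g (z * cis s * c j))" if "norm z \<le> \<rho>" for z
        using that by (subst sum_ennreal[symmetric]) (auto simp: G_def g_def norm_mult nc mult.assoc)
      show ?thesis
        using 2 w w'(1) e
        by (simp add: G1 ennreal_plus[symmetric] sum_nonneg g_def del: ennreal_plus)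
    qed
    have "circ (\<lambda>u. G (w * u)) = (\<integral>\<^sup>+s\<in>{0..<h}. (\<Sum>j<N. G (w * (cis s * c j))) \<partial>lborel)"
      unfolding h_def c_def by (rule circ_split[OF _ N(2)]) measurable
    also have "\<dots> \<le> (\<integral>\<^sup>+s. (\<Sum>j<N. G (w' * (cis s * c j))) * indicator {0..<h} s
         + ennreal (real N * (e/(2*pi))) * indicator {0..<h} s \<partial>lborel)"
    proof (rule nn_integral_mono)
      fix s show "(\<Sum>j<N. G (w * (cis s * c j))) * indicator {0..<h} s
         \<le> (\<Sum>j<N. G (w' * (cis s * c j))) * indicator {0..<h} s + ennreal (real N * (e/(2*pi))) * indicator {0..<h} s"
        using le[of s] by (auto simp: indicator_def)
    qed
    also have "\<dots> = (\<integral>\<^sup>+s\<in>{0..<h}. (\<Sum>j<N. G (w' * (cis s * c j))) \<partial>lborel) + ennreal (real N * (e/(2*pi))) * ennreal h"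
      using h by (subst nn_integral_add) (auto simp: nn_integral_cmult)
    also have "(\<integral>\<^sup>+s\<in>{0..<h}. (\<Sum>j<N. G (w' * (cis s * c j))) \<partial>lborel) = circ (\<lambda>u. G (w' * u))"
      unfolding h_def c_def by (rule circ_split[OF _ N(2), symmetric]) measurable
    also have "ennreal (real N * (e/(2*pi))) * ennreal h = ennreal e"
    proof -
      have "real N * (e/(2*pi)) * h = e"
        using h(2) pi_gt_zero by (metis (no_types, opaque_lifting) divide_self_if eq_divide_eq less_numeral_extra(3) mult.commute mult.assoc mult_eq_0_iff nonzero_mult_div_cancel_left times_divide_eq_right zero_neq_numeral)
      then show ?thesis using e h by (simp add: ennreal_mult'[symmetric])
    qed
    finally show "circ (\<lambda>u. G (w * u)) \<le> circ (\<lambda>u. G (of_real \<rho> * u)) + ennreal e"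
      using rot[OF w'(1)] by simp
  qed
  then show ?thesis using eq[OF w] eq[of "of_real \<rho>"] rho0 by simp
qed

section \<open>Disk integrals with a radial weight, and the kernel\<close>

text \<open>Values outside the disk are arbitrary, perhaps not even measurable. Extended by 0, a
  function continuous on the disk becomes Borel.\<close>

definition on_disk :: "(complex \<Rightarrow> real) \<Rightarrow> complex \<Rightarrow> ennreal" where
  "on_disk G z = (if norm z < 1 then ennreal (G z) else 0)"

definition cmean :: "(complex \<Rightarrow> real) \<Rightarrow> real \<Rightarrow> ennreal" where
  "cmean G r = circ (\<lambda>u. on_disk G (of_real r * u))"

definition disk_int :: "(real \<Rightarrow> real) \<Rightarrow> (complex \<Rightarrow> real) \<Rightarrow> ennreal" where
  "disk_int w G = (\<integral>\<^sup>+r\<in>{0..<1}. ennreal (w r * r) * cmean G r \<partial>lborel)"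

text \<open>The kernel P_a. Its numerator keeps the circle means below \<open>2 * pi\<close>,
  uniformly in a.\<close>

definition pk :: "complex \<Rightarrow> complex \<Rightarrow> real" where
  "pk a z = (1 - norm a) / (norm (1 - cnj a * z))\<^sup>2"

lemma measurable_cutoff:
  fixes G :: "complex \<Rightarrow> real"
  assumes "open S" "continuous_on S G"
  shows "(\<lambda>z. if z \<in> S then ennreal (G z) else 0) \<in> borel_measurable borel"
proof -
  have "(\<lambda>z. indicator S z *\<^sub>R G z) \<in> borel_measurable borel"
    by (rule borel_measurable_continuous_on_indicator[OF _ assms(2)]) (use assms in auto)
  then have "(\<lambda>z. ennreal (indicator S z *\<^sub>R G z)) \<in> borel_measurable borel"
    by measurable
  also have "(\<lambda>z. ennreal (indicator S z *\<^sub>R G z)) = (\<lambda>z. if z \<in> S then ennreal (G z) else 0)"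
    by (auto simp: fun_eq_iff indicator_def)
  finally show ?thesis .
qed

lemma on_disk_measurable:
  "continuous_on unit_disk G \<Longrightarrow> on_disk G \<in> borel_measurable borel"
  using measurable_cutoff[of unit_disk G] by (simp add: on_disk_def[abs_def])

lemma cmean_measurable:
  assumes "continuous_on unit_disk G"
  shows "cmean G \<in> borel_measurable borel"
  unfolding cmean_def[abs_def] using on_disk_measurable[OF assms, measurable] by measurable

lemma continuous_on_norm_powr:
  fixes f :: "complex \<Rightarrow> complex"
  assumes "f holomorphic_on S" "0 < q"
  shows "continuous_on S (\<lambda>z. norm (f z) powr q)"
  using assms(2) holomorphic_on_imp_continuous_on[OF assms(1)]
  by (intro continuous_on_powr' continuous_on_norm continuous_on_const) auto

lemma kernel_nonzero: "norm a < 1 \<Longrightarrow> norm z < 1 \<Longrightarrow> 1 - cnj a * z \<noteq> 0"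
proof
  assume "norm a < 1" "norm z < 1" "1 - cnj a * z = 0"
  then have "norm (cnj a * z) = 1" by (metis eq_iff_diff_eq_0 norm_one)
  moreover have "norm a * norm z < 1 * 1"
    using \<open>norm a < 1\<close> \<open>norm z < 1\<close> by (intro mult_strict_mono') auto
  ultimately show False by (simp add: norm_mult)
qed

lemma norm_kernel_ge:
  assumes "norm a < 1" "norm z < 1"
  shows "1 - norm z \<le> norm (1 - cnj a * z)" "1 - norm a \<le> norm (1 - cnj a * z)"
proof -
  have "1 - norm (cnj a * z) \<le> norm (1 - cnj a * z)"
    using norm_triangle_ineq2[of 1 "cnj a * z"] by simp
  moreover have "norm (cnj a * z) \<le> norm z"
    using assms by (simp add: norm_mult mult_left_le_one_le)
  moreover have "norm (cnj a * z) \<le> norm a"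
    using assms by (simp add: norm_mult mult_left_le mult.commute)
  ultimately show "1 - norm z \<le> norm (1 - cnj a * z)" "1 - norm a \<le> norm (1 - cnj a * z)"
    by auto
qed

lemma pk_nonneg: "norm a < 1 \<Longrightarrow> 0 \<le> pk a z"
  by (simp add: pk_def)

lemma continuous_on_pk: "norm a < 1 \<Longrightarrow> continuous_on unit_disk (pk a)"
  unfolding pk_def[abs_def] by (intro continuous_intros) (auto dest: kernel_nonzero)

text \<open>A Harnack inequality: as |a| < 1, moving z by at most A times |1 - cnj a z| multiplies
  this quantity by at most 1 + A. The kernel is carried between nearby points by this bound.\<close>

lemma pk_compare:
  assumes "norm a < 1" "norm z < 1" "norm w < 1" "norm (z - w) \<le> A * norm (1 - cnj a * z)" "0 \<le> A"
  shows "pk a z \<le> (1 + A)\<^sup>2 * pk a w"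
proof -
  have pz: "norm (1 - cnj a * z) > 0" and pw: "norm (1 - cnj a * w) > 0"
    using assms kernel_nonzero by auto
  have "1 - cnj a * w = (1 - cnj a * z) + cnj a * (z - w)" by (simp add: algebra_simps)
  then have "norm (1 - cnj a * w) \<le> norm (1 - cnj a * z) + norm (cnj a * (z - w))"
    by (metis norm_triangle_ineq)
  also have "norm (cnj a * (z - w)) \<le> norm (z - w)"
    using assms by (simp add: norm_mult mult_left_le_one_le)
  also note assms(4)
  finally have "norm (1 - cnj a * w) \<le> (1 + A) * norm (1 - cnj a * z)" by (simp add: algebra_simps)
  then have "(norm (1 - cnj a * w))\<^sup>2 \<le> ((1 + A) * norm (1 - cnj a * z))\<^sup>2"
    by (rule power_mono) simp
  then have "(1 - norm a) * (norm (1 - cnj a * w))\<^sup>2 \<le> (1 - norm a) * ((1 + A)\<^sup>2 * (norm (1 - cnj a * z))\<^sup>2)"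
    using assms by (intro mult_left_mono) (auto simp: power_mult_distrib)
  then show ?thesis using pz pw by (simp add: pk_def field_simps)
qed

text \<open>The values \<open>1 - cnj a * z\<close> lie in the right half-plane, so their power with
  exponent \<open>- 2 / q\<close> has a holomorphic branch on the disk.\<close>

lemma pk_root:
  assumes a: "norm a < 1" and q: "0 < q"
  obtains h where "h holomorphic_on unit_disk" "\<And>z. norm z < 1 \<Longrightarrow> norm (h z) powr q = pk a z"
proof -
  define p where "p = 1/q"
  define h where "h z = exp (of_real p * (of_real (ln (1 - norm a)) - 2 * Ln (1 - cnj a * z)))" for z
  have re: "Re (1 - cnj a * z) > 0" if "norm z < 1" for z
  proof -
    have "Re (cnj a * z) \<le> norm (cnj a * z)" by (rule complex_Re_le_cmod)
    also have "\<dots> = norm a * norm z" by (simp add: norm_mult)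
    also have "\<dots> \<le> norm a" using that by (intro mult_left_le) auto
    also note a
    finally show ?thesis by simp
  qed
  then have nr: "1 - cnj a * z \<notin> \<real>\<^sub>\<le>\<^sub>0" if "norm z < 1" for z
    using that by (meson complex_nonpos_Reals_iff not_le)
  have "h holomorphic_on unit_disk"
    unfolding h_def by (intro holomorphic_intros nr) simp
  moreover have "norm (h z) powr q = pk a z" if "norm z < 1" for z
  proof -
    have n0: "1 - cnj a * z \<noteq> 0" using kernel_nonzero[OF a that] .
    have "norm (h z) = exp (p * (ln (1 - norm a) - 2 * ln (norm (1 - cnj a * z))))"
      unfolding h_def norm_exp_eq_Re using n0 by (simp add: Re_Ln)
    then have "norm (h z) powr q = exp (ln (1 - norm a) - (ln (norm (1 - cnj a * z)) + ln (norm (1 - cnj a * z))))"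
      using q by (simp add: powr_def p_def)
    also have "\<dots> = exp (ln (1 - norm a)) / (exp (ln (norm (1 - cnj a * z))) * exp (ln (norm (1 - cnj a * z))))"
      by (simp only: exp_diff exp_add)
    also have "\<dots> = pk a z"
    proof -
      have "exp (ln (norm (1 - cnj a * z))) = norm (1 - cnj a * z)" using n0 by (metis exp_ln zero_less_norm_iff)
      moreover have "exp (ln (1 - norm a)) = 1 - norm a" using a by simp
      ultimately show ?thesis by (simp only: pk_def power2_eq_square)
    qed
    finally show ?thesis .
  qed
  ultimately show ?thesis by (rule that)
qed

text \<open>The circle may start at any point \<open>w\<close> of the closed disk of radius
  \<open>\<rho>\<close>, which is what area integrals over sets off the real axis need.\<close>

lemma circ_pk_mono:
  assumes f: "f holomorphic_on unit_disk" and q: "0 < q" and a: "norm a < 1"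
    and w: "norm w \<le> \<rho>" and rho: "\<rho> < 1"
  shows "circ (\<lambda>u. on_disk (\<lambda>z. norm (f z) powr q * pk a z) (w * u)) \<le> cmean (\<lambda>z. norm (f z) powr q * pk a z) \<rho>"
proof -
  obtain h where h: "h holomorphic_on unit_disk" "\<And>z. norm z < 1 \<Longrightarrow> norm (h z) powr q = pk a z"
    using pk_root[OF a q] by blast
  have rho0: "0 \<le> \<rho>" using w norm_ge_zero order_trans by blast
  have eq: "circ (\<lambda>u. on_disk (\<lambda>z. norm (f z) powr q * pk a z) (v * u)) = circ (\<lambda>u. ennreal (norm (f (v * u) * h (v * u)) powr q))"
    if "norm v \<le> \<rho>" for v
    using that rho by (intro circ_cong) (simp add: on_disk_def norm_mult powr_mult h(2))
  have "circ (\<lambda>u. ennreal (norm (f (w * u) * h (w * u)) powr q)) \<le> circ (\<lambda>u. ennreal (norm (f (of_real \<rho> * u) * h (of_real \<rho> * u)) powr q))"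
    using circ_powr_mono[where F = "\<lambda>z. f z * h z" and R = 1, OF holomorphic_on_mult[OF f h(1)] q w rho] .
  then show ?thesis using eq[OF w] eq[of "of_real \<rho>"] rho0 by (simp add: cmean_def)
qed

section \<open>Sub-mean value and Cauchy estimates; circle means of the kernel\<close>

text \<open>The circle of radius 0 is compared with all circles around z and the result is
  integrated over the radius; hence the constant 1 for every positive q.\<close>

lemma submean_area:
  assumes f: "f holomorphic_on ball z \<delta>" and q: "0 < q" and d: "0 < \<delta>"
  shows "ennreal (pi * \<delta>\<^sup>2) * ennreal (norm (f z) powr q) \<le> (\<integral>\<^sup>+w\<in>ball z \<delta>. ennreal (norm (f w) powr q) \<partial>lborel)"
proof -
  let ?G = "\<lambda>w. if w \<in> ball z \<delta> then ennreal (norm (f w) powr q) else 0"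
  have [measurable]: "?G \<in> borel_measurable borel"
    by (rule measurable_cutoff[OF open_ball continuous_on_norm_powr[OF f q]])
  have hol: "(\<lambda>w. f (z + w)) holomorphic_on ball 0 \<delta>"
    by (rule holomorphic_on_compose_gen[OF _ f, unfolded o_def]) (auto intro!: holomorphic_intros simp: dist_norm)
  have "(\<integral>\<^sup>+w\<in>ball z \<delta>. ennreal (norm (f w) powr q) \<partial>lborel) = (\<integral>\<^sup>+w. ?G w \<partial>lborel)"
    by (intro nn_integral_cong) auto
  also have "\<dots> = (\<integral>\<^sup>+w. ?G (z + w) \<partial>lborel)"
    by (rule nn_integral_lborel_translate[symmetric]) measurable
  also have "\<dots> = (\<integral>\<^sup>+r\<in>{0..}. ennreal r * circ (\<lambda>u. ?G (z + of_real r * u)) \<partial>lborel)"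
    by (rule nn_integral_polar) measurable
  also have "\<dots> \<ge> (\<integral>\<^sup>+r\<in>{0..<\<delta>}. ennreal r * (ennreal (2*pi) * ennreal (norm (f z) powr q)) \<partial>lborel)"
  proof (rule nn_integral_mono)
    fix r :: real
    have "ennreal (2*pi) * ennreal (norm (f z) powr q) \<le> circ (\<lambda>u. ?G (z + of_real r * u))" if r: "0 \<le> r" "r < \<delta>"
    proof -
      have "ennreal (2*pi) * ennreal (norm (f z) powr q) = circ (\<lambda>u. ennreal (norm (f (z + 0 * u)) powr q))"
        by simp
      also have "\<dots> \<le> circ (\<lambda>u. ennreal (norm (f (z + of_real r * u)) powr q))"
        by (rule circ_powr_mono[OF hol q]) (use r in auto)
      also have "\<dots> = circ (\<lambda>u. ?G (z + of_real r * u))"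
        using r by (intro circ_cong) (simp add: dist_norm norm_mult)
      finally show ?thesis .
    qed
    then show "ennreal r * (ennreal (2*pi) * ennreal (norm (f z) powr q)) * indicator {0..<\<delta>} r
        \<le> ennreal r * circ (\<lambda>u. ?G (z + of_real r * u)) * indicator {0..} r"
      by (auto simp: indicator_def intro!: mult_left_mono)
  qed
  also have "(\<integral>\<^sup>+r\<in>{0..<\<delta>}. ennreal r * (ennreal (2*pi) * ennreal (norm (f z) powr q)) \<partial>lborel)
     = (\<integral>\<^sup>+r. ennreal (norm (f z) powr q) * (ennreal (2*pi*r) * indicator {0..\<delta>} r) \<partial>lborel)"
  proof (rule nn_integral_cong_AE)
    have "AE r in lborel. r \<noteq> \<delta>" by (rule AE_lborel_singleton)
    then show "AE r in lborel. ennreal r * (ennreal (2*pi) * ennreal (norm (f z) powr q)) * indicator {0..<\<delta>} r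
       = ennreal (norm (f z) powr q) * (ennreal (2*pi*r) * indicator {0..\<delta>} r)"
      by eventually_elim (auto simp: indicator_def ennreal_mult mult_ac)
  qed
  also have "\<dots> = ennreal (norm (f z) powr q) * (\<integral>\<^sup>+r. ennreal (2*pi*r) * indicator {0..\<delta>} r \<partial>lborel)"
    by (rule nn_integral_cmult) measurable
  also have "(\<integral>\<^sup>+r. ennreal (2*pi*r) * indicator {0..\<delta>} r \<partial>lborel) = ennreal (pi * \<delta>\<^sup>2 - pi * 0\<^sup>2)"
    using d by (intro nn_integral_FTC_Icc) (auto intro!: derivative_eq_intros)
  finally show ?thesis by (simp add: mult.commute)
qed

text \<open>On the circle of radius \<open>\<delta> / 2\<close> around z, |f|^q is bounded by its
  means over balls of radius \<open>\<delta> / 2\<close>, all inside the given ball, and Cauchy's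
  estimate follows. Halving the radius accounts for \<open>2 powr (m*q)\<close> and for the 4 in
  \<open>4/pi\<close>.\<close>

lemma higher_deriv_submean:
  assumes f: "f holomorphic_on ball z \<delta>" and q: "0 < q" and d: "0 < \<delta>"
  shows "ennreal (norm ((deriv ^^ m) f z) powr q) \<le>
    ennreal (fact m powr q * 2 powr (m*q) * (4/pi) * \<delta> powr (- (m*q)) / \<delta>\<^sup>2) * (\<integral>\<^sup>+w\<in>ball z \<delta>. ennreal (norm (f w) powr q) \<partial>lborel)"
proof -
  let ?C = "fact m powr q * 2 powr (m*q) * (4/pi) * \<delta> powr (- (m*q)) / \<delta>\<^sup>2"
  define I where "I = (\<integral>\<^sup>+w\<in>ball z \<delta>. ennreal (norm (f w) powr q) \<partial>lborel)"
  have C: "?C > 0" using d by (simp add: powr_gt_zero)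
  show ?thesis
  proof (cases "I = \<infinity>")
    case True
    moreover have "ennreal ?C \<noteq> 0" using C ennreal_eq_0_iff[of ?C] by linarith
    ultimately have "ennreal ?C * I = \<infinity>"
      by (simp only: ennreal_mult_eq_top_iff infinity_ennreal_def) blast
    then show ?thesis unfolding I_def by simp
  next
    case False
    then obtain J where J: "I = ennreal J" "J \<ge> 0"
      by (cases I) auto
    define B where "B = (4 * J / (pi * \<delta>\<^sup>2)) powr (1/q)"
    have "norm (f w) \<le> B" if w: "norm (z - w) = \<delta>/2" for w
    proof -
      have sub: "ball w (\<delta>/2) \<subseteq> ball z \<delta>"
      proof
        fix x assume "x \<in> ball w (\<delta>/2)"
        then show "x \<in> ball z \<delta>" using w dist_triangle[of z x w] by (simp add: dist_norm)
      qed
      have "ennreal (pi * (\<delta>/2)\<^sup>2) * ennreal (norm (f w) powr q) \<le> (\<integral>\<^sup>+x\<in>ball w (\<delta>/2). ennreal (norm (f x) powr q) \<partial>lborel)"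
        using d by (intro submean_area holomorphic_on_subset[OF f sub] q) auto
      also have "\<dots> \<le> I" unfolding I_def
        using sub by (intro nn_integral_mono) (auto simp: indicator_def)
      finally have "ennreal (pi * (\<delta>/2)\<^sup>2 * norm (f w) powr q) \<le> ennreal J"
        unfolding J by (subst ennreal_mult'') auto
      then have "pi * (\<delta>/2)\<^sup>2 * norm (f w) powr q \<le> J"
        using J by simp
      then have "norm (f w) powr q \<le> 4 * J / (pi * \<delta>\<^sup>2)"
        using d by (simp add: field_simps power2_eq_square)
      then have "(norm (f w) powr q) powr (1/q) \<le> B"
        unfolding B_def using q by (intro powr_mono2) auto
      then show ?thesis using q by (simp add: powr_powr)
    qed
    then have "norm ((deriv ^^ m) f z) \<le> fact m * B / (\<delta>/2)^m"
      using d by (intro Cauchy_inequality holomorphic_on_subset[OF f]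
           holomorphic_on_imp_continuous_on[OF holomorphic_on_subset[OF f]]) (auto simp: subset_iff)
    then have "norm ((deriv ^^ m) f z) powr q \<le> (fact m * B / (\<delta>/2)^m) powr q"
      using q by (intro powr_mono2) auto
    also have "\<dots> = ?C * J"
    proof -
      have "((\<delta>/2)^m) powr q = \<delta> powr (m*q) / 2 powr (m*q)"
        using d by (simp add: powr_realpow[symmetric] powr_powr powr_divide)
      moreover have "B powr q = 4 * J / (pi * \<delta>\<^sup>2)"
        unfolding B_def using q J by (simp add: powr_powr)
      moreover have "(fact m * B / (\<delta>/2)^m) powr q = fact m powr q * B powr q / ((\<delta>/2)^m) powr q"
        using d by (simp add: powr_mult powr_divide B_def)
      ultimately show ?thesis using d
        by (simp only: powr_minus) (simp add: field_simps)
    qed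
    finally have "ennreal (norm ((deriv ^^ m) f z) powr q) \<le> ennreal (?C * J)"
      by (rule ennreal_leI)
    also have "\<dots> = ennreal ?C * I" using J by (simp only: ennreal_mult'')
    finally show ?thesis unfolding I_def .
  qed
qed

text \<open>With \<open>c = r cnj a\<close>, the Poisson kernel is the \<open>t\<close>-derivative of
  \<open>t - 2 Im (Ln (1 - c cis t))\<close>, whose second summand is periodic.\<close>

lemma circ_pk_le:
  assumes a: "norm a < 1" and r: "0 \<le> r" "r < 1"
  shows "circ (\<lambda>u. ennreal (pk a (of_real r * u))) \<le> ennreal (2 * pi)"
proof -
  define c where "c = cnj a * of_real r"
  have nc: "norm c < 1" "norm c \<le> norm a"
  proof -
    have "norm c = norm a * r" using r by (simp add: c_def norm_mult)
    moreover have "norm a * r \<le> norm a" using r by (intro mult_left_le) auto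
    ultimately show "norm c < 1" "norm c \<le> norm a" using a by linarith+
  qed
  \<comment> \<open>This is the true Poisson kernel. It dominates \<open>pk\<close> because |c|^2 <=
    |c| <= |a|.\<close>
  define P where "P t = (1 - (norm c)\<^sup>2) / (norm (1 - c * cis t))\<^sup>2" for t
  define L where "L t = t - 2 * Im (Ln (1 - c * cis t))" for t
  have re: "Re (1 - c * cis t) > 0" for t
  proof -
    have "Re (c * cis t) \<le> norm (c * cis t)" by (rule complex_Re_le_cmod)
    then show ?thesis using nc by (simp add: norm_mult)
  qed
  have c2: "(norm c)\<^sup>2 \<le> norm c" using nc by (simp add: power2_eq_square mult_left_le)
  have le: "pk a (of_real r * cis t) \<le> P t" for t
    unfolding pk_def P_def c_def[symmetric] mult.assoc[symmetric]
    using c2 nc by (intro divide_right_mono) auto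
  have Pd: "P t = 1 + 2 * Re ((c * cis t) / (1 - c * cis t))" for t
  proof -
    define w where "w = c * cis t"
    have "Re (1 - w) > 0" using re[of t] unfolding w_def .
    then have n0: "1 - w \<noteq> 0" by (metis less_irrefl zero_complex.simps(1))
    have nw: "norm w = norm c" by (simp add: w_def norm_mult)
    have "1 + 2 * Re (w / (1 - w)) = Re ((1 + w) / (1 - w))"
    proof -
      have "(1 + w) / (1 - w) = 1 + (w / (1 - w) + w / (1 - w))"
        using n0 by (subst add_divide_distrib[symmetric]) (simp add: divide_simps)
      then show ?thesis by (simp only: plus_complex.simps one_complex.simps mult_2)
    qed
    also have "\<dots> = Re ((1 + w) * cnj (1 - w)) / (norm (1 - w))\<^sup>2"
      by (subst complex_div_cnj) simp
    also have "Re ((1 + w) * cnj (1 - w)) = 1 - (norm w)\<^sup>2"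
      unfolding cmod_power2 by (simp add: power2_eq_square algebra_simps)
    finally show ?thesis by (simp add: P_def w_def[symmetric] nw)
  qed
  have deriv: "(L has_real_derivative P t) (at t)" for t
  proof -
    have "((\<lambda>t. Ln (1 - c * cis t)) has_vector_derivative (- (c * (\<i> * cis t)) * (1 / (1 - c * cis t)))) (at t)"
    proof -
      have 1: "(cis has_vector_derivative \<i> * cis t) (at t)"
        unfolding cis_conv_exp
        by (rule derivative_eq_intros has_vector_derivative_real_field | simp)+
      have 2: "((\<lambda>t. 1 - c * cis t) has_vector_derivative (- (c * (\<i> * cis t)))) (at t)"
        by (rule derivative_eq_intros 1 refl | simp)+
      have 3: "(Ln has_field_derivative (inverse (1 - c * cis t))) (at (1 - c * cis t))"
        using re[of t] by (intro has_field_derivative_Ln) (force simp: complex_nonpos_Reals_iff)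
      show ?thesis
        using field_vector_diff_chain_at[OF 2 3] by (simp add: o_def divide_inverse)
    qed
    then have "((\<lambda>t. Im (Ln (1 - c * cis t))) has_vector_derivative Im (- (c * (\<i> * cis t)) * (1 / (1 - c * cis t)))) (at t)"
      by (rule bounded_linear.has_vector_derivative[OF bounded_linear_Im])
    moreover have "Im (- (c * (\<i> * cis t)) * (1 / (1 - c * cis t))) = - Re ((c * cis t) / (1 - c * cis t))"
    proof -
      have "Im (- \<i> * Y) = - Re Y" for Y by simp
      moreover have "- (c * (\<i> * cis t)) * (1 / (1 - c * cis t)) = - \<i> * ((c * cis t) / (1 - c * cis t))"
        by simp
      ultimately show ?thesis by (simp only:)
    qed
    ultimately have "((\<lambda>t. Im (Ln (1 - c * cis t))) has_real_derivative - Re ((c * cis t) / (1 - c * cis t))) (at t)"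
      by (simp only: has_real_derivative_iff_has_vector_derivative)
    from DERIV_diff[OF DERIV_ident DERIV_cmult[OF this, of 2]]
    show ?thesis unfolding L_def[abs_def] Pd by (simp only: mult_minus_right diff_minus_eq_add)
  qed
  have P0: "P t \<ge> 0" for t
    unfolding P_def using nc c2 by (intro divide_nonneg_nonneg) auto
  have [measurable]: "P \<in> borel_measurable borel"
    unfolding P_def[abs_def] using re
    by (intro borel_measurable_continuous_onI continuous_intros) (metis less_irrefl norm_eq_zero power_eq_0_iff zero_complex.simps(1))
  have "circ (\<lambda>u. ennreal (pk a (of_real r * u))) \<le> (\<integral>\<^sup>+t. ennreal (P t) * indicator {0..2*pi} t \<partial>lborel)"
    unfolding circ_def using le by (intro nn_integral_mono) (auto simp: indicator_def intro: ennreal_leI)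
  also have "\<dots> = ennreal (L (2*pi) - L 0)"
    by (rule nn_integral_FTC_Icc) (auto intro: deriv P0 DERIV_subset)
  also have "L (2*pi) - L 0 = 2*pi" by (simp add: L_def)
  finally show ?thesis .
qed

section \<open>Carleson squares\<close>

lemma cos_le_iff_abs:
  assumes "\<bar>x\<bar> \<le> pi" "0 \<le> h" "h \<le> pi"
  shows "cos h \<le> cos x \<longleftrightarrow> \<bar>x\<bar> \<le> h"
  using cos_mono_le_eq[of h "\<bar>x\<bar>"] assms by simp

text \<open>The parametrised form hides measurability. For angles in [-pi, pi] the condition |t -
  Arg a| <= h amounts to a bound on the cosine, since h <= 1/2 < pi, and the cosine is read off from
  \<open>Re (z * cnj a)\<close>.\<close>

lemma carleson_square_eq:
  assumes a: "a \<noteq> 0" "norm a < 1"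
  shows "carleson_square a =
    {z. norm a \<le> norm z \<and> norm z < 1 \<and> norm z * norm a * cos ((1 - norm a)/2) \<le> Re (z * cnj a)}"
proof -
  define h where "h = (1 - norm a)/2"
  have h: "0 \<le> h" using a by (simp add: h_def)
  have "h \<le> 1/2" by (simp add: h_def)
  then have h': "h \<le> pi" using pi_ge_two by (intro order_trans[OF \<open>h \<le> 1/2\<close> order_trans[OF _ pi_ge_two]]) simp
  note h = h h'
  have Re: "Re (rcis \<rho> t * cnj a) = \<rho> * norm a * cos (t - Arg a)" for \<rho> t
  proof -
    have "cnj a = rcis (norm a) (- Arg a)"
      by (metis rcis_cmod_Arg cis_cnj rcis_def complex_cnj_mult complex_cnj_complex_of_real)
    then have "rcis \<rho> t * cnj a = rcis (\<rho> * norm a) (t - Arg a)" by (simp add: rcis_mult)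
    then show ?thesis by simp
  qed
  show ?thesis
  proof (intro set_eqI iffI)
    fix z assume "z \<in> carleson_square a"
    then obtain \<rho> t where z: "z = rcis \<rho> t" "norm a \<le> \<rho>" "\<rho> < 1" "\<bar>t - Arg a\<bar> \<le> h"
      using a by (auto simp: carleson_square_def h_def)
    have "\<rho> \<ge> 0" using z(2) norm_ge_zero[of a] by linarith
    moreover have "cos h \<le> cos (t - Arg a)"
      using z h by (subst cos_le_iff_abs) auto
    ultimately show "z \<in> {z. norm a \<le> norm z \<and> norm z < 1 \<and> norm z * norm a * cos ((1 - norm a)/2) \<le> Re (z * cnj a)}"
      using z unfolding h_def[symmetric] mem_Collect_eq z(1) Re by (auto intro!: mult_left_mono)
  next
    fix z assume "z \<in> {z. norm a \<le> norm z \<and> norm z < 1 \<and> norm z * norm a * cos ((1 - norm a)/2) \<le> Re (z * cnj a)}"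
    then have z: "norm a \<le> norm z" "norm z < 1" "norm z * norm a * cos h \<le> Re (z * cnj a)"
      by (auto simp: h_def)
    have na: "norm a > 0" using a by simp
    define p where "p = Arg (z / a)"
    have za: "z / a = rcis (norm z / norm a) p"
      using rcis_cmod_Arg[of "z/a"] by (simp add: p_def norm_divide)
    have zr: "z = rcis (norm z) (Arg a + p)"
    proof -
      have "z = (z / a) * a" using a by simp
      also have "\<dots> = rcis (norm z / norm a) p * rcis (norm a) (Arg a)"
        using za rcis_cmod_Arg[of a] by simp
      finally show ?thesis using na by (simp add: rcis_mult add.commute)
    qed
    have "Re (z * cnj a) = norm z * norm a * cos p"
      by (subst zr, subst Re) simp
    moreover have "0 < norm z * norm a" using z na by (intro mult_pos_pos) linarith+
    ultimately have "cos h \<le> cos p"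
      using z(3) by (simp only: mult_le_cancel_left_pos)
    moreover have "\<bar>p\<bar> \<le> pi"
      unfolding p_def using Arg_bounded[of "z/a"] by (simp add: abs_le_iff)
    ultimately have "\<bar>p\<bar> \<le> h" using h cos_le_iff_abs by blast
    then have "norm a \<le> norm z \<and> norm z < 1 \<and> \<bar>(Arg a + p) - Arg a\<bar> \<le> (1 - norm a) / 2"
      using z by (simp add: h_def)
    then show "z \<in> carleson_square a"
      using a(1) zr unfolding carleson_square_def if_not_P[OF a(1)] by blast
  qed
qed

lemma carleson_square_measurable [measurable]:
  assumes "norm a < 1"
  shows "carleson_square a \<in> sets borel"
proof (cases "a = 0")
  case True then show ?thesis by (simp add: carleson_square_def)
next
  case False
  show ?thesis unfolding carleson_square_eq[OF False assms] by measurable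
qed

lemma carleson_squareD:
  assumes "norm a < 1" "z \<in> carleson_square a"
  shows "norm z < 1" "norm a \<le> norm z"
  using assms carleson_square_eq[of a] by (cases "a = 0"; auto simp: carleson_square_def)+

text \<open>The moduli contribute at most 2 (1 - |a|) to |1 - cnj a z| and the angle at most half of
  1 - |a|; and (5/2)^2 < 7.\<close>

lemma inverse_le_pk:
  assumes a: "norm a < 1" and z: "z \<in> carleson_square a"
  shows "1 / (1 - norm a) \<le> 7 * pk a z"
proof (cases "a = 0")
  case True then show ?thesis by (simp add: pk_def)
next
  case False
  then obtain \<rho> t where zr: "z = rcis \<rho> t" "norm a \<le> \<rho>" "\<rho> < 1" "\<bar>t - Arg a\<bar> \<le> (1 - norm a)/2"
    using z by (auto simp: carleson_square_def)
  have rho: "\<rho> \<ge> 0" using zr(2) norm_ge_zero[of a] by linarith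
  have "cnj a = rcis (norm a) (- Arg a)"
    by (metis rcis_cmod_Arg cis_cnj rcis_def complex_cnj_mult complex_cnj_complex_of_real)
  then have "cnj a * z = of_real (norm a * \<rho>) * cis (t - Arg a)"
    by (simp add: zr rcis_def mult_ac cis_mult)
  then have "1 - cnj a * z = of_real (1 - norm a * \<rho>) + of_real (norm a * \<rho>) * (1 - cis (t - Arg a))"
    by (simp add: algebra_simps)
  then have "norm (1 - cnj a * z) \<le> \<bar>1 - norm a * \<rho>\<bar> + \<bar>norm a * \<rho>\<bar> * norm (1 - cis (t - Arg a))"
    using norm_triangle_ineq[of "of_real (1 - norm a * \<rho>)" "of_real (norm a * \<rho>) * (1 - cis (t - Arg a))"]
    by (simp only: norm_mult norm_of_real)
  also have "\<dots> \<le> 2 * (1 - norm a) + 1 * ((1 - norm a)/2)"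
  proof (rule add_mono)
    have "norm a * norm a \<le> norm a * \<rho>" "norm a * \<rho> \<le> 1"
      using zr a rho by (auto intro!: mult_left_mono mult_le_one)
    moreover have "1 - norm a * norm a = (1 - norm a) * (1 + norm a)" by (simp add: algebra_simps)
    moreover have "(1 - norm a) * (1 + norm a) \<le> (1 - norm a) * 2"
      using a by (intro mult_left_mono) auto
    ultimately show "\<bar>1 - norm a * \<rho>\<bar> \<le> 2 * (1 - norm a)" by linarith
    show "\<bar>norm a * \<rho>\<bar> * norm (1 - cis (t - Arg a)) \<le> 1 * ((1 - norm a)/2)"
      using norm_one_minus_cis_le[of "t - Arg a"] zr a rho
      by (intro mult_mono) (auto simp: abs_mult intro!: mult_le_one)
  qed
  finally have "norm (1 - cnj a * z) \<le> 5/2 * (1 - norm a)" by argo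
  then have "(norm (1 - cnj a * z))\<^sup>2 \<le> (5/2 * (1 - norm a))\<^sup>2"
    by (rule power_mono) simp
  also have "\<dots> \<le> 7 * (1 - norm a) * (1 - norm a)"
  proof -
    have "(5/2 * x)\<^sup>2 \<le> 7 * x * x" for x :: real
      using zero_le_square[of x] by (simp add: power2_eq_square)
    then show ?thesis .
  qed
  finally have "(norm (1 - cnj a * z))\<^sup>2 \<le> 7 * (1 - norm a) * (1 - norm a)" .
  moreover have "norm (1 - cnj a * z) > 0"
    using kernel_nonzero[OF a carleson_squareD(1)[OF a z]] by simp
  ultimately show ?thesis using a by (simp add: pk_def field_simps)
qed

text \<open>Off the square of \<open>b\<close>, either \<open>|z| < |b|\<close>, or the angle between \<open>z\<close> and \<open>a\<close> exceeds
  \<open>(1 - |b|) / 2\<close>.\<close>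

lemma norm_kernel_ge_off_square:
  assumes a: "norm a < 1" and b: "b = of_real s * a" "0 < s" "s \<le> 1" "a \<noteq> 0"
    and z: "norm z < 1" "z \<notin> carleson_square b"
  shows "(1 - norm b) / 7 \<le> norm (1 - cnj a * z)"
proof -
  have "norm b = s * norm a" "s * norm a \<le> norm a"
    using b by (simp_all add: norm_mult mult_left_le_one_le)
  then have nb: "norm b \<le> norm a" "norm b < 1" "b \<noteq> 0"
    using a b(2-) by (linarith, linarith, auto)
  define h where "h = (1 - norm b)/2"
  have h: "0 \<le> h" "h \<le> 1/2" using nb by (auto simp: h_def)
  then have h': "h \<le> pi" using pi_ge_two by (intro order_trans[OF h(2) order_trans[OF _ pi_ge_two]]) simp
  note h = h h'
  show ?thesis
  proof (cases "norm z < norm b")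
    case True
    have "(1 - norm b) / 7 \<le> 1 - norm b" using nb by simp
    also have "\<dots> \<le> norm (1 - cnj a * z)" using True norm_kernel_ge(1)[OF a z(1)] by linarith
    finally show ?thesis .
  next
    case False
    then have "Re (z * cnj b) < norm z * norm b * cos h"
      using z nb by (auto simp: carleson_square_eq h_def)
    moreover have "Re (z * cnj b) = s * Re (z * cnj a)" unfolding b(1) by (simp add: algebra_simps)
    moreover have "norm z * norm b * cos h = s * (norm z * norm a * cos h)"
      using b by (simp add: norm_mult)
    ultimately have "s * Re (z * cnj a) < s * (norm z * norm a * cos h)" by metis
    then have Re: "Re (z * cnj a) < norm z * norm a * cos h"
      using b(2) by (simp only: mult_less_cancel_left_pos)
    define x where "x = norm z * norm a"
    have x: "0 \<le> x" "x \<le> 1" using z a by (auto simp: x_def intro!: mult_le_one)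
    have nx: "norm (z * cnj a) = x" by (simp add: x_def norm_mult)
    have "(norm (1 - cnj a * z))\<^sup>2 = 1 - 2 * Re (z * cnj a) + (norm (z * cnj a))\<^sup>2"
      unfolding cmod_power2 by (simp add: power2_eq_square algebra_simps)
    also have "\<dots> \<ge> 1 - 2 * (x * cos h) + x\<^sup>2"
      using Re unfolding nx by (simp add: x_def)
    finally have "1 - 2 * (x * cos h) + x\<^sup>2 \<le> (norm (1 - cnj a * z))\<^sup>2" by simp
    \<comment> \<open>Completing the square: a point at angle h has distance at least sin h from
      1.\<close>
    moreover have "1 - 2 * (x * cos h) + x\<^sup>2 = (x - cos h)\<^sup>2 + (sin h)\<^sup>2"
      using sin_cos_squared_add[of h] by (simp add: power2_eq_square algebra_simps)
    ultimately have "(sin h)\<^sup>2 \<le> (norm (1 - cnj a * z))\<^sup>2"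
      using zero_le_power2[of "x - cos h"] by linarith
    then have "sin h \<le> norm (1 - cnj a * z)"
      by (rule power2_le_imp_le) simp
    \<comment> \<open>For h <= 1/2 < pi/3 the cosine is at least 1/2. As h / 2 is a quarter of
      \<open>1 - norm b\<close>, the constant 7 leaves room.\<close>
    moreover have "h / 2 \<le> sin h"
    proof (cases "h = 0")
      case False
      then have "0 < h" using h by simp
      then obtain x where x: "0 < x" "x < h" "sin h - sin 0 = (h - 0) * cos x"
        using MVT2[of 0 h sin cos] by (auto intro: DERIV_sin)
      have "cos (pi/3) \<le> cos x" using x h pi_gt3 by (intro cos_monotone_0_pi_le) auto
      then have "h * (1/2) \<le> h * cos x" using h by (intro mult_left_mono) (auto simp: cos_60)
      then show ?thesis using x by simp
    qed simp
    ultimately show ?thesis using nb by (simp add: h_def)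
  qed
qed

text \<open>The point on the radius through a whose distance to the unit circle is 2^k times that of
  a. Once this distance would reach 1 the point is 0, whose square is the whole disk; so the squares
  eventually cover the disk, also for a = 0.\<close>

definition dyadic_pt :: "complex \<Rightarrow> nat \<Rightarrow> complex" where
  "dyadic_pt a k = (if 2^k * (1 - norm a) < 1 then of_real ((1 - 2^k * (1 - norm a)) / norm a) * a else 0)"

lemma norm_rescale:
  fixes a :: complex
  shows "a \<noteq> 0 \<Longrightarrow> 0 \<le> s \<Longrightarrow> norm (of_real (s / norm a) * a) = s"
  by (simp only: norm_mult norm_of_real) simp

lemma norm_dyadic_pt:
  assumes "norm a < 1"
  shows "norm (dyadic_pt a k) < 1" "1 - norm (dyadic_pt a k) \<le> 2^k * (1 - norm a)"
proof -
  have "norm (dyadic_pt a k) = (if 2^k * (1 - norm a) < 1 then 1 - 2^k * (1 - norm a) else 0)"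
  proof (cases "2^k * (1 - norm a) < 1 \<and> a = 0")
    case True
    moreover have "\<not> (2::real)^k < 1" by (simp add: not_less)
    ultimately have False by (metis diff_zero mult.right_neutral norm_zero)
    then show ?thesis ..
  next
    case False
    then show ?thesis unfolding dyadic_pt_def by (simp add: norm_rescale del: of_real_divide of_real_diff)
  qed
  then show "norm (dyadic_pt a k) < 1" "1 - norm (dyadic_pt a k) \<le> 2^k * (1 - norm a)"
    using assms by (auto simp: not_less)
qed

text \<open>Let k be the first index whose square contains z. For k > 0 the preceding square misses
  z, so |1 - cnj a z| is at least 2^(k-1) (1 - |a|) / 7, and 49 times 4 is below 200. For k = 0 the
  trivial bound 1 / (1 - |a|) of the kernel suffices.\<close>

lemma pk_le_suminf:
  assumes a: "norm a < 1" and z: "norm z < 1"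
  shows "ennreal (pk a z) \<le> (\<Sum>k. ennreal (200 * (1/4)^k / (1 - norm a)) * indicator (carleson_square (dyadic_pt a k)) z)"
proof -
  obtain K :: nat where "1 / (1 - norm a) < 2^K"
    using real_arch_pow[of 2] by auto
  then have "1 \<le> 2^K * (1 - norm a)" using a by (simp add: field_simps)
  then have "z \<in> carleson_square (dyadic_pt a K)"
    using z by (simp add: dyadic_pt_def carleson_square_def)
  then have ex: "\<exists>k. z \<in> carleson_square (dyadic_pt a k)" by blast
  define k where "k = (LEAST k. z \<in> carleson_square (dyadic_pt a k))"
  have k: "z \<in> carleson_square (dyadic_pt a k)" unfolding k_def using ex by (rule LeastI_ex)
  have kl: "z \<notin> carleson_square (dyadic_pt a j)" if "j < k" for j
    using that unfolding k_def by (rule not_less_Least)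
  have n0: "norm (1 - cnj a * z) > 0" using kernel_nonzero[OF a z] by simp
  have "pk a z \<le> 200 * (1/4)^k / (1 - norm a)"
  proof (cases k)
    case 0
    have "(1 - norm a)\<^sup>2 \<le> (norm (1 - cnj a * z))\<^sup>2"
      using norm_kernel_ge(2)[OF a z] a by (intro power_mono) auto
    then have "pk a z \<le> (1 - norm a) / (1 - norm a)\<^sup>2"
      unfolding pk_def using a n0 by (intro divide_left_mono) auto
    also have "\<dots> \<le> 200 / (1 - norm a)" using a by (simp add: power2_eq_square field_simps)
    finally show ?thesis using 0 by simp
  next
    case (Suc j)
    then have nz: "z \<notin> carleson_square (dyadic_pt a j)" using kl by simp
    define s where "s = (1 - 2^j * (1 - norm a)) / norm a"
    have lt: "2^j * (1 - norm a) < 1"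
      using nz z by (auto simp: dyadic_pt_def carleson_square_def split: if_splits)
    have "\<not> (2::real)^j < 1" by (simp add: not_less)
    with lt have a0: "a \<noteq> 0" by (metis diff_zero mult.right_neutral norm_zero)
    have b: "dyadic_pt a j = of_real s * a" using lt by (simp add: dyadic_pt_def s_def)
    have "1 - norm a \<le> 2^j * (1 - norm a)" using a one_le_power[of "2::real" j] by simp
    then have s: "0 < s" "s \<le> 1" using lt a0 by (auto simp: s_def)
    have nb: "norm (dyadic_pt a j) = 1 - 2^j * (1 - norm a)"
      using lt a0 unfolding dyadic_pt_def by (simp add: norm_rescale del: of_real_divide of_real_diff)
    have "2^j * (1 - norm a) / 7 \<le> norm (1 - cnj a * z)"
      using norm_kernel_ge_off_square[OF a b s a0 z nz] nb by simp
    then have "(2^j * (1 - norm a) / 7)\<^sup>2 \<le> (norm (1 - cnj a * z))\<^sup>2"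
      using a by (intro power_mono) auto
    then have "pk a z \<le> (1 - norm a) / (2^j * (1 - norm a) / 7)\<^sup>2"
      unfolding pk_def using a n0 by (intro divide_left_mono) auto
    also have "\<dots> = 49 * (1/4)^j / (1 - norm a)"
    proof -
      have "(2^j :: real)\<^sup>2 = 4^j" by (simp add: power2_eq_square power_mult_distrib[symmetric])
      then have "x / (2^j * x / 7)\<^sup>2 = 49 * (1/4)^j / x" if "x > 0" for x :: real
        using that by (simp add: power_mult_distrib power_divide) (simp add: power2_eq_square)
      then show ?thesis using a by simp
    qed
    also have "\<dots> \<le> 200 * (1/4)^k / (1 - norm a)"
      using a Suc by (intro divide_right_mono) auto
    finally show ?thesis .
  qed
  define F where "F i = ennreal (200 * (1/4)^i / (1 - norm a)) * indicator (carleson_square (dyadic_pt a i)) z" for i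
  have "ennreal (pk a z) \<le> F k"
    using \<open>pk a z \<le> _\<close> k by (simp add: ennreal_leI F_def)
  also have "\<dots> = sum F {k}" by simp
  also have "\<dots> \<le> suminf F" by (rule sum_le_suminf) auto
  finally show ?thesis unfolding F_def .
qed

text \<open>Passing from 1 / (1 - |a|) to the normalisation of the k-th square costs 2^k, which
  turns the decay 4^-k into 2^-k; 400 is the sum of 200 times 2^-k.\<close>

lemma nn_integral_pk_le:
  fixes g :: "complex \<Rightarrow> ennreal"
  assumes [measurable]: "g \<in> borel_measurable borel" and a: "norm a < 1"
    and N: "\<And>b. norm b < 1 \<Longrightarrow> ennreal (1 / (1 - norm b)) * (\<integral>\<^sup>+z\<in>carleson_square b. g z \<partial>lborel) \<le> N"
  shows "(\<integral>\<^sup>+z\<in>unit_disk. ennreal (pk a z) * g z \<partial>lborel) \<le> 400 * N"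
proof -
  have [measurable]: "carleson_square (dyadic_pt a k) \<in> sets borel" for k
    by (rule carleson_square_measurable[OF norm_dyadic_pt(1)[OF a]])
  let ?b = "\<lambda>k. dyadic_pt a k"
  have "(\<integral>\<^sup>+z\<in>unit_disk. ennreal (pk a z) * g z \<partial>lborel)
    \<le> (\<integral>\<^sup>+z. (\<Sum>k. ennreal (200 * (1/4)^k / (1 - norm a)) * (g z * indicator (carleson_square (?b k)) z)) \<partial>lborel)"
  proof (rule nn_integral_mono)
    fix z
    show "ennreal (pk a z) * g z * indicator unit_disk z \<le> (\<Sum>k. ennreal (200 * (1/4)^k / (1 - norm a)) * (g z * indicator (carleson_square (?b k)) z))"
    proof (cases "norm z < 1")
      case True
      have "ennreal (pk a z) * g z \<le> (\<Sum>k. ennreal (200 * (1/4)^k / (1 - norm a)) * indicator (carleson_square (?b k)) z) * g z"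
        by (intro mult_right_mono pk_le_suminf a True) simp
      then show ?thesis using True by (simp add: ennreal_suminf_multc[symmetric] mult_ac)
    qed simp
  qed
  also have "\<dots> = (\<Sum>k. \<integral>\<^sup>+z. ennreal (200 * (1/4)^k / (1 - norm a)) * (g z * indicator (carleson_square (?b k)) z) \<partial>lborel)"
    by (rule nn_integral_suminf) measurable
  also have "\<dots> = (\<Sum>k. ennreal (200 * (1/4)^k / (1 - norm a)) * (\<integral>\<^sup>+z\<in>carleson_square (?b k). g z \<partial>lborel))"
    by (intro suminf_cong nn_integral_cmult) measurable
  also have "\<dots> \<le> (\<Sum>k. ennreal (200 * (1/2)^k) * N)"
  proof (rule suminf_le)
    fix k
    define I where "I = (\<integral>\<^sup>+z\<in>carleson_square (?b k). g z \<partial>lborel)"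
    have nb: "norm (?b k) < 1" "1 - norm (?b k) \<le> 2^k * (1 - norm a)" using norm_dyadic_pt[OF a] by auto
    have "200 * (1/4)^k / (1 - norm a) \<le> 200 * (1/2)^k * (1 / (1 - norm (?b k)))"
    proof -
      have "200 * (1/4)^k * (1 - norm (?b k)) \<le> 200 * (1/4)^k * (2^k * (1 - norm a))"
        using nb by (intro mult_left_mono) auto
      also have "\<dots> = 200 * (1/2)^k * (1 - norm a)"
        by (simp add: power_mult_distrib[symmetric] mult.assoc[symmetric])
      finally show ?thesis using a nb by (simp add: field_simps)
    qed
    then have "ennreal (200 * (1/4)^k / (1 - norm a)) * I \<le> ennreal (200 * (1/2)^k * (1 / (1 - norm (?b k)))) * I"
      by (intro mult_right_mono ennreal_leI) auto
    also have "\<dots> = ennreal (200 * (1/2)^k) * (ennreal (1 / (1 - norm (?b k))) * I)"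
      using nb by (subst ennreal_mult) (auto simp only: mult.assoc intro!: divide_nonneg_nonneg mult_nonneg_nonneg zero_le_power)
    also have "\<dots> \<le> ennreal (200 * (1/2)^k) * N"
      unfolding I_def by (intro mult_left_mono N nb) auto
    finally show "ennreal (200 * (1/4)^k / (1 - norm a)) * (\<integral>\<^sup>+z\<in>carleson_square (?b k). g z \<partial>lborel)
       \<le> ennreal (200 * (1/2)^k) * N" unfolding I_def .
  qed auto
  also have "\<dots> = (\<Sum>k. ennreal (200 * (1/2)^k)) * N" by simp
  also have "(\<Sum>k. ennreal (200 * (1/2::real)^k)) = ennreal (200 * 2)"
  proof -
    have "(\<lambda>k. 200 * (1/2::real)^k) sums (200 * (1 / (1 - 1/2)))"
      by (intro sums_mult geometric_sums) simp
    then show ?thesis by (intro suminf_ennreal_eq) auto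
  qed
  finally show ?thesis by simp
qed

section \<open>Carleson suprema against kernel integrals\<close>

text \<open>For G = |f|^q this is the q-th power of the tent norm. Without the root, the estimates
  stay additive in the integrand.\<close>

definition carl :: "(real \<Rightarrow> real) \<Rightarrow> (complex \<Rightarrow> real) \<Rightarrow> ennreal" where
  "carl w G = (SUP a\<in>unit_disk. ennreal (1 / (1 - norm a)) *
     (\<integral>\<^sup>+z\<in>carleson_square a. on_disk G z * ennreal (w (norm z)) \<partial>lborel))"

lemma ball_measurable [measurable]: "ball (z::complex) r \<in> sets borel"
  by simp

lemma nn_integral_disk:
  assumes G: "continuous_on unit_disk G" and [measurable]: "w \<in> borel_measurable borel" and w: "\<And>r. 0 \<le> w r"
  shows "(\<integral>\<^sup>+z. on_disk G z * ennreal (w (norm z)) \<partial>lborel) = disk_int w G"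
proof -
  note [measurable] = on_disk_measurable[OF G] cmean_measurable[OF G]
  have "(\<integral>\<^sup>+z. on_disk G z * ennreal (w (norm z)) \<partial>lborel) =
    (\<integral>\<^sup>+r\<in>{0..}. ennreal r * circ (\<lambda>u. on_disk G (of_real r * u) * ennreal (w (norm (of_real r * u)))) \<partial>lborel)"
    by (rule nn_integral_polar) measurable
  also have "\<dots> = disk_int w G"
    unfolding disk_int_def
  proof (rule nn_integral_cong)
    fix r :: real
    have "ennreal r * circ (\<lambda>u. on_disk G (of_real r * u) * ennreal (w (norm (of_real r * u))))
       = ennreal (w r * r) * cmean G r * indicator {0..<1} r" if r: "0 \<le> r"
    proof (cases "r < 1")
      case True
      have "circ (\<lambda>u. on_disk G (of_real r * u) * ennreal (w (norm (of_real r * u))))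
        = circ (\<lambda>u. ennreal (w r) * on_disk G (of_real r * u))"
        using r by (intro circ_cong) (simp add: norm_mult mult.commute)
      also have "\<dots> = ennreal (w r) * cmean G r" unfolding cmean_def by (rule circ_cmult) measurable
      finally show ?thesis using True r w by (simp add: ennreal_mult mult_ac)
    next
      case False
      have "circ (\<lambda>u. on_disk G (of_real r * u) * ennreal (w (norm (of_real r * u)))) = circ (\<lambda>u. 0)"
        using r False by (intro circ_cong) (simp add: norm_mult on_disk_def)
      then show ?thesis using False by simp
    qed
    then show "ennreal r * circ (\<lambda>u. on_disk G (of_real r * u) * ennreal (w (norm (of_real r * u)))) * indicator {0..} r
      = ennreal (w r * r) * cmean G r * indicator {0..<1} r"
      by (cases "0 \<le> r") auto
  qed
  finally show ?thesis .
qed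

lemma disk_int_pk_le_carl:
  assumes G: "continuous_on unit_disk G" and G0: "\<And>z. 0 \<le> G z" and [measurable]: "w \<in> borel_measurable borel" and w: "\<And>r. 0 \<le> w r"
    and a: "norm a < 1"
  shows "disk_int w (\<lambda>z. G z * pk a z) \<le> 400 * carl w G"
proof -
  note [measurable] = on_disk_measurable[OF G]
  have "disk_int w (\<lambda>z. G z * pk a z) = (\<integral>\<^sup>+z. on_disk (\<lambda>z. G z * pk a z) z * ennreal (w (norm z)) \<partial>lborel)"
    using a by (intro nn_integral_disk[symmetric] continuous_intros G continuous_on_pk w) auto
  also have "\<dots> = (\<integral>\<^sup>+z\<in>unit_disk. ennreal (pk a z) * (on_disk G z * ennreal (w (norm z))) \<partial>lborel)"
    using G0 pk_nonneg[OF a] by (intro nn_integral_cong) (auto simp: on_disk_def ennreal_mult mult_ac)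
  also have "\<dots> \<le> 400 * carl w G"
    by (rule nn_integral_pk_le) (auto simp: a carl_def intro!: SUP_upper2)
  finally show ?thesis .
qed

text \<open>The square of a meets only radii from |a| on. The cut-off of the weight is kept because
  the estimate of f by its derivative sums only from the annulus of |a| outwards.\<close>

lemma carleson_le_disk_int:
  assumes G: "continuous_on unit_disk G" and G0: "\<And>z. 0 \<le> G z" and [measurable]: "w \<in> borel_measurable borel" and w: "\<And>r. 0 \<le> w r"
    and a: "norm a < 1"
  shows "ennreal (1 / (1 - norm a)) * (\<integral>\<^sup>+z\<in>carleson_square a. on_disk G z * ennreal (w (norm z)) \<partial>lborel)
    \<le> 7 * disk_int (\<lambda>r. w r * indicator {norm a..} r) (\<lambda>z. G z * pk a z)"
proof -
  note [measurable] = on_disk_measurable[OF G] carleson_square_measurable[OF a]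
  have Gp: "continuous_on unit_disk (\<lambda>z. G z * pk a z)" using a by (intro continuous_intros G continuous_on_pk)
  note [measurable] = on_disk_measurable[OF Gp]
  let ?w = "\<lambda>r. w r * indicator {norm a..} r"
  have "ennreal (1 / (1 - norm a)) * (\<integral>\<^sup>+z\<in>carleson_square a. on_disk G z * ennreal (w (norm z)) \<partial>lborel)
    = (\<integral>\<^sup>+z. ennreal (1 / (1 - norm a)) * (on_disk G z * ennreal (w (norm z)) * indicator (carleson_square a) z) \<partial>lborel)"
    by (rule nn_integral_cmult[symmetric]) measurable
  also have "\<dots> \<le> (\<integral>\<^sup>+z. 7 * (on_disk (\<lambda>z. G z * pk a z) z * ennreal (?w (norm z))) \<partial>lborel)"
  proof (rule nn_integral_mono)
    fix z
    show "ennreal (1 / (1 - norm a)) * (on_disk G z * ennreal (w (norm z)) * indicator (carleson_square a) z)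
      \<le> 7 * (on_disk (\<lambda>z. G z * pk a z) z * ennreal (?w (norm z)))"
    proof (cases "z \<in> carleson_square a")
      case True
      note z = carleson_squareD[OF a True]
      have "ennreal (1 / (1 - norm a)) * (ennreal (G z) * ennreal (w (norm z))) \<le> ennreal (7 * pk a z) * (ennreal (G z) * ennreal (w (norm z)))"
        by (intro mult_right_mono ennreal_leI inverse_le_pk a True) simp
      then show ?thesis using z True G0[of z] pk_nonneg[OF a, of z]
        by (simp add: on_disk_def ennreal_mult mult_ac)
    qed simp
  qed
  also have "\<dots> = 7 * (\<integral>\<^sup>+z. on_disk (\<lambda>z. G z * pk a z) z * ennreal (?w (norm z)) \<partial>lborel)"
    by (rule nn_integral_cmult) measurable
  also have "(\<integral>\<^sup>+z. on_disk (\<lambda>z. G z * pk a z) z * ennreal (?w (norm z)) \<partial>lborel) = disk_int ?w (\<lambda>z. G z * pk a z)"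
    by (rule nn_integral_disk[OF Gp]) (auto simp: w)
  finally show ?thesis .
qed

lemma circ_Fubini:
  fixes g :: "complex \<Rightarrow> complex \<Rightarrow> ennreal"
  assumes [measurable]: "case_prod g \<in> borel_measurable (borel \<Otimes>\<^sub>M borel)"
  shows "circ (\<lambda>u. \<integral>\<^sup>+v. g u v \<partial>lborel) = (\<integral>\<^sup>+v. circ (\<lambda>u. g u v) \<partial>lborel)"
proof -
  have "circ (\<lambda>u. \<integral>\<^sup>+v. g u v \<partial>lborel) = (\<integral>\<^sup>+t. (\<integral>\<^sup>+v. g (cis t) v * indicator {0..<2*pi} t \<partial>lborel) \<partial>lborel)"
    by (simp add: circ_def nn_integral_multc)
  also have "\<dots> = (\<integral>\<^sup>+v. (\<integral>\<^sup>+t. g (cis t) v * indicator {0..<2*pi} t \<partial>lborel) \<partial>lborel)"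
    by (rule lborel_pair.Fubini') measurable
  finally show ?thesis by (simp add: circ_def)
qed

text \<open>Turns an area integral around a centre moving on a circle into one over a fixed ball, so
  that Tonelli can exchange it with the circle mean.\<close>

lemma nn_integral_ball_rotate:
  fixes g :: "complex \<Rightarrow> ennreal"
  assumes [measurable]: "g \<in> borel_measurable borel" and u: "norm u = 1"
  shows "(\<integral>\<^sup>+w\<in>ball (of_real r * u) \<delta>. g w \<partial>lborel) = (\<integral>\<^sup>+v\<in>ball (of_real r) \<delta>. g (v * u) \<partial>lborel)"
proof -
  have "(\<integral>\<^sup>+w\<in>ball (of_real r * u) \<delta>. g w \<partial>lborel) = (\<integral>\<^sup>+v. g (u * v) * indicator (ball (of_real r * u) \<delta>) (u * v) \<partial>lborel)"
    by (rule nn_integral_lborel_rotate[OF _ u, symmetric]) measurable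
  also have "\<dots> = (\<integral>\<^sup>+v\<in>ball (of_real r) \<delta>. g (v * u) \<partial>lborel)"
  proof (rule nn_integral_cong)
    fix v
    have "of_real r * u - u * v = u * (of_real r - v)" by (simp add: algebra_simps)
    then have "norm (of_real r * u - u * v) = norm (of_real r - v)" using u by (simp add: norm_mult)
    then show "g (u * v) * indicator (ball (of_real r * u) \<delta>) (u * v) = g (v * u) * indicator (ball (of_real r) \<delta>) v"
      by (simp add: indicator_def dist_norm mult.commute)
  qed
  finally show ?thesis .
qed

lemma emeasure_complex_ball:
  "0 \<le> r \<Longrightarrow> emeasure lborel (ball (z::complex) r) = ennreal (pi * r\<^sup>2)"
  using content_ball[of r z] by (subst emeasure_eq_ennreal_measure)
    (auto simp: unit_ball_vol_2 unit_ball_vol_numeral emeasure_bounded_finite[THEN less_imp_neq, unfolded infinity_ennreal_def])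

text \<open>The constant of \<open>higher_deriv_submean\<close> without its powers of the
  radius.\<close>

definition deriv_const :: "nat \<Rightarrow> real \<Rightarrow> real" where
  "deriv_const m q = fact m powr q * 2 powr (m*q) * (4/pi)"

lemma deriv_const_pos: "deriv_const m q > 0"
  by (simp add: deriv_const_def)

text \<open>On the ball of radius (1 - r)/2 around a point of modulus r the kernel varies by a
  factor of at most 4, and the ball stays within modulus (1 + r)/2. So each circle mean through the
  ball is at most the one at (1 + r)/2, and the area of the ball cancels the squared radius in the
  sub-mean value estimate.\<close>

lemma cmean_higher_deriv:
  assumes f: "f holomorphic_on unit_disk" and q: "0 < q" and a: "norm a < 1" and r: "0 \<le> r" "r < 1"
  shows "cmean (\<lambda>z. norm ((deriv ^^ m) f z) powr q * pk a z) r
    \<le> ennreal (4 * pi * deriv_const m q * ((1-r)/2) powr (- (m*q))) * cmean (\<lambda>z. norm (f z) powr q * pk a z) ((1 + r)/2)"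
proof -
  define \<delta> where "\<delta> = (1-r)/2"
  have d: "0 < \<delta>" "r + \<delta> = (1 + r)/2" "(1 + r)/2 < 1" using r by (auto simp: \<delta>_def field_simps)
  let ?G = "\<lambda>z. norm (f z) powr q * pk a z"
  have G: "continuous_on unit_disk ?G"
    using a by (intro continuous_intros continuous_on_norm_powr f q continuous_on_pk)
  note [measurable] = on_disk_measurable[OF G] on_disk_measurable[OF continuous_on_norm_powr[OF f q]]
  define C where "C = deriv_const m q * \<delta> powr (- (m*q)) / \<delta>\<^sup>2"
  have C: "C \<ge> 0" using deriv_const_pos[of m q] by (simp add: C_def)
  have sub: "ball (of_real r * u) \<delta> \<subseteq> unit_disk" if "norm u = 1" for u :: complex
  proof
    fix w assume "w \<in> ball (of_real r * u) \<delta>"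
    then have "norm w \<le> norm (of_real r * u) + \<delta>"
      by (metis dist_norm less_eq_real_def mem_ball norm_minus_commute norm_triangle_le_diff norm_triangle_sub order_trans add_left_mono)
    then show "w \<in> unit_disk" using that r d by (simp add: norm_mult)
  qed
  have pt: "on_disk (\<lambda>z. norm ((deriv ^^ m) f z) powr q * pk a z) (of_real r * u)
     \<le> (\<integral>\<^sup>+v. ennreal (4 * C) * (on_disk ?G (v * u) * indicator (ball (of_real r) \<delta>) v) \<partial>lborel)" if u: "norm u = 1" for u
  proof -
    have nr: "norm (of_real r * u) = r" using u r by (simp add: norm_mult)
    have "on_disk (\<lambda>z. norm ((deriv ^^ m) f z) powr q * pk a z) (of_real r * u) =
      ennreal (norm ((deriv ^^ m) f (of_real r * u)) powr q) * ennreal (pk a (of_real r * u))"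
      using nr r pk_nonneg[OF a] by (simp add: on_disk_def ennreal_mult)
    also have "\<dots> \<le> (ennreal C * (\<integral>\<^sup>+w\<in>ball (of_real r * u) \<delta>. ennreal (norm (f w) powr q) \<partial>lborel)) * ennreal (pk a (of_real r * u))"
      unfolding C_def deriv_const_def using d
      by (intro mult_right_mono higher_deriv_submean holomorphic_on_subset[OF f sub[OF u]] q) auto
    also have "(\<integral>\<^sup>+w\<in>ball (of_real r * u) \<delta>. ennreal (norm (f w) powr q) \<partial>lborel) =
        (\<integral>\<^sup>+w\<in>ball (of_real r * u) \<delta>. on_disk (\<lambda>z. norm (f z) powr q) w \<partial>lborel)"
      using sub[OF u] by (intro nn_integral_cong) (auto simp: indicator_def on_disk_def)
    also have "\<dots> = (\<integral>\<^sup>+v\<in>ball (of_real r) \<delta>. on_disk (\<lambda>z. norm (f z) powr q) (v * u) \<partial>lborel)"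
      by (rule nn_integral_ball_rotate[OF _ u]) measurable
    also have "ennreal C * \<dots> * ennreal (pk a (of_real r * u)) = (\<integral>\<^sup>+v. (ennreal C * ennreal (pk a (of_real r * u))) * (on_disk (\<lambda>z. norm (f z) powr q) (v * u) * indicator (ball (of_real r) \<delta>) v) \<partial>lborel)"
      by (subst nn_integral_cmult, measurable) (simp only: mult.assoc mult.commute[of _ "ennreal (pk a (of_real r * u))"])
    also have "\<dots> \<le> (\<integral>\<^sup>+v. ennreal (4 * C) * (on_disk ?G (v * u) * indicator (ball (of_real r) \<delta>) v) \<partial>lborel)"
    proof (rule nn_integral_mono)
      fix v
      show "(ennreal C * ennreal (pk a (of_real r * u))) * (on_disk (\<lambda>z. norm (f z) powr q) (v * u) * indicator (ball (of_real r) \<delta>) v)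
        \<le> ennreal (4 * C) * (on_disk ?G (v * u) * indicator (ball (of_real r) \<delta>) v)"
      proof (cases "v \<in> ball (of_real r) \<delta>")
        case True
        have vu: "norm (of_real r * u - v * u) < \<delta>"
          using True u by (simp add: dist_norm left_diff_distrib[symmetric] norm_mult)
        then have "norm (v * u) < 1" using sub[OF u] by (auto simp: dist_norm subset_iff)
        have "\<delta> \<le> 1 * norm (1 - cnj a * (of_real r * u))"
          using norm_kernel_ge(1)[OF a, of "of_real r * u"] r nr by (simp add: \<delta>_def)
        then have "pk a (of_real r * u) \<le> (1 + 1)\<^sup>2 * pk a (v * u)"
          using nr r vu \<open>norm (v * u) < 1\<close> by (intro pk_compare a) auto
        then have "C * pk a (of_real r * u) * norm (f (v * u)) powr q \<le> (4 * C) * (norm (f (v * u)) powr q * pk a (v * u))"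
          using mult_left_mono[of "pk a (of_real r * u)" "4 * pk a (v * u)" "C * norm (f (v * u)) powr q"] C
          by (simp add: mult_ac)
        then have "ennreal (C * pk a (of_real r * u) * norm (f (v * u)) powr q) \<le> ennreal ((4 * C) * (norm (f (v * u)) powr q * pk a (v * u)))"
          by (rule ennreal_leI)
        then show ?thesis
          using True \<open>norm (v * u) < 1\<close> C pk_nonneg[OF a] by (simp add: on_disk_def ennreal_mult mult_ac)
      qed simp
    qed
    finally show ?thesis .
  qed
  have "cmean (\<lambda>z. norm ((deriv ^^ m) f z) powr q * pk a z) r
     \<le> circ (\<lambda>u. \<integral>\<^sup>+v. ennreal (4 * C) * (on_disk ?G (v * u) * indicator (ball (of_real r) \<delta>) v) \<partial>lborel)"
    unfolding cmean_def by (rule circ_mono[OF pt])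
  also have "\<dots> = (\<integral>\<^sup>+v. circ (\<lambda>u. ennreal (4 * C) * (on_disk ?G (v * u) * indicator (ball (of_real r) \<delta>) v)) \<partial>lborel)"
    by (rule circ_Fubini) measurable
  also have "\<dots> \<le> (\<integral>\<^sup>+v. ennreal (4 * C) * cmean ?G ((1 + r)/2) * indicator (ball (of_real r) \<delta>) v \<partial>(lborel :: complex measure))"
  proof (rule nn_integral_mono)
    fix v :: complex
    show "circ (\<lambda>u. ennreal (4 * C) * (on_disk ?G (v * u) * indicator (ball (of_real r) \<delta>) v))
       \<le> ennreal (4 * C) * cmean ?G ((1 + r)/2) * indicator (ball (of_real r) \<delta>) v"
    proof (cases "v \<in> ball (of_real r) \<delta>")
      case True
      have "norm v \<le> norm (of_real r :: complex) + norm (of_real r - v)"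
        by (metis norm_minus_commute norm_triangle_sub)
      then have "norm v \<le> (1 + r)/2" using True d r by (simp add: dist_norm)
      then have "circ (\<lambda>u. on_disk ?G (v * u)) \<le> cmean ?G ((1 + r)/2)"
        using d by (intro circ_pk_mono f q a) auto
      then show ?thesis using True by (simp add: circ_cmult mult_left_mono)
    next
      case False
      then show ?thesis by simp
    qed
  qed
  also have "\<dots> = ennreal (4 * C) * cmean ?G ((1 + r)/2) * ennreal (pi * \<delta>\<^sup>2)"
    using d by (simp add: nn_integral_cmult emeasure_complex_ball)
  also have "\<dots> = ennreal (4 * pi * deriv_const m q * \<delta> powr (- (m*q))) * cmean ?G ((1 + r)/2)"
  proof -
    have "4 * C * (pi * \<delta>\<^sup>2) = 4 * pi * deriv_const m q * \<delta> powr (- (m*q))"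
      using d by (simp add: C_def)
    moreover have "ennreal (4 * C) * ennreal (pi * \<delta>\<^sup>2) = ennreal (4 * C * (pi * \<delta>\<^sup>2))"
      using C by (intro ennreal_mult[symmetric]) auto
    ultimately have "ennreal (4 * C) * ennreal (pi * \<delta>\<^sup>2) = ennreal (4 * pi * deriv_const m q * \<delta> powr (- (m*q)))"
      by (simp only:)
    moreover have "A * M * P = (A * P) * M" for A M P :: ennreal by (simp add: mult_ac)
    ultimately show ?thesis by (simp only:)
  qed
  finally show ?thesis unfolding \<delta>_def .
qed

section \<open>Regular weights\<close>

definition radius :: "real \<Rightarrow> nat \<Rightarrow> real" where
  "radius K j = 1 - 1 / K ^ j"

text \<open>The midpoint of \<open>radius K (Suc j)\<close> and 1: the furthest that the step from r
  to (1 + r)/2 in the derivative estimate leads from layer j.\<close>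

definition outer_radius :: "real \<Rightarrow> nat \<Rightarrow> real" where
  "outer_radius K j = 1 - 1 / (2 * K ^ Suc j)"

definition layer :: "real \<Rightarrow> nat \<Rightarrow> real set" where
  "layer K j = {radius K j..<radius K (Suc j)}"

text \<open>An axiomatic form of the class D. For a weight in D, \<open>W\<close> consists of the
  tails at the radii; \<open>W_dec\<close> then stems from one of the two conditions and
  \<open>W_low\<close> from the other. \<open>W\<close> is a parameter of its own because the notion
  has to survive multiplication by powers of 1 - r, after which rescaled tails are used.\<close>

locale regular_weight =
  fixes K lam c :: real and w :: "real \<Rightarrow> real" and W :: "nat \<Rightarrow> real"
  assumes K: "2 \<le> K" and lam: "0 < lam" "lam < 1" and c: "0 < c"
    and w_meas [measurable]: "w \<in> borel_measurable borel" and w_nonneg: "0 \<le> w r"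
    and W_pos: "0 < W j" and W_dec: "W (Suc j) \<le> lam * W j" and W_low: "c * W j \<le> W (Suc j)"
    and layer_lower: "ennreal (c * W j) \<le> (\<integral>\<^sup>+r\<in>layer K j. ennreal (w r) \<partial>lborel)"
    and layer_upper: "(\<integral>\<^sup>+r\<in>layer K j. ennreal (w r) \<partial>lborel) \<le> ennreal (W j)"
begin

lemma K_pos [simp]: "0 < K" "K \<noteq> 0" "0 \<le> K" "1 \<le> K"
  using K by auto

lemma Kp: "0 < K ^ j" "1 \<le> K ^ j"
  using K by auto

lemma radius_0 [simp]: "radius K 0 = 0"
  by (simp add: radius_def)

lemma radius_less_Suc: "radius K j < radius K (Suc j)"
  using K Kp[of j] by (simp add: radius_def field_simps)

lemma radius_mono: "i \<le> j \<Longrightarrow> radius K i \<le> radius K j"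
  by (rule lift_Suc_mono_le[of "radius K"]) (simp_all add: radius_less_Suc less_imp_le)

lemma radius_nonneg: "0 \<le> radius K j" and radius_less_1: "radius K j < 1"
  using Kp[of j] by (auto simp: radius_def)

lemma outer_radius_bounds:
  "radius K (Suc j) \<le> outer_radius K j" "outer_radius K j \<le> radius K (j + 2)" "outer_radius K j < 1"
  "0 \<le> outer_radius K j"
proof -
  have "2 * K ^ Suc j \<le> K * K ^ Suc j" using K Kp[of "Suc j"] by (intro mult_right_mono) auto
  then have "2 * K ^ Suc j \<le> K ^ (j + 2)" by (simp add: mult_ac)
  then have "1 / K ^ (j + 2) \<le> 1 / (2 * K ^ Suc j)"
    using Kp[of "Suc j"] by (intro divide_left_mono) auto
  then show "outer_radius K j \<le> radius K (j + 2)" by (simp only: radius_def outer_radius_def)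
  have "1 / (2 * x) \<le> 1 / x" "0 < 1 / (2 * x)" if "0 < x" for x :: real
    using that by (simp_all add: field_simps)
  from this[OF Kp(1)[of "Suc j"]]
  show 1: "radius K (Suc j) \<le> outer_radius K j" "outer_radius K j < 1"
    unfolding radius_def outer_radius_def by linarith+
  show "0 \<le> outer_radius K j" using radius_nonneg[of "Suc j"] 1 by linarith
qed

lemma layer_disjoint: "disjoint_family (layer K)"
  unfolding disjoint_family_on_def layer_def
proof (intro ballI impI)
  fix i j :: nat assume "i \<noteq> j"
  then consider "Suc i \<le> j" | "Suc j \<le> i" by linarith
  then show "{radius K i..<radius K (Suc i)} \<inter> {radius K j..<radius K (Suc j)} = {}"
    by cases (auto dest!: radius_mono)
qed

lemma layer_subset: "layer K j \<subseteq> {0..<1}"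
  using radius_nonneg[of j] radius_less_1[of "Suc j"] by (auto simp: layer_def)

lemma layer_cover:
  assumes "0 \<le> r" "r < 1"
  obtains j where "r \<in> layer K j"
proof -
  obtain n where "1 / (1 - r) < K ^ n"
    using real_arch_pow[of K "1 / (1-r)"] K by auto
  then have "r < radius K n" using assms Kp[of n] by (simp add: radius_def field_simps)
  define k where "k = (LEAST n. r < radius K n)"
  have k: "r < radius K k" unfolding k_def using \<open>r < radius K n\<close> by (rule LeastI)
  have "k \<noteq> 0" using k assms by (metis radius_0 not_le)
  then obtain j where j: "k = Suc j" by (metis not0_implies_Suc)
  then have "\<not> r < radius K j" unfolding k_def by (metis lessI not_less_Least)
  then show ?thesis using that[of j] k j by (auto simp: layer_def)
qed

lemma layer_Union: "(\<Union>j. layer K j) = {0..<1}"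
proof
  show "(\<Union>j. layer K j) \<subseteq> {0..<1}" using layer_subset by blast
  show "{0..<1} \<subseteq> (\<Union>j. layer K j)"
  proof
    fix r :: real assume "r \<in> {0..<1}"
    then obtain j where "r \<in> layer K j" using layer_cover[of r] by auto
    then show "r \<in> (\<Union>j. layer K j)" by blast
  qed
qed

lemma suminf_indicator_layer: "(\<Sum>j. indicator (layer K j) r) = (indicator {0..<1} r :: ennreal)"
  using suminf_indicator[OF layer_disjoint, of r] by (simp add: layer_Union)

lemma layer_measurable [measurable]: "layer K j \<in> sets borel"
  by (simp add: layer_def)

lemma nn_integral_layers:
  assumes [measurable]: "g \<in> borel_measurable borel"
  shows "(\<integral>\<^sup>+r\<in>{0..<1}. g r \<partial>lborel) = (\<Sum>j. \<integral>\<^sup>+r\<in>layer K j. g r \<partial>lborel)"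
proof -
  have "(\<integral>\<^sup>+r\<in>{0..<1}. g r \<partial>lborel) = (\<integral>\<^sup>+r. (\<Sum>j. g r * indicator (layer K j) r) \<partial>lborel)"
    by (simp add: suminf_indicator_layer[symmetric])
  also have "\<dots> = (\<Sum>j. \<integral>\<^sup>+r\<in>layer K j. g r \<partial>lborel)"
    by (rule nn_integral_suminf) measurable
  finally show ?thesis .
qed

lemma nn_integral_layer_le:
  assumes "\<And>r. r \<in> layer K j \<Longrightarrow> h r \<le> B"
  shows "(\<integral>\<^sup>+r\<in>layer K j. ennreal (w r * r) * h r \<partial>lborel) \<le> ennreal (W j) * B"
proof -
  have "(\<integral>\<^sup>+r\<in>layer K j. ennreal (w r * r) * h r \<partial>lborel) \<le> (\<integral>\<^sup>+r. ennreal (w r) * indicator (layer K j) r * B \<partial>lborel)"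
  proof (rule nn_integral_mono)
    fix r
    show "ennreal (w r * r) * h r * indicator (layer K j) r \<le> ennreal (w r) * indicator (layer K j) r * B"
    proof (cases "r \<in> layer K j")
      case True
      then have "r \<le> 1" using layer_subset[of j] by auto
      then have "ennreal (w r * r) * h r \<le> ennreal (w r) * B"
        using assms[OF True] w_nonneg[of r] by (intro mult_mono ennreal_leI) (auto simp: mult_left_le)
      then show ?thesis using True by simp
    qed simp
  qed
  also have "\<dots> = (\<integral>\<^sup>+r\<in>layer K j. ennreal (w r) \<partial>lborel) * B"
    by (rule nn_integral_multc) measurable
  also have "\<dots> \<le> ennreal (W j) * B" by (intro mult_right_mono layer_upper) simp
  finally show ?thesis .
qed

definition "level_const = 2 / c ^ 3"

lemma level_const_pos: "level_const > 0"
  using c by (simp add: level_const_def)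

text \<open>The value of \<open>M\<close> at the outer radius of layer j is at most its values on
  layer j + 2, whose mass is at least c W (j + 2) >= c^3 W j. There r >= 1/2, so the factor r of
  polar coordinates costs 2; this gives \<open>level_const\<close>.\<close>

lemma level_sum:
  assumes [measurable]: "M \<in> borel_measurable borel"
    and mono: "\<And>s t. 0 \<le> s \<Longrightarrow> s \<le> t \<Longrightarrow> t < 1 \<Longrightarrow> M s \<le> M t"
  shows "(\<Sum>j. ennreal (W j) * M (outer_radius K j)) \<le> ennreal level_const * (\<integral>\<^sup>+r\<in>{0..<1}. ennreal (w r * r) * M r \<partial>lborel)"
proof -
  define I where "I j = (\<integral>\<^sup>+r\<in>layer K j. ennreal (w r * r) * M r \<partial>lborel)" for j
  have le: "ennreal (W j) * M (outer_radius K j) \<le> ennreal level_const * I (j + 2)" for j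
  proof -
    let ?B = "M (outer_radius K j)"
    have "c * (c * (c * W j)) \<le> c * W (j + 2)"
    proof -
      have "c * (c * W j) \<le> c * W (Suc j)" using c W_low[of j] by (intro mult_left_mono) auto
      also have "\<dots> \<le> W (j + 2)" using W_low[of "Suc j"] by simp
      finally show ?thesis using c by (intro mult_left_mono) auto
    qed
    then have "c ^ 3 * W j \<le> c * W (j + 2)" by (simp only: power3_eq_cube mult.assoc)
    then have "W j \<le> c * W (j + 2) / c ^ 3" using c by (subst pos_le_divide_eq) (auto simp: mult.commute)
    also have "\<dots> = level_const * (c * W (j + 2) * (1/2))" by (simp add: level_const_def)
    finally have "W j \<le> level_const * (c * W (j + 2) * (1/2))" .
    then have "ennreal (W j) * ?B \<le> ennreal (level_const * (c * W (j + 2) * (1/2))) * ?B"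
      by (intro mult_right_mono ennreal_leI) auto
    also have "\<dots> = ennreal level_const * (ennreal (c * W (j + 2)) * (ennreal (1/2) * ?B))"
    proof -
      have "ennreal (level_const * (c * W (j + 2) * (1/2))) = ennreal level_const * ennreal (c * W (j + 2) * (1/2))"
        using level_const_pos by (intro ennreal_mult') simp
      moreover have "ennreal (c * W (j + 2) * (1/2)) = ennreal (c * W (j + 2)) * ennreal (1/2)"
        by (intro ennreal_mult'') simp
      ultimately show ?thesis by (simp only: mult.assoc)
    qed
    also have "\<dots> \<le> ennreal level_const * ((\<integral>\<^sup>+r\<in>layer K (j + 2). ennreal (w r) \<partial>lborel) * (ennreal (1/2) * ?B))"
      by (intro mult_left_mono mult_right_mono layer_lower) auto
    also have "(\<integral>\<^sup>+r\<in>layer K (j + 2). ennreal (w r) \<partial>lborel) * (ennreal (1/2) * ?B)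
        = (\<integral>\<^sup>+r. ennreal (w r) * indicator (layer K (j + 2)) r * (ennreal (1/2) * ?B) \<partial>lborel)"
      by (rule nn_integral_multc[symmetric]) measurable
    also have "\<dots> \<le> I (j + 2)"
      unfolding I_def
    proof (rule nn_integral_mono)
      fix r
      show "ennreal (w r) * indicator (layer K (j + 2)) r * (ennreal (1/2) * ?B) \<le> ennreal (w r * r) * M r * indicator (layer K (j + 2)) r"
      proof (cases "r \<in> layer K (j + 2)")
        case True
        then have r: "radius K (j + 2) \<le> r" "r < 1" using layer_subset[of "j+2"] by (auto simp: layer_def)
        have "1/2 \<le> r"
        proof -
          have "2 \<le> K ^ (j + 2)" using K Kp(2)[of "j+1"] mult_mono[of 2 K 1 "K^(j+1)"] by simp
          then have "1 / K ^ (j+2) \<le> 1/2" by (intro divide_left_mono) auto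
          then show ?thesis using r(1) unfolding radius_def by linarith
        qed
        moreover have "?B \<le> M r" using r outer_radius_bounds[of j] by (intro mono) auto
        ultimately have "ennreal (w r * (1/2)) * ?B \<le> ennreal (w r * r) * M r"
          using w_nonneg[of r] by (intro mult_mono ennreal_leI mult_left_mono) auto
        moreover have "ennreal (w r * (1/2)) = ennreal (w r) * ennreal (1/2)"
          using w_nonneg[of r] by (rule ennreal_mult) simp
        ultimately show ?thesis using True by (simp add: mult.assoc)
      qed simp
    qed
    finally show ?thesis by (simp add: mult_left_mono)
  qed
  have "(\<Sum>j. ennreal (W j) * M (outer_radius K j)) \<le> (\<Sum>j. ennreal level_const * I (j + 2))"
    by (intro suminf_le le) auto
  also have "\<dots> = ennreal level_const * (\<Sum>j. I (j + 2))" by simp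
  also have "(\<Sum>j. I (j + 2)) \<le> (\<Sum>j. I j)"
  proof (rule suminf_le_const)
    fix n
    have "(\<Sum>j<n. I (j + 2)) = sum I ((\<lambda>j. j + 2) ` {..<n})"
      by (subst sum.reindex) (auto simp: inj_on_def)
    also have "\<dots> \<le> (\<Sum>j. I j)" by (intro sum_le_suminf) auto
    finally show "(\<Sum>j<n. I (j + 2)) \<le> (\<Sum>j. I j)" .
  qed auto
  also have "(\<Sum>j. I j) = (\<integral>\<^sup>+r\<in>{0..<1}. ennreal (w r * r) * M r \<partial>lborel)"
    unfolding I_def by (rule nn_integral_layers[symmetric]) measurable
  finally show ?thesis by (simp add: mult_left_mono)
qed

lemma mean_sum:
  assumes f: "f holomorphic_on unit_disk" and q: "0 < q" and a: "norm a < 1"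
  shows "(\<Sum>j. ennreal (W j) * cmean (\<lambda>z. norm (f z) powr q * pk a z) (outer_radius K j))
    \<le> ennreal level_const * disk_int w (\<lambda>z. norm (f z) powr q * pk a z)"
  unfolding disk_int_def
proof (rule level_sum)
  show "cmean (\<lambda>z. norm (f z) powr q * pk a z) \<in> borel_measurable borel"
    using a by (intro cmean_measurable continuous_intros continuous_on_norm_powr f q continuous_on_pk)
next
  fix s t :: real assume "0 \<le> s" "s \<le> t" "t < 1"
  then show "cmean (\<lambda>z. norm (f z) powr q * pk a z) s \<le> cmean (\<lambda>z. norm (f z) powr q * pk a z) t"
    using circ_pk_mono[OF f q a, of "of_real s" t] by (simp add: cmean_def)
qed

lemma mean_le:
  assumes f: "f holomorphic_on unit_disk" and q: "0 < q" and a: "norm a < 1"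
  shows "ennreal (W j) * cmean (\<lambda>z. norm (f z) powr q * pk a z) (outer_radius K j)
    \<le> ennreal level_const * disk_int w (\<lambda>z. norm (f z) powr q * pk a z)"
  using sum_le_suminf[of "\<lambda>j. ennreal (W j) * cmean (\<lambda>z. norm (f z) powr q * pk a z) (outer_radius K j)" "{j}"]
    mean_sum[OF assms] by (auto intro: order_trans)

text \<open>On layer j the factor (1 - r)^p lies between its values at the two ends, whose ratio is
  K^-p. The decay rate survives because the new factor decreases with j.\<close>

lemma power_weight:
  assumes p: "0 \<le> p"
  shows "regular_weight K lam (c * K powr (-p)) (\<lambda>r. w r * (1 - r) powr p) (\<lambda>j. W j * (1 / K ^ j) powr p)"
proof unfold_locales
  have Kpp: "0 < K powr (-p)" "K powr (-p) \<le> 1"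
    using p powr_mono[of "-p" 0 K] by auto
  have step: "(1 / K ^ Suc j) powr p = K powr (-p) * (1 / K ^ j) powr p" for j
    by (simp add: powr_mult powr_minus divide_inverse inverse_powr)
  fix j :: nat and r :: real
  let ?P = "(1 / K ^ j) powr p"
  have P: "0 < ?P" by simp
  show "2 \<le> K" "0 < lam" "lam < 1" by (fact K lam)+
  show "0 < c * K powr (-p)" using c by simp
  show "(\<lambda>r. w r * (1 - r) powr p) \<in> borel_measurable borel" by measurable
  show "0 \<le> w r * (1 - r) powr p" using w_nonneg[of r] by simp
  show "0 < W j * ?P" using W_pos[of j] P by simp
  show "W (Suc j) * (1 / K ^ Suc j) powr p \<le> lam * (W j * ?P)"
  proof -
    have "W (Suc j) * (K powr (-p) * ?P) \<le> (lam * W j) * (1 * ?P)"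
      using W_dec[of j] Kpp lam W_pos[of j] by (intro mult_mono) auto
    then show ?thesis unfolding step by (simp add: mult_ac)
  qed
  show "c * K powr (-p) * (W j * ?P) \<le> W (Suc j) * (1 / K ^ Suc j) powr p"
  proof -
    have "(c * W j) * (K powr (-p) * ?P) \<le> W (Suc j) * (K powr (-p) * ?P)"
      using W_low[of j] by (intro mult_right_mono) auto
    then show ?thesis unfolding step by (simp add: mult_ac)
  qed
  have in_layer: "(1 / K ^ Suc j) powr p \<le> (1 - r) powr p" "(1 - r) powr p \<le> ?P" if "r \<in> layer K j" for r
  proof -
    have "r < 1" "1 - 1 / K ^ j \<le> r" "r < 1 - 1 / K ^ Suc j"
      using subsetD[OF layer_subset that] that
      by (simp_all only: layer_def radius_def atLeastLessThan_iff)
    then show "(1 / K ^ Suc j) powr p \<le> (1 - r) powr p" "(1 - r) powr p \<le> ?P"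
      using p Kp[of "Suc j"] by (auto simp del: power_Suc intro!: powr_mono2)
  qed
  show "ennreal (c * K powr (-p) * (W j * ?P)) \<le> (\<integral>\<^sup>+r\<in>layer K j. ennreal (w r * (1 - r) powr p) \<partial>lborel)"
  proof -
    have "ennreal (c * K powr (-p) * (W j * ?P)) = ennreal (c * W j) * ennreal ((1 / K ^ Suc j) powr p)"
      unfolding step using c W_pos[of j] by (subst ennreal_mult[symmetric]) (auto simp: mult_ac)
    also have "\<dots> \<le> (\<integral>\<^sup>+r\<in>layer K j. ennreal (w r) \<partial>lborel) * ennreal ((1 / K ^ Suc j) powr p)"
      by (intro mult_right_mono layer_lower) simp
    also have "\<dots> = (\<integral>\<^sup>+r. ennreal (w r) * indicator (layer K j) r * ennreal ((1 / K ^ Suc j) powr p) \<partial>lborel)"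
      by (rule nn_integral_multc[symmetric]) measurable
    also have "\<dots> \<le> (\<integral>\<^sup>+r\<in>layer K j. ennreal (w r * (1 - r) powr p) \<partial>lborel)"
      using in_layer(1) w_nonneg by (intro nn_integral_mono) (auto simp: indicator_def ennreal_mult[symmetric] intro!: ennreal_leI mult_left_mono)
    finally show ?thesis .
  qed
  show "(\<integral>\<^sup>+r\<in>layer K j. ennreal (w r * (1 - r) powr p) \<partial>lborel) \<le> ennreal (W j * ?P)"
  proof -
    have "(\<integral>\<^sup>+r\<in>layer K j. ennreal (w r * (1 - r) powr p) \<partial>lborel) \<le> (\<integral>\<^sup>+r. ennreal (w r) * indicator (layer K j) r * ennreal ?P \<partial>lborel)"
      using in_layer(2) w_nonneg by (intro nn_integral_mono) (auto simp: indicator_def ennreal_mult[symmetric] intro!: ennreal_leI mult_left_mono)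
    also have "\<dots> = (\<integral>\<^sup>+r\<in>layer K j. ennreal (w r) \<partial>lborel) * ennreal ?P"
      by (rule nn_integral_multc) measurable
    also have "\<dots> \<le> ennreal (W j) * ennreal ?P"
      by (intro mult_right_mono layer_upper) simp
    finally show ?thesis using W_pos[of j] by (simp add: ennreal_mult less_imp_le)
  qed
qed

lemma disk_int_layers:
  assumes G: "continuous_on unit_disk G" and [measurable]: "v \<in> borel_measurable borel"
  shows "disk_int v G = (\<Sum>j. \<integral>\<^sup>+r\<in>layer K j. ennreal (v r * r) * cmean G r \<partial>lborel)"
proof -
  note [measurable] = cmean_measurable[OF G]
  show ?thesis unfolding disk_int_def by (rule nn_integral_layers) measurable
qed

text \<open>On layer j the factor (1 - r)^(m q) cancels the negative power of the radius in the
  Cauchy estimate. What remains is a mean at \<open>outer_radius K j\<close>, and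
  \<open>mean_sum\<close> turns the sum of these back into a weighted integral.\<close>

proposition disk_int_higher_deriv:
  assumes q: "0 < q"
  shows "\<exists>C>0. \<forall>f a. f holomorphic_on unit_disk \<longrightarrow> norm a < 1 \<longrightarrow>
    disk_int (\<lambda>r. w r * (1 - r) powr (m * q)) (\<lambda>z. norm ((deriv ^^ m) f z) powr q * pk a z)
      \<le> ennreal C * disk_int w (\<lambda>z. norm (f z) powr q * pk a z)"
proof -
  define D where "D = 4 * pi * deriv_const m q * 2 powr (m * q)"
  have D: "D > 0" using deriv_const_pos[of m q] by (simp add: D_def)
  show ?thesis
  proof (intro exI[of _ "D * level_const"] conjI allI impI)
    show "0 < D * level_const" using D level_const_pos by simp
    fix f a assume f: "f holomorphic_on unit_disk" and a: "norm (a::complex) < 1"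
    let ?G = "\<lambda>z. norm (f z) powr q * pk a z" and ?H = "\<lambda>z. norm ((deriv ^^ m) f z) powr q * pk a z"
    have fm: "(deriv ^^ m) f holomorphic_on unit_disk" by (intro holomorphic_higher_deriv f open_ball)
    have H: "continuous_on unit_disk ?H"
      using a by (intro continuous_intros continuous_on_norm_powr fm q continuous_on_pk)
    have le: "ennreal ((1 - r) powr (m*q)) * cmean ?H r \<le> ennreal D * cmean ?G (outer_radius K j)" if "r \<in> layer K j" for r j
    proof -
      have r: "0 \<le> r" "r < 1" "r < radius K (Suc j)" using that layer_subset[of j] by (auto simp: layer_def)
      have "(1 + r)/2 \<le> outer_radius K j"
        using r Kp[of "Suc j"] by (simp add: radius_def outer_radius_def field_simps)
      then have *: "cmean ?G ((1 + r)/2) \<le> cmean ?G (outer_radius K j)"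
        using circ_pk_mono[OF f q a, of "of_real ((1+r)/2)" "outer_radius K j"] r outer_radius_bounds[of j]
        by (simp add: cmean_def del: of_real_divide of_real_add)
      have "ennreal ((1 - r) powr (m*q)) * cmean ?H r \<le>
         ennreal ((1 - r) powr (m*q)) * (ennreal (4 * pi * deriv_const m q * ((1-r)/2) powr (- (m*q))) * cmean ?G ((1 + r)/2))"
        by (intro mult_left_mono cmean_higher_deriv f q a r) auto
      also have "\<dots> = ennreal D * cmean ?G ((1 + r)/2)"
      proof -
        have "(1 - r) powr (m*q) * (4 * pi * deriv_const m q * ((1-r)/2) powr (- (m*q))) = D"
          using r by (simp add: D_def powr_divide powr_minus field_simps)
        moreover have "ennreal ((1 - r) powr (m*q)) * ennreal (4 * pi * deriv_const m q * ((1-r)/2) powr (- (m*q)))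
           = ennreal ((1 - r) powr (m*q) * (4 * pi * deriv_const m q * ((1-r)/2) powr (- (m*q))))"
          using deriv_const_pos[of m q] by (intro ennreal_mult[symmetric]) auto
        ultimately show ?thesis by (simp only: mult.assoc[symmetric])
      qed
      also have "\<dots> \<le> ennreal D * cmean ?G (outer_radius K j)" by (intro mult_left_mono *) simp
      finally show ?thesis .
    qed
    have "disk_int (\<lambda>r. w r * (1 - r) powr (m * q)) ?H =
        (\<Sum>j. \<integral>\<^sup>+r\<in>layer K j. ennreal (w r * (1 - r) powr (m * q) * r) * cmean ?H r \<partial>lborel)"
      by (rule disk_int_layers[OF H]) measurable
    also have "\<dots> \<le> (\<Sum>j. ennreal D * (ennreal (W j) * cmean ?G (outer_radius K j)))"
    proof (rule suminf_le)
      fix j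
      have "(\<integral>\<^sup>+r\<in>layer K j. ennreal (w r * (1 - r) powr (m * q) * r) * cmean ?H r \<partial>lborel)
         = (\<integral>\<^sup>+r\<in>layer K j. ennreal (w r * r) * (ennreal ((1 - r) powr (m * q)) * cmean ?H r) \<partial>lborel)"
      proof (rule nn_integral_cong)
        fix r show "ennreal (w r * (1 - r) powr (m * q) * r) * cmean ?H r * indicator (layer K j) r =
          ennreal (w r * r) * (ennreal ((1 - r) powr (m * q)) * cmean ?H r) * indicator (layer K j) r"
          using w_nonneg[of r] layer_subset[of j]
          by (cases "r \<in> layer K j") (auto simp: ennreal_mult mult_ac subset_iff)
      qed
      also have "\<dots> \<le> ennreal (W j) * (ennreal D * cmean ?G (outer_radius K j))"
        by (rule nn_integral_layer_le) (rule le)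
      finally show "(\<integral>\<^sup>+r\<in>layer K j. ennreal (w r * (1 - r) powr (m * q) * r) * cmean ?H r \<partial>lborel)
        \<le> ennreal D * (ennreal (W j) * cmean ?G (outer_radius K j))" by (simp add: mult_ac)
    qed auto
    also have "\<dots> = ennreal D * (\<Sum>j. ennreal (W j) * cmean ?G (outer_radius K j))" by simp
    also have "\<dots> \<le> ennreal D * (ennreal level_const * disk_int w ?G)"
      by (intro mult_left_mono mean_sum f q a) simp
    also have "\<dots> = ennreal (D * level_const) * disk_int w ?G"
      using D level_const_pos by (simp add: ennreal_mult mult.assoc)
    finally show "disk_int (\<lambda>r. w r * (1 - r) powr (m * q)) ?H \<le> ennreal (D * level_const) * disk_int w ?G" .
  qed
qed

text \<open>The Cauchy estimate at radius 0 leads to the mean at 1/2, which a single term of the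
  layer sum controls, as \<open>W 0\<close> is positive.\<close>

proposition higher_deriv_at_0:
  assumes q: "0 < q"
  shows "\<exists>C>0. \<forall>f. f holomorphic_on unit_disk \<longrightarrow>
    ennreal (norm ((deriv ^^ m) f 0) powr q) \<le> ennreal C * disk_int w (\<lambda>z. norm (f z) powr q * pk 0 z)"
proof -
  define D where "D = 4 * pi * deriv_const m q * (1/2) powr (- (m * q))"
  have D: "D > 0" using deriv_const_pos[of m q] by (simp add: D_def)
  define C where "C = D * level_const / (2 * pi * W 0)"
  have C: "C > 0" using D level_const_pos W_pos[of 0] by (simp add: C_def)
  show ?thesis
  proof (intro exI[of _ C] conjI allI impI C)
    fix f assume f: "f holomorphic_on unit_disk"
    let ?G = "\<lambda>z. norm (f z) powr q * pk 0 z" and ?H = "\<lambda>z. norm ((deriv ^^ m) f z) powr q * pk 0 z"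
    let ?I = "disk_int w ?G"
    define x where "x = norm ((deriv ^^ m) f 0) powr q"
    have "ennreal (2 * pi) * ennreal (norm ((deriv ^^ m) f 0) powr q) = cmean ?H 0"
      by (simp add: cmean_def on_disk_def pk_def)
    also have "\<dots> \<le> ennreal D * cmean ?G (1/2)"
      using cmean_higher_deriv[OF f q, of 0 0 m] by (simp add: D_def)
    also have "cmean ?G (1/2) \<le> cmean ?G (outer_radius K 0)"
    proof -
      have "1/2 \<le> outer_radius K 0" using K by (simp add: outer_radius_def field_simps)
      then show ?thesis
        using circ_pk_mono[OF f q, of 0 "1/2" "outer_radius K 0"] outer_radius_bounds[of 0] by (simp add: cmean_def)
    qed
    finally have "ennreal (W 0) * (ennreal (2 * pi) * ennreal (norm ((deriv ^^ m) f 0) powr q)) \<le> ennreal (W 0) * (ennreal D * cmean ?G (outer_radius K 0))"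
      by (simp add: mult_left_mono)
    also have "\<dots> = ennreal D * (ennreal (W 0) * cmean ?G (outer_radius K 0))" by (simp add: mult_ac)
    also have "\<dots> \<le> ennreal D * (ennreal level_const * ?I)"
      by (intro mult_left_mono mean_le f q) auto
    finally have *: "ennreal (W 0) * (ennreal (2 * pi) * ennreal x) \<le> ennreal D * (ennreal level_const * ?I)"
      unfolding x_def .
    define y where "y = 1 / (W 0 * (2 * pi))"
    have y: "0 < y" "y * (W 0 * (2 * pi)) = 1" using W_pos[of 0] by (auto simp: y_def)
    have "ennreal y * (ennreal (W 0) * ennreal (2 * pi)) = ennreal (y * (W 0 * (2 * pi)))"
    proof -
      have "ennreal (y * (W 0 * (2 * pi))) = ennreal y * ennreal (W 0 * (2 * pi))"
        using y(1) by (intro ennreal_mult') simp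
      moreover have "ennreal (W 0 * (2 * pi)) = ennreal (W 0) * ennreal (2 * pi)"
        by (intro ennreal_mult'') simp
      ultimately show ?thesis by (simp only:)
    qed
    then have "ennreal x = ennreal y * (ennreal (W 0) * (ennreal (2 * pi) * ennreal x))"
      unfolding y(2) by (simp only: mult.assoc[symmetric] ennreal_1 mult_1_left)
    also have "\<dots> \<le> ennreal y * (ennreal D * (ennreal level_const * ?I))"
      by (intro mult_left_mono *) simp
    also have "\<dots> = ennreal (y * (D * level_const)) * ?I"
      using y D level_const_pos by (simp add: ennreal_mult mult.assoc less_imp_le)
    also have "y * (D * level_const) = C" by (simp add: y_def C_def)
    finally have "ennreal (norm ((deriv ^^ m) f 0) powr q) \<le> ennreal C * ?I" unfolding x_def .
    then show "ennreal (norm ((deriv ^^ m) f 0) powr q) \<le> ennreal C * ?I" .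
  qed
qed

end

section \<open>Estimating a function by its derivative\<close>

text \<open>The point is that g may be as close to 1 as desired. With (1 + e)^q = g the first term
  absorbs y as long as y <= e x, and otherwise x < y / e.\<close>

lemma powr_add_le:
  fixes q g :: real
  assumes q: "0 < q" and g: "1 < g"
  shows "\<exists>C>0. \<forall>x y. 0 \<le> x \<longrightarrow> 0 \<le> y \<longrightarrow> (x + y) powr q \<le> g * x powr q + C * y powr q"
proof -
  define e where "e = g powr (1/q) - 1"
  have e: "0 < e" using q g by (simp add: e_def)
  have eg: "(1 + e) powr q = g" using q g by (simp add: e_def powr_powr)
  show ?thesis
  proof (intro exI[of _ "(1 + 1/e) powr q"] conjI allI impI)
    have "0 < 1 + 1/e" using e by (intro add_pos_pos) auto
    then show "0 < (1 + 1/e) powr q" by simp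
    fix x y :: real assume xy: "0 \<le> x" "0 \<le> y"
    show "(x + y) powr q \<le> g * x powr q + (1 + 1/e) powr q * y powr q"
    proof (cases "y \<le> e * x")
      case True
      then have "(x + y) powr q \<le> ((1 + e) * x) powr q"
        using xy q by (intro powr_mono2) (auto simp: algebra_simps)
      also have "\<dots> = g * x powr q" using xy e by (simp add: powr_mult eg)
      finally show ?thesis by (simp add: add_increasing2)
    next
      case False
      then have "(x + y) powr q \<le> ((1 + 1/e) * y) powr q"
        using xy q e by (intro powr_mono2) (auto simp: field_simps)
      also have "\<dots> = (1 + 1/e) powr q * y powr q" using xy e by (simp add: powr_mult)
      finally show ?thesis using g by (simp add: add_increasing)
    qed
  qed
qed

text \<open>A summed recursion in a form that never subtracts possibly infinite terms; the
  additional \<open>k * Y n\<close> on the left makes the induction close.\<close>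

lemma geometric_recursion:
  fixes Y d :: "nat \<Rightarrow> ennreal"
  assumes k: "0 \<le> k" "k \<le> 1" and rec: "\<And>i. Y (Suc i) \<le> ennreal k * Y i + d i"
  shows "ennreal (1 - k) * (\<Sum>i\<le>n. Y i) + ennreal k * Y n \<le> Y 0 + (\<Sum>i<n. d i)"
proof (induction n)
  case 0
  have "ennreal (1 - k) * Y 0 + ennreal k * Y 0 = (ennreal (1 - k) + ennreal k) * Y 0"
    by (simp add: distrib_right)
  also have "ennreal (1 - k) + ennreal k = 1" using k by (subst ennreal_plus[symmetric]) auto
  finally show ?case by simp
next
  case (Suc n)
  have "ennreal (1 - k) * Y (Suc n) + ennreal k * Y (Suc n) = (ennreal (1 - k) + ennreal k) * Y (Suc n)"
    by (simp add: distrib_right)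
  also have "ennreal (1 - k) + ennreal k = 1" using k by (subst ennreal_plus[symmetric]) auto
  finally have "ennreal (1 - k) * (\<Sum>i\<le>Suc n. Y i) + ennreal k * Y (Suc n) = ennreal (1 - k) * (\<Sum>i\<le>n. Y i) + Y (Suc n)"
    by (simp add: distrib_left add.assoc)
  also have "\<dots> \<le> ennreal (1 - k) * (\<Sum>i\<le>n. Y i) + (ennreal k * Y n + d n)"
    by (intro add_left_mono rec)
  also have "\<dots> \<le> (Y 0 + (\<Sum>i<n. d i)) + d n"
    using Suc.IH by (simp add: add.assoc[symmetric] add_right_mono)
  finally show ?case by (simp add: add.assoc)
qed

context regular_weight
begin

text \<open>Contains small balls around all points of layer j on the positive real axis, yet stays
  within \<open>1 / K ^ j\<close> of the point \<open>radius K j\<close>, so that the kernel varies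
  on it by a bounded factor only. Other directions are reached by the rotation
  \<open>u\<close>.\<close>

definition patch :: "nat \<Rightarrow> complex set" where
  "patch j = {v. norm v \<le> outer_radius K j \<and> norm (of_real (radius K j) - v) \<le> 1 / K ^ j}"

definition patch_int :: "nat \<Rightarrow> (complex \<Rightarrow> real) \<Rightarrow> complex \<Rightarrow> ennreal" where
  "patch_int j G u = (\<integral>\<^sup>+v\<in>patch j. on_disk G (v * u) \<partial>lborel)"

lemma patch_measurable [measurable]: "patch j \<in> sets borel"
  unfolding patch_def by measurable

lemma patch_norm: "v \<in> patch j \<Longrightarrow> norm v < 1"
  using outer_radius_bounds[of j] by (auto simp: patch_def)

lemma patch_subset_ball: "patch j \<subseteq> ball (of_real (radius K j)) (2 / K ^ j)"
proof
  fix v assume "v \<in> patch j"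
  then have "norm (of_real (radius K j) - v) \<le> 1 / K ^ j" by (simp add: patch_def)
  also have "\<dots> < 2 / K ^ j" using Kp[of j] by (simp add: divide_strict_right_mono)
  finally show "v \<in> ball (of_real (radius K j)) (2 / K ^ j)" by (simp add: dist_norm)
qed

lemma patch_int_measurable:
  assumes "continuous_on unit_disk G"
  shows "patch_int j G \<in> borel_measurable borel"
  unfolding patch_int_def[abs_def] using on_disk_measurable[OF assms, measurable] by measurable

text \<open>The kernel at the inner end of the layer is exchanged for the one at the integration
  point at a cost of 4; then Tonelli and the monotone means apply. The area is that of a ball of
  radius \<open>2 / K ^ j\<close> enclosing the patch.\<close>

lemma circ_patch_int:
  assumes g: "g holomorphic_on unit_disk" and q: "0 < q" and a: "norm a < 1"
  shows "circ (\<lambda>u. on_disk (pk a) (of_real (radius K j) * u) * patch_int j (\<lambda>z. norm (g z) powr q) u)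
    \<le> ennreal (16 * pi * (1 / K ^ j)\<^sup>2) * cmean (\<lambda>z. norm (g z) powr q * pk a z) (outer_radius K j)"
proof -
  let ?G = "\<lambda>z. norm (g z) powr q * pk a z" and ?P = "\<lambda>z. norm (g z) powr q"
  have P: "continuous_on unit_disk ?P" by (rule continuous_on_norm_powr[OF g q])
  have G: "continuous_on unit_disk ?G"
    using a by (intro continuous_intros P continuous_on_pk)
  note [measurable] = on_disk_measurable[OF G] on_disk_measurable[OF P]
  note r = radius_nonneg[of j] radius_less_1[of j]
  have "circ (\<lambda>u. on_disk (pk a) (of_real (radius K j) * u) * patch_int j ?P u)
    \<le> circ (\<lambda>u. \<integral>\<^sup>+v. 4 * (on_disk ?G (v * u) * indicator (patch j) v) \<partial>lborel)"
  proof (rule circ_mono)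
    fix u :: complex assume u: "norm u = 1"
    have "on_disk (pk a) (of_real (radius K j) * u) * patch_int j ?P u
      = (\<integral>\<^sup>+v. on_disk (pk a) (of_real (radius K j) * u) * (on_disk ?P (v * u) * indicator (patch j) v) \<partial>lborel)"
      unfolding patch_int_def by (rule nn_integral_cmult[symmetric]) measurable
    also have "\<dots> \<le> (\<integral>\<^sup>+v. 4 * (on_disk ?G (v * u) * indicator (patch j) v) \<partial>lborel)"
    proof (rule nn_integral_mono)
      fix v
      show "on_disk (pk a) (of_real (radius K j) * u) * (on_disk ?P (v * u) * indicator (patch j) v)
        \<le> 4 * (on_disk ?G (v * u) * indicator (patch j) v)"
      proof (cases "v \<in> patch j")
        case True
        have nr: "norm (of_real (radius K j) * u) = radius K j" using u r by (simp add: norm_mult)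
        have nv: "norm (v * u) < 1" using patch_norm[OF True] u by (simp add: norm_mult)
        have "norm (of_real (radius K j) * u - v * u) = norm (of_real (radius K j) - v)"
          using u by (simp add: left_diff_distrib[symmetric] norm_mult)
        also have "\<dots> \<le> 1 - radius K j" using True by (simp add: patch_def radius_def)
        also have "\<dots> \<le> 1 * norm (1 - cnj a * (of_real (radius K j) * u))"
          using norm_kernel_ge(1)[OF a, of "of_real (radius K j) * u"] r nr by simp
        finally have "pk a (of_real (radius K j) * u) \<le> (1 + 1)\<^sup>2 * pk a (v * u)"
          using nr r nv by (intro pk_compare a) auto
        then have "ennreal (pk a (of_real (radius K j) * u)) \<le> ennreal (4 * pk a (v * u))" by (simp add: ennreal_leI)
        then have "ennreal (pk a (of_real (radius K j) * u)) * ennreal (norm (g (v * u)) powr q) \<le> ennreal (4 * pk a (v * u)) * ennreal (norm (g (v * u)) powr q)"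
          by (rule mult_right_mono) simp
        then show ?thesis using True nr nv r pk_nonneg[OF a] by (simp add: on_disk_def ennreal_mult mult_ac)
      qed simp
    qed
    finally show "on_disk (pk a) (of_real (radius K j) * u) * patch_int j ?P u
      \<le> (\<integral>\<^sup>+v. 4 * (on_disk ?G (v * u) * indicator (patch j) v) \<partial>lborel)" .
  qed
  also have "\<dots> = (\<integral>\<^sup>+v. circ (\<lambda>u. 4 * (on_disk ?G (v * u) * indicator (patch j) v)) \<partial>lborel)"
    by (rule circ_Fubini) measurable
  also have "\<dots> \<le> (\<integral>\<^sup>+v. 4 * cmean ?G (outer_radius K j) * indicator (ball (of_real (radius K j)) (2 / K ^ j)) v \<partial>(lborel :: complex measure))"
  proof (rule nn_integral_mono)
    fix v :: complex
    show "circ (\<lambda>u. 4 * (on_disk ?G (v * u) * indicator (patch j) v))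
      \<le> 4 * cmean ?G (outer_radius K j) * indicator (ball (of_real (radius K j)) (2 / K ^ j)) v"
    proof (cases "v \<in> patch j")
      case True
      then have "circ (\<lambda>u. on_disk ?G (v * u)) \<le> cmean ?G (outer_radius K j)"
        using outer_radius_bounds[of j] by (intro circ_pk_mono g q a) (auto simp: patch_def)
      moreover have "v \<in> ball (of_real (radius K j)) (2 / K ^ j)" using patch_subset_ball True by blast
      ultimately show ?thesis using True by (simp add: circ_cmult mult_left_mono del: mem_ball)
    qed simp
  qed
  also have "\<dots> = 4 * cmean ?G (outer_radius K j) * ennreal (pi * (2 / K ^ j)\<^sup>2)"
    using Kp[of j] by (simp add: nn_integral_cmult emeasure_complex_ball)
  also have "\<dots> = ennreal (16 * pi * (1 / K ^ j)\<^sup>2) * cmean ?G (outer_radius K j)"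
  proof -
    have "16 * pi * (1 / K ^ j)\<^sup>2 = 4 * (pi * (2 / K ^ j)\<^sup>2)" by (simp add: power_divide)
    then have "ennreal (16 * pi * (1 / K ^ j)\<^sup>2) = 4 * ennreal (pi * (2 / K ^ j)\<^sup>2)"
      by (simp only: ennreal_mult' zero_le_numeral ennreal_numeral)
    then show ?thesis by (simp only: mult_ac)
  qed
  finally show ?thesis .
qed

text \<open>The counterpart for a single direction. Let b be the inner end of the layer in direction
  \<open>u\<close> and k = 1 - |b|. The kernel of b is at least 1 / (9 k) on the rotated patch,
  which lies in an annulus of width at most 2 k, and all circle means there are below the mean at
  the outer radius. The product of 9 k and 2 k is the constant.\<close>

lemma patch_int_le_mean:
  assumes g: "g holomorphic_on unit_disk" and q: "0 < q" and u: "norm u = 1"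
  shows "patch_int j (\<lambda>z. norm (g z) powr q) u
    \<le> ennreal (18 * (1 / K ^ j)\<^sup>2) * cmean (\<lambda>z. norm (g z) powr q * pk (of_real (radius K j) * u) z) (outer_radius K j)"
proof -
  define b where "b = of_real (radius K j) * u"
  define k where "k = 1 / K ^ j"
  have k: "0 < k" "k \<le> 1" "radius K j = 1 - k" using Kp[of j] by (auto simp: k_def radius_def)
  have "norm b = \<bar>1 - k\<bar>"
    unfolding b_def norm_mult k(3) norm_of_real using u by simp
  then have nb: "norm b = 1 - k" "norm b < 1" using k by auto
  let ?G = "\<lambda>z. norm (g z) powr q * pk b z" and ?P = "\<lambda>z. norm (g z) powr q"
  have P: "continuous_on unit_disk ?P" by (rule continuous_on_norm_powr[OF g q])
  have G: "continuous_on unit_disk ?G"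
    using nb by (intro continuous_intros P continuous_on_pk)
  note [measurable] = on_disk_measurable[OF G] on_disk_measurable[OF P]
  let ?M = "cmean ?G (outer_radius K j)"
  have lower: "1 / (9 * k) \<le> pk b (v * u)" if v: "v \<in> patch j" for v
  proof -
    have nv: "norm (v * u) < 1" using patch_norm[OF v] u by (simp add: norm_mult)
    have "norm (b - v * u) \<le> k"
      using v u unfolding b_def left_diff_distrib[symmetric] by (simp add: norm_mult patch_def k_def)
    have "1 - cnj b * (v * u) = (1 - cnj b * b) + cnj b * (b - v * u)" by (simp add: algebra_simps)
    also have "norm \<dots> \<le> norm (1 - cnj b * b) + norm (cnj b * (b - v * u))" by (rule norm_triangle_ineq)
    also have "1 - cnj b * b = of_real (1 - (norm b)\<^sup>2)"
      by (simp only: of_real_diff of_real_1 complex_norm_square mult.commute[of b])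
    also have "norm (of_real (1 - (norm b)\<^sup>2) :: complex) \<le> 2 * k"
    proof -
      have "1 - (norm b)\<^sup>2 = k * (2 - k)" by (simp add: nb(1) power2_eq_square algebra_simps)
      moreover have "0 \<le> k * (2 - k)" "k * (2 - k) \<le> k * 2" using k by (auto intro!: mult_nonneg_nonneg mult_left_mono)
      ultimately show ?thesis by (simp only: norm_of_real)
    qed
    also have "norm (cnj b * (b - v * u)) \<le> k"
    proof -
      have "norm b * norm (b - v * u) \<le> 1 * norm (b - v * u)"
        using nb(2) by (intro mult_right_mono) auto
      then show ?thesis using \<open>norm (b - v * u) \<le> k\<close> unfolding norm_mult complex_mod_cnj by linarith
    qed
    finally have "norm (1 - cnj b * (v * u)) \<le> 3 * k" by simp
    then have "(norm (1 - cnj b * (v * u)))\<^sup>2 \<le> (3 * k)\<^sup>2" by (rule power_mono) simp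
    moreover have "norm (1 - cnj b * (v * u)) > 0" using kernel_nonzero[OF nb(2) nv] by simp
    ultimately have "k / (3 * k)\<^sup>2 \<le> k / (norm (1 - cnj b * (v * u)))\<^sup>2"
      using k by (intro divide_left_mono) auto
    then show ?thesis using k by (simp add: pk_def nb(1) power2_eq_square)
  qed
  have "patch_int j ?P u \<le> (\<integral>\<^sup>+v. ennreal (9 * k) * (on_disk ?G (v * u) * indicator (patch j) v) \<partial>lborel)"
    unfolding patch_int_def
  proof (rule nn_integral_mono)
    fix v
    show "on_disk ?P (v * u) * indicator (patch j) v \<le> ennreal (9 * k) * (on_disk ?G (v * u) * indicator (patch j) v)"
    proof (cases "v \<in> patch j")
      case True
      have nv: "norm (v * u) < 1" using patch_norm[OF True] u by (simp add: norm_mult)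
      have "9 * k * (1 / (9 * k)) \<le> 9 * k * pk b (v * u)"
        using lower[OF True] k by (intro mult_left_mono) auto
      then have "1 \<le> 9 * k * pk b (v * u)" using k by simp
      then have "1 * ?P (v * u) \<le> (9 * k * pk b (v * u)) * ?P (v * u)" by (rule mult_right_mono) simp
      then have "ennreal (?P (v * u)) \<le> ennreal (9 * k * ?G (v * u))"
        by (intro ennreal_leI) (simp add: mult_ac)
      then show ?thesis using True nv k pk_nonneg[OF nb(2)] by (simp add: on_disk_def ennreal_mult)
    qed simp
  qed
  also have "\<dots> = ennreal (9 * k) * (\<integral>\<^sup>+v. on_disk ?G (v * u) * indicator (patch j) v \<partial>lborel)"
    by (rule nn_integral_cmult) measurable
  also have "(\<integral>\<^sup>+v. on_disk ?G (v * u) * indicator (patch j) v \<partial>lborel)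
     = (\<integral>\<^sup>+r\<in>{0..}. ennreal r * circ (\<lambda>x. on_disk ?G (of_real r * x * u) * indicator (patch j) (of_real r * x)) \<partial>lborel)"
    by (rule nn_integral_polar) measurable
  also have "\<dots> \<le> (\<integral>\<^sup>+r. ?M * indicator {1 - 2 * k..1} r \<partial>lborel)"
  proof (rule nn_integral_mono)
    fix r :: real
    show "ennreal r * circ (\<lambda>x. on_disk ?G (of_real r * x * u) * indicator (patch j) (of_real r * x)) * indicator {0..} r
      \<le> ?M * indicator {1 - 2 * k..1} r"
    proof (cases "0 \<le> r \<and> r \<le> outer_radius K j \<and> 1 - 2 * k \<le> r")
      case True
      have "circ (\<lambda>x. on_disk ?G (of_real r * x * u) * indicator (patch j) (of_real r * x))
         \<le> circ (\<lambda>x. on_disk ?G ((of_real r * u) * x))"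
        by (intro circ_mono) (auto simp: indicator_def mult_ac)
      also have "\<dots> \<le> ?M"
        using True u outer_radius_bounds[of j] by (intro circ_pk_mono g q nb) (auto simp: norm_mult)
      finally have "ennreal r * circ (\<lambda>x. on_disk ?G (of_real r * x * u) * indicator (patch j) (of_real r * x)) \<le> 1 * ?M"
        using True outer_radius_bounds[of j] by (intro mult_mono) auto
      then show ?thesis using True outer_radius_bounds[of j] by simp
    next
      case False
      have "of_real r * x \<notin> patch j" if "0 \<le> r" "norm x = 1" for x :: complex
      proof
        assume "of_real r * x \<in> patch j"
        then have p: "norm (of_real r * x) \<le> outer_radius K j" "norm (of_real (radius K j) - of_real r * x) \<le> k"
          by (auto simp: patch_def k_def)
        have nrx: "norm (of_real r * x) = r" using that by (simp add: norm_mult)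
        have "norm (of_real (radius K j) :: complex) - norm (of_real r * x) \<le> k"
          using norm_triangle_ineq2 p(2) by (rule order_trans)
        then have "radius K j - r \<le> k" unfolding nrx using radius_nonneg[of j] by simp
        then show False using False p(1) k that nrx by auto
      qed
      then have "circ (\<lambda>x. on_disk ?G (of_real r * x * u) * indicator (patch j) (of_real r * x)) = circ (\<lambda>x. 0)" if "0 \<le> r"
        using that by (intro circ_cong) simp
      then show ?thesis by (cases "0 \<le> r") auto
    qed
  qed
  also have "\<dots> = ?M * ennreal (2 * k)"
    using k by (simp add: nn_integral_cmult)
  finally have "patch_int j ?P u \<le> ennreal (9 * k) * (?M * ennreal (2 * k))" by (simp add: mult_left_mono)
  also have "\<dots> = ennreal (18 * k\<^sup>2) * ?M"
  proof -
    have "ennreal (9 * k) * ennreal (2 * k) = ennreal (9 * k * (2 * k))"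
      using k by (intro ennreal_mult[symmetric]) auto
    moreover have "9 * k * (2 * k) = 18 * k\<^sup>2" by (simp add: power2_eq_square)
    moreover have "A * (M * B) = (A * B) * M" for A B M :: ennreal by (simp add: mult_ac)
    ultimately show ?thesis by (simp only:)
  qed
  finally show ?thesis unfolding k_def b_def .
qed

text \<open>Comes from 1 / (pi d^2) for balls of radius d = 1 / (2 K^(j+1)), apart from the factor
  K^(2 j).\<close>

definition "diff_const = 4 * K\<^sup>2 / pi"

lemma diff_const_pos: "diff_const > 0"
  by (simp add: diff_const_def)

text \<open>Within layer j, f changes along a ray by at most the length of the segment times the
  supremum of |f'| on it, which the sub-mean value property bounds through small balls inside the
  rotated patch.\<close>

lemma radial_increment:
  assumes f: "f holomorphic_on unit_disk" and q: "0 < q" and u: "norm u = 1"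
    and r: "radius K j \<le> r" "r \<le> radius K (Suc j)"
  shows "ennreal (norm (f (of_real r * u) - f (of_real (radius K j) * u)) powr q)
    \<le> ennreal (diff_const * (K ^ j)\<^sup>2 * (1 / K ^ j) powr q) * patch_int j (\<lambda>z. norm (deriv f z) powr q) u"
proof -
  let ?C = "diff_const * (K ^ j)\<^sup>2 * (1 / K ^ j) powr q"
  let ?P = "\<lambda>z. norm (deriv f z) powr q"
  have C: "?C > 0" using diff_const_pos Kp[of j] by simp
  have f': "deriv f holomorphic_on unit_disk" by (intro holomorphic_deriv f open_ball)
  have P: "continuous_on unit_disk ?P" by (rule continuous_on_norm_powr[OF f' q])
  note [measurable] = on_disk_measurable[OF P]
  define I where "I = patch_int j ?P u"
  define \<delta> where "\<delta> = 1 / (2 * K ^ Suc j)"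
  have d: "0 < \<delta>" using Kp[of "Suc j"] by (simp add: \<delta>_def)
  have rd: "radius K (Suc j) + \<delta> = outer_radius K j" "radius K (Suc j) - radius K j + \<delta> \<le> 1 / K ^ j"
    using Kp[of j] K by (auto simp: radius_def outer_radius_def \<delta>_def field_simps)
  have deriv_le: "ennreal (pi * \<delta>\<^sup>2) * ennreal (?P (of_real s * u)) \<le> I"
    if s: "radius K j \<le> s" "s \<le> radius K (Suc j)" for s
  proof -
    have s0: "0 \<le> s" using s radius_nonneg[of j] by linarith
    have sub: "ball (of_real s * u) \<delta> \<subseteq> unit_disk"
    proof
      fix x assume "x \<in> ball (of_real s * u) \<delta>"
      then have "norm x < norm (of_real s * u) + \<delta>"
        using norm_triangle_sub[of x "of_real s * u"] by (simp add: dist_norm norm_minus_commute)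
      then show "x \<in> unit_disk" using s s0 u rd outer_radius_bounds[of j] by (simp add: norm_mult)
    qed
    have "ennreal (pi * \<delta>\<^sup>2) * ennreal (?P (of_real s * u)) \<le> (\<integral>\<^sup>+x\<in>ball (of_real s * u) \<delta>. ennreal (?P x) \<partial>lborel)"
      by (intro submean_area holomorphic_on_subset[OF f' sub] q d)
    also have "\<dots> = (\<integral>\<^sup>+x\<in>ball (of_real s * u) \<delta>. on_disk ?P x \<partial>lborel)"
      using sub by (intro nn_integral_cong) (auto simp: indicator_def on_disk_def)
    also have "\<dots> = (\<integral>\<^sup>+v\<in>ball (of_real s) \<delta>. on_disk ?P (v * u) \<partial>lborel)"
      by (rule nn_integral_ball_rotate[OF _ u]) measurable
    also have "\<dots> \<le> I" unfolding I_def patch_int_def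
    proof (intro nn_integral_mono mult_left_mono)
      fix v :: complex
      have "v \<in> patch j" if v: "v \<in> ball (of_real s) \<delta>"
      proof -
        have nv: "norm (of_real s - v) < \<delta>" using v by (simp add: dist_norm)
        have "norm v \<le> norm (of_real s :: complex) + norm (of_real s - v)"
          by (metis norm_minus_commute norm_triangle_sub)
        then have 1: "norm v \<le> outer_radius K j" using nv s s0 rd by simp
        have "norm (of_real (radius K j) - v) \<le> norm (of_real (radius K j) - of_real s :: complex) + norm (of_real s - v)"
          using norm_triangle_ineq[of "of_real (radius K j) - of_real s :: complex" "of_real s - v"] by simp
        also have "norm (of_real (radius K j) - of_real s :: complex) = s - radius K j"
          using s by (subst of_real_diff[symmetric], subst norm_of_real) simp
        finally have "norm (of_real (radius K j) - v) \<le> 1 / K ^ j" using nv s rd by linarith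
        with 1 show ?thesis by (simp add: patch_def)
      qed
      then show "indicator (ball (of_real s) \<delta>) v \<le> (indicator (patch j) v :: ennreal)"
        by (auto simp: indicator_def simp del: mem_ball)
    qed simp
    finally show ?thesis .
  qed
  show ?thesis
  proof (cases "I = \<infinity>")
    case True
    moreover have "ennreal ?C \<noteq> 0" using C ennreal_eq_0_iff[of ?C] by linarith
    ultimately have "ennreal ?C * I = \<infinity>"
      by (simp only: ennreal_mult_eq_top_iff infinity_ennreal_def) blast
    then show ?thesis unfolding I_def by simp
  next
    case False
    then obtain J where J: "I = ennreal J" "J \<ge> 0" by (cases I) auto
    define B where "B = (J / (pi * \<delta>\<^sup>2)) powr (1/q)"
    have Bs: "norm (deriv f (of_real s * u)) \<le> B" if "radius K j \<le> s" "s \<le> radius K (Suc j)" for s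
    proof -
      have "ennreal (pi * \<delta>\<^sup>2 * ?P (of_real s * u)) \<le> ennreal J"
        using deriv_le[OF that] unfolding J by (subst ennreal_mult'') auto
      then have "?P (of_real s * u) \<le> J / (pi * \<delta>\<^sup>2)"
        using J d by (simp add: field_simps)
      then have "(?P (of_real s * u)) powr (1/q) \<le> B"
        unfolding B_def using q by (intro powr_mono2) auto
      then show ?thesis using q by (simp add: powr_powr)
    qed
    have "norm (f (of_real r * u) - f (of_real (radius K j) * u)) \<le> B * norm (of_real r * u - of_real (radius K j) * u)"
    proof (rule field_differentiable_bound[of "(\<lambda>s. of_real s * u) ` {radius K j..radius K (Suc j)}" f "deriv f" B])
      have "linear (\<lambda>s::real. of_real s * u)"
        by (auto intro!: linearI simp: algebra_simps scaleR_conv_of_real)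
      then show "convex ((\<lambda>s. of_real s * u) ` {radius K j..radius K (Suc j)})"
        by (intro convex_linear_image convex_real_interval)
      fix z assume "z \<in> (\<lambda>s. of_real s * u) ` {radius K j..radius K (Suc j)}"
      then obtain s where s': "z = of_real s * u" "s \<in> {radius K j..radius K (Suc j)}" by (rule imageE)
      then have s: "z = of_real s * u" "radius K j \<le> s" "s \<le> radius K (Suc j)"
        by (simp_all only: atLeastAtMost_iff)
      have "z \<in> unit_disk"
        using s u radius_nonneg[of j] radius_less_1[of "Suc j"] by (simp add: norm_mult)
      then show "(f has_field_derivative deriv f z) (at z within (\<lambda>s. of_real s * u) ` {radius K j..radius K (Suc j)})"
        by (rule holomorphic_derivI[OF f open_ball])
      show "norm (deriv f z) \<le> B" using Bs s by simp
    qed (use r in auto)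
    also have "norm (of_real r * u - of_real (radius K j) * u) = r - radius K j"
    proof -
      have "of_real r * u - of_real (radius K j) * u = of_real (r - radius K j) * u"
        by (simp add: left_diff_distrib)
      then show ?thesis using u r by (simp only: norm_mult norm_of_real) simp
    qed
    also have "B * (r - radius K j) \<le> B * (1 / K ^ j)"
    proof -
      have "0 \<le> B" by (simp add: B_def)
      moreover have "r - radius K j \<le> 1 / K ^ j" using r rd d by linarith
      ultimately show ?thesis by (rule mult_left_mono[rotated])
    qed
    finally have "norm (f (of_real r * u) - f (of_real (radius K j) * u)) powr q \<le> (B * (1 / K ^ j)) powr q"
      using q by (intro powr_mono2) auto
    also have "\<dots> = B powr q * (1 / K ^ j) powr q"
      by (rule powr_mult)
    also have "B powr q = J / (pi * \<delta>\<^sup>2)"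
      unfolding B_def using q J by (simp add: powr_powr)
    also have "J / (pi * \<delta>\<^sup>2) * (1 / K ^ j) powr q = ?C * J"
      using Kp[of j] by (simp add: \<delta>_def diff_const_def power2_eq_square field_simps)
    finally have "ennreal (norm (f (of_real r * u) - f (of_real (radius K j) * u)) powr q) \<le> ennreal (?C * J)"
      by (rule ennreal_leI)
    also have "\<dots> = ennreal ?C * I" using J by (simp only: ennreal_mult'')
    finally show ?thesis unfolding I_def .
  qed
qed

end

lemma ennreal_mult_assoc: "0 \<le> x \<Longrightarrow> ennreal x * (ennreal y * Z) = ennreal (x * y) * Z"
  by (simp add: ennreal_mult' mult.assoc)

lemma ennreal_distrib: "0 \<le> x \<Longrightarrow> 0 \<le> y \<Longrightarrow> ennreal x * Z + ennreal y * Z = ennreal (x + y) * Z"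
  by (simp add: distrib_right)

lemma sum_shift: "(\<Sum>j<N + n. h j) = (\<Sum>j<N. h j) + (\<Sum>i<n. h (N + i))" for h :: "nat \<Rightarrow> ennreal"
  by (induction n) (simp_all add: add.assoc)

context regular_weight
begin

text \<open>One layer further out |f|^q grows at most by the factor g, up to a patch integral of f',
  while the mass shrinks by lam; with kap = lam g < 1 the layers from |a| outwards sum like a
  geometric series. Its starting value, on the circle at the inner end of the layer of |a|, cannot
  be obtained by summing from 0, since the kernel of a is not comparable to a frozen one on the
  inner layers. It comes from the pointwise bound \<open>growth\<close>.\<close>

proposition carl_le_deriv:
  assumes q: "0 < q"
  shows "\<exists>C>0. \<forall>f. f holomorphic_on unit_disk \<longrightarrow>
    carl w (\<lambda>z. norm (f z) powr q)
      \<le> ennreal C * (ennreal (norm (f 0) powr q) + carl (\<lambda>r. w r * (1 - r) powr q) (\<lambda>z. norm (deriv f z) powr q))"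
proof -
  interpret V: regular_weight K lam "c * K powr (-q)" "\<lambda>r. w r * (1 - r) powr q" "\<lambda>j. W j * (1 / K ^ j) powr q"
    by (rule power_weight) (use q in simp)
  define L where "L = V.level_const"
  have L: "L > 0" unfolding L_def by (rule V.level_const_pos)
  \<comment> \<open>Halfway between 1 and \<open>1 / lam\<close>, which makes \<open>kap\<close>
    equal to (1 + lam) / 2.\<close>
  define g where "g = (1 + 1/lam)/2"
  define kap where "kap = lam * g"
  have g: "1 < g" using lam by (simp add: g_def)
  have kap: "0 < kap" "kap < 1" using lam by (simp_all add: kap_def g_def distrib_left)
  obtain Cg where Cg: "Cg > 0" "\<And>x y. 0 \<le> x \<Longrightarrow> 0 \<le> y \<Longrightarrow> (x + y) powr q \<le> g * x powr q + Cg * y powr q"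
    using powr_add_le[OF q g] by blast
  define e where "e j = Cg * (diff_const * (K ^ j)\<^sup>2 * (1 / K ^ j) powr q)" for j
  have e: "0 \<le> e j" for j using Cg diff_const_pos Kp[of j] by (simp add: e_def)
  have ek: "e j * (1 / K ^ j)\<^sup>2 = Cg * diff_const * (1 / K ^ j) powr q" for j
    using Kp[of j] by (simp add: e_def power_divide)
  define C4 where "C4 = 18 * Cg * diff_const * (L * 400)"
  \<comment> \<open>Large enough to cover the start \<open>W 0\<close> of \<open>growth\<close> and
    to be preserved by its step, which leads from b to kap b + lam C4.\<close>
  define b where "b = W 0 + lam * C4 / (1 - kap)"
  have C4: "C4 \<ge> 0" using Cg diff_const_pos L by (simp add: C4_def)
  have b: "W 0 \<le> b" "kap * b + lam * C4 \<le> b" "0 \<le> b"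
  proof -
    show "W 0 \<le> b" using C4 lam kap by (simp add: b_def)
    then show "0 \<le> b" using W_pos[of 0] by linarith
    have "(1 - kap) * b = (1 - kap) * W 0 + lam * C4" using kap by (simp add: b_def distrib_left)
    moreover have "(1 - kap) * W 0 \<ge> 0" using kap W_pos[of 0] by simp
    ultimately show "kap * b + lam * C4 \<le> b" by (simp add: left_diff_distrib)
  qed
  define C5 where "C5 = 16 * pi * (1 + K)\<^sup>2 * Cg * diff_const"
  have C5: "C5 \<ge> 0" using Cg diff_const_pos by (simp add: C5_def)
  define D where "D = (1 + K)\<^sup>2 * (g * ((2 * pi * b + C5 * (L * 400)) / (1 - kap)) + C5 * (L * 400))"
  have D: "D \<ge> 0" using b g kap C5 L unfolding D_def
    by (intro mult_nonneg_nonneg add_nonneg_nonneg divide_nonneg_nonneg) auto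
  show ?thesis
  proof (intro exI[of _ "7 * D + 1"] conjI allI impI)
    show "0 < 7 * D + 1" using D by simp
    fix f assume f: "f holomorphic_on unit_disk"
    let ?F = "\<lambda>z. norm (f z) powr q" and ?F' = "\<lambda>z. norm (deriv f z) powr q"
    have f': "deriv f holomorphic_on unit_disk" by (intro holomorphic_deriv f open_ball)
    have Fc: "continuous_on unit_disk ?F" by (rule continuous_on_norm_powr[OF f q])
    have F'c: "continuous_on unit_disk ?F'" by (rule continuous_on_norm_powr[OF f' q])
    note [measurable] = on_disk_measurable[OF Fc] patch_int_measurable[OF F'c]
    define X where "X = carl (\<lambda>r. w r * (1 - r) powr q) ?F'"
    define Z where "Z = ennreal (?F 0) + X"
    have disk_le: "disk_int (\<lambda>r. w r * (1 - r) powr q) (\<lambda>z. ?F' z * pk a z) \<le> 400 * Z" if "norm a < 1" for a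
    proof -
      have "disk_int (\<lambda>r. w r * (1 - r) powr q) (\<lambda>z. ?F' z * pk a z) \<le> 400 * X"
        unfolding X_def using that w_nonneg by (intro disk_int_pk_le_carl F'c) auto
      also have "\<dots> \<le> 400 * Z" by (intro mult_left_mono) (auto simp: Z_def)
      finally show ?thesis .
    qed
    \<comment> \<open>The share of layer j in the kernel integral of the derivative. Its sum over j
      is bounded by a multiple of Z, uniformly in the centre a.\<close>
    define m where "m a j = ennreal (W j * (1 / K ^ j) powr q) * cmean (\<lambda>z. ?F' z * pk a z) (outer_radius K j)" for a j
    have m_sum: "(\<Sum>j. m a j) \<le> ennreal (L * 400) * Z" if a: "norm a < 1" for a
    proof -
      have "(\<Sum>j. m a j) \<le> ennreal L * disk_int (\<lambda>r. w r * (1 - r) powr q) (\<lambda>z. ?F' z * pk a z)"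
        unfolding m_def L_def by (rule V.mean_sum[OF f' q a])
      also have "\<dots> \<le> ennreal L * (ennreal 400 * Z)" using disk_le[OF a] by (intro mult_left_mono) auto
      finally show ?thesis using L by (subst (asm) ennreal_mult_assoc) auto
    qed
    have m_le: "m a j \<le> ennreal (L * 400) * Z" if a: "norm a < 1" for a j
      using sum_le_suminf[of "m a" "{j}"] m_sum[OF a] by (auto intro: order_trans)
    define E where "E j = patch_int j ?F'" for j
    have [measurable]: "E j \<in> borel_measurable borel" for j unfolding E_def by (rule patch_int_measurable[OF F'c])
    have step: "ennreal (?F (of_real r * u)) \<le> ennreal g * ennreal (?F (of_real (radius K j) * u)) + ennreal (e j) * E j u"
      if r: "radius K j \<le> r" "r \<le> radius K (Suc j)" and u: "norm u = 1" for r u j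
    proof -
      let ?x = "f (of_real (radius K j) * u)" and ?y = "f (of_real r * u) - f (of_real (radius K j) * u)"
      have "norm (f (of_real r * u)) \<le> norm ?x + norm ?y" by (metis norm_triangle_sub)
      then have "?F (of_real r * u) \<le> (norm ?x + norm ?y) powr q" using q by (intro powr_mono2) auto
      also have "\<dots> \<le> g * norm ?x powr q + Cg * norm ?y powr q" by (intro Cg) auto
      finally have "ennreal (?F (of_real r * u)) \<le> ennreal (g * norm ?x powr q + Cg * norm ?y powr q)" by (rule ennreal_leI)
      also have "\<dots> = ennreal g * ennreal (norm ?x powr q) + ennreal Cg * ennreal (norm ?y powr q)"
        using g Cg by (simp add: ennreal_mult)
      also have "\<dots> \<le> ennreal g * ennreal (norm ?x powr q) + ennreal Cg * (ennreal (diff_const * (K ^ j)\<^sup>2 * (1 / K ^ j) powr q) * E j u)"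
        unfolding E_def by (intro add_left_mono mult_left_mono radial_increment f q u r) simp
      also have "ennreal Cg * (ennreal (diff_const * (K ^ j)\<^sup>2 * (1 / K ^ j) powr q) * E j u) = ennreal (e j) * E j u"
        unfolding e_def using Cg by (intro ennreal_mult_assoc) simp
      finally show ?thesis .
    qed
    \<comment> \<open>Here the kernel is centred at the point itself. As the bound by Z is uniform
      in the centre, one term of the layer sum suffices at each point.\<close>
    have WeE: "ennreal (W j) * (ennreal (e j) * E j u) \<le> ennreal C4 * Z" if u: "norm u = 1" for u j
    proof -
      let ?a = "of_real (radius K j) * u"
      have a: "norm ?a < 1" using u radius_nonneg[of j] radius_less_1[of j] by (simp add: norm_mult)
      let ?M = "cmean (\<lambda>z. ?F' z * pk ?a z) (outer_radius K j)"
      have "ennreal (W j) * (ennreal (e j) * E j u) \<le> ennreal (W j) * (ennreal (e j) * (ennreal (18 * (1 / K ^ j)\<^sup>2) * ?M))"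
        unfolding E_def by (intro mult_left_mono patch_int_le_mean f' q u) auto
      also have "\<dots> = ennreal (W j * (e j * (18 * (1 / K ^ j)\<^sup>2))) * ?M"
        using W_pos[of j] e[of j] by (simp only: ennreal_mult_assoc less_imp_le)
      also have "W j * (e j * (18 * (1 / K ^ j)\<^sup>2)) = (18 * Cg * diff_const) * (W j * (1 / K ^ j) powr q)"
        using ek[of j] by (simp add: mult_ac)
      also have "ennreal ((18 * Cg * diff_const) * (W j * (1 / K ^ j) powr q)) * ?M = ennreal (18 * Cg * diff_const) * m ?a j"
        unfolding m_def using Cg diff_const_pos by (intro ennreal_mult_assoc[symmetric]) auto
      also have "\<dots> \<le> ennreal (18 * Cg * diff_const) * (ennreal (L * 400) * Z)"
        by (intro mult_left_mono m_le a) simp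
      also have "\<dots> = ennreal C4 * Z" unfolding C4_def using Cg diff_const_pos by (intro ennreal_mult_assoc) auto
      finally show ?thesis .
    qed
    have growth: "ennreal (W j) * ennreal (?F (of_real (radius K j) * u)) \<le> ennreal b * Z" if u: "norm u = 1" for u j
    proof (induction j)
      case 0
      have "ennreal (W 0) * ennreal (?F 0) \<le> ennreal b * Z"
        using b(1) by (intro mult_mono ennreal_leI) (auto simp: Z_def)
      then show ?case by simp
    next
      case (Suc j)
      let ?x = "ennreal (?F (of_real (radius K j) * u))"
      have "ennreal (W (Suc j)) * ennreal (?F (of_real (radius K (Suc j)) * u))
         \<le> ennreal (lam * W j) * (ennreal g * ?x + ennreal (e j) * E j u)"
        using radius_less_Suc[of j] by (intro mult_mono ennreal_leI W_dec step u) auto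
      also have "\<dots> = ennreal kap * (ennreal (W j) * ?x) + ennreal lam * (ennreal (W j) * (ennreal (e j) * E j u))"
        using lam W_pos[of j] g by (simp add: kap_def ennreal_mult less_imp_le distrib_left mult_ac)
      also have "\<dots> \<le> ennreal kap * (ennreal b * Z) + ennreal lam * (ennreal C4 * Z)"
        by (intro add_mono mult_left_mono Suc.IH WeE u) auto
      also have "\<dots> = ennreal (kap * b + lam * C4) * Z"
        using kap lam b C4 by (simp only: ennreal_mult_assoc less_imp_le ennreal_distrib mult_nonneg_nonneg)
      also have "\<dots> \<le> ennreal b * Z" by (intro mult_right_mono ennreal_leI b) simp
      finally show ?case .
    qed
    have main: "ennreal (1 / (1 - norm a)) * (\<integral>\<^sup>+z\<in>carleson_square a. on_disk ?F z * ennreal (w (norm z)) \<partial>lborel)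
        \<le> ennreal (7 * D + 1) * Z" if a: "norm a < 1" for a
    proof -
      obtain N where N: "norm a \<in> layer K N" using layer_cover[of "norm a"] a by auto
      then have N1: "radius K N \<le> norm a" "norm a < radius K (Suc N)" by (auto simp: layer_def)
      note [measurable] = on_disk_measurable[OF continuous_on_pk[OF a]]
      \<comment> \<open>The kernel frozen at the inner end of the layer of |a|, so that the
        recursion acts on |f|^q alone. By \<open>pkc\<close> it is comparable to the kernel at all
        larger radii, because 1 - radius K N <= K (1 - |a|).\<close>
      define kk where "kk u = on_disk (pk a) (of_real (radius K N) * u)" for u
      have [measurable]: "kk \<in> borel_measurable borel" unfolding kk_def[abs_def] by measurable
      have pkc: "pk a (of_real r * u) \<le> (1 + K)\<^sup>2 * pk a (of_real s * u)"
        if u: "norm u = 1" and rs: "radius K N \<le> r" "r < 1" "radius K N \<le> s" "s < 1" for r s u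
      proof (rule pk_compare[OF a])
        have 0: "0 \<le> r" "0 \<le> s" using rs radius_nonneg[of N] by linarith+
        then show nr: "norm (of_real r * u) < 1" and "norm (of_real s * u) < 1" using u rs by (auto simp: norm_mult)
        have "of_real r * u - of_real s * u = of_real (r - s) * u" by (simp add: left_diff_distrib)
        then have "norm (of_real r * u - of_real s * u) = \<bar>r - s\<bar>"
          using u by (simp only: norm_mult norm_of_real mult_1_right)
        also have "\<dots> \<le> 1 - radius K N" using rs by linarith
        also have "\<dots> = K * (1 - radius K (Suc N))" by (simp add: radius_def)
        also have "\<dots> \<le> K * (1 - norm a)" using N1 by (intro mult_left_mono) auto
        also have "\<dots> \<le> K * norm (1 - cnj a * (of_real r * u))"
          by (intro mult_left_mono norm_kernel_ge(2)[OF a nr]) simp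
        finally show "norm (of_real r * u - of_real s * u) \<le> K * norm (1 - cnj a * (of_real r * u))" .
      qed simp
      have nrr: "norm (of_real (radius K j) * u) < 1" "0 \<le> radius K j" if "norm u = 1" for u :: complex and j
        using that radius_nonneg[of j] radius_less_1[of j] by (simp_all add: norm_mult)
      define J where "J i = circ (\<lambda>u. kk u * on_disk ?F (of_real (radius K (N + i)) * u))" for i
      define H where "H i = circ (\<lambda>u. kk u * E (N + i) u)" for i
      have eH: "ennreal (W (N + i)) * (ennreal (e (N + i)) * H i) \<le> ennreal C5 * m a (N + i)" for i
      proof -
        let ?j = "N + i"
        have "H i \<le> circ (\<lambda>u. ennreal ((1 + K)\<^sup>2) * (on_disk (pk a) (of_real (radius K ?j) * u) * E ?j u))"
          unfolding H_def
        proof (rule circ_mono)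
          fix u :: complex assume u: "norm u = 1"
          have "ennreal (pk a (of_real (radius K N) * u)) \<le> ennreal ((1 + K)\<^sup>2 * pk a (of_real (radius K ?j) * u))"
            using radius_mono[of N ?j] radius_less_1 u by (intro ennreal_leI pkc) auto
          then have "kk u \<le> ennreal ((1 + K)\<^sup>2) * on_disk (pk a) (of_real (radius K ?j) * u)"
            using nrr[OF u] by (simp add: kk_def on_disk_def ennreal_mult')
          then show "kk u * E ?j u \<le> ennreal ((1 + K)\<^sup>2) * (on_disk (pk a) (of_real (radius K ?j) * u) * E ?j u)"
            unfolding mult.assoc[symmetric] by (rule mult_right_mono) simp
        qed
        also have "\<dots> = ennreal ((1 + K)\<^sup>2) * circ (\<lambda>u. on_disk (pk a) (of_real (radius K ?j) * u) * E ?j u)"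
          by (rule circ_cmult) measurable
        also have "\<dots> \<le> ennreal ((1 + K)\<^sup>2) * (ennreal (16 * pi * (1 / K ^ ?j)\<^sup>2) * cmean (\<lambda>z. ?F' z * pk a z) (outer_radius K ?j))"
          unfolding E_def by (intro mult_left_mono circ_patch_int f' q a) simp
        finally have "ennreal (W ?j) * (ennreal (e ?j) * H i) \<le> ennreal (W ?j) * (ennreal (e ?j) * (ennreal ((1 + K)\<^sup>2) * (ennreal (16 * pi * (1 / K ^ ?j)\<^sup>2) * cmean (\<lambda>z. ?F' z * pk a z) (outer_radius K ?j))))"
          by (intro mult_left_mono) auto
        also have "\<dots> = ennreal (W ?j * (e ?j * ((1 + K)\<^sup>2 * (16 * pi * (1 / K ^ ?j)\<^sup>2)))) * cmean (\<lambda>z. ?F' z * pk a z) (outer_radius K ?j)"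
          using W_pos[of ?j] e[of ?j] by (simp only: ennreal_mult_assoc less_imp_le zero_le_power2)
        also have "W ?j * (e ?j * ((1 + K)\<^sup>2 * (16 * pi * (1 / K ^ ?j)\<^sup>2))) = C5 * (W ?j * (1 / K ^ ?j) powr q)"
        proof -
          have "W ?j * (e ?j * ((1 + K)\<^sup>2 * (16 * pi * (1 / K ^ ?j)\<^sup>2))) = W ?j * ((e ?j * (1 / K ^ ?j)\<^sup>2) * ((1 + K)\<^sup>2 * (16 * pi)))"
            by (simp only: mult_ac)
          then show ?thesis unfolding ek C5_def by (simp only: mult_ac)
        qed
        also have "ennreal (C5 * (W ?j * (1 / K ^ ?j) powr q)) * cmean (\<lambda>z. ?F' z * pk a z) (outer_radius K ?j) = ennreal C5 * m a ?j"
          unfolding m_def using C5 by (intro ennreal_mult_assoc[symmetric])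
        finally show ?thesis .
      qed
      have layer_mean: "circ (\<lambda>u. kk u * ennreal (?F (of_real r * u))) \<le> ennreal g * J i + ennreal (e (N + i)) * H i"
        if r: "radius K (N + i) \<le> r" "r \<le> radius K (Suc (N + i))" for r i
      proof -
        have "circ (\<lambda>u. kk u * ennreal (?F (of_real r * u))) \<le>
          circ (\<lambda>u. ennreal g * (kk u * on_disk ?F (of_real (radius K (N + i)) * u)) + ennreal (e (N + i)) * (kk u * E (N + i) u))"
        proof (rule circ_mono)
          fix u :: complex assume u: "norm u = 1"
          have "kk u * ennreal (?F (of_real r * u)) \<le> kk u * (ennreal g * ennreal (?F (of_real (radius K (N + i)) * u)) + ennreal (e (N + i)) * E (N + i) u)"
            by (intro mult_left_mono step r u) simp
          then show "kk u * ennreal (?F (of_real r * u)) \<le> ennreal g * (kk u * on_disk ?F (of_real (radius K (N + i)) * u)) + ennreal (e (N + i)) * (kk u * E (N + i) u)"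
            using nrr(1)[OF u, of "N + i"] by (simp add: on_disk_def distrib_left mult_ac)
        qed
        also have "\<dots> = ennreal g * J i + ennreal (e (N + i)) * H i"
          unfolding J_def H_def by (simp add: circ_add circ_cmult)
        finally show ?thesis .
      qed
      define Y where "Y i = ennreal (W (N + i)) * J i" for i
      have Yrec: "Y (Suc i) \<le> ennreal kap * Y i + ennreal C5 * m a (N + i)" for i
      proof -
        have "J (Suc i) = circ (\<lambda>u. kk u * ennreal (?F (of_real (radius K (Suc (N + i))) * u)))"
          unfolding J_def using nrr(1)[of _ "Suc (N + i)"] by (intro circ_cong) (simp add: on_disk_def)
        also have "\<dots> \<le> ennreal g * J i + ennreal (e (N + i)) * H i"
          using radius_less_Suc[of "N + i"] by (intro layer_mean) auto
        finally have "Y (Suc i) \<le> ennreal (lam * W (N + i)) * (ennreal g * J i + ennreal (e (N + i)) * H i)"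
          unfolding Y_def using W_dec[of "N + i"] by (intro mult_mono ennreal_leI) auto
        also have "\<dots> = ennreal kap * Y i + ennreal lam * (ennreal (W (N + i)) * (ennreal (e (N + i)) * H i))"
          using lam W_pos[of "N + i"] g by (simp add: Y_def kap_def ennreal_mult less_imp_le distrib_left mult_ac)
        also have "\<dots> \<le> ennreal kap * Y i + ennreal 1 * (ennreal C5 * m a (N + i))"
          using lam by (intro add_left_mono mult_mono ennreal_leI eH) auto
        finally show ?thesis by simp
      qed
      have Y0: "Y 0 \<le> ennreal (2 * pi * b) * Z"
      proof -
        have "Y 0 = circ (\<lambda>u. ennreal (W N) * (kk u * on_disk ?F (of_real (radius K N) * u)))"
          unfolding Y_def J_def add_0_right by (rule circ_cmult[symmetric]) measurable
        also have "\<dots> \<le> circ (\<lambda>u. (ennreal b * Z) * kk u)"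
        proof (rule circ_mono)
          fix u :: complex assume u: "norm u = 1"
          have "kk u * (ennreal (W N) * ennreal (?F (of_real (radius K N) * u))) \<le> kk u * (ennreal b * Z)"
            by (intro mult_left_mono growth u) simp
          then show "ennreal (W N) * (kk u * on_disk ?F (of_real (radius K N) * u)) \<le> (ennreal b * Z) * kk u"
            using nrr(1)[OF u, of N] by (simp add: on_disk_def mult_ac)
        qed
        also have "\<dots> = (ennreal b * Z) * circ kk" by (rule circ_cmult) measurable
        also have "circ kk \<le> ennreal (2 * pi)"
        proof -
          have "circ kk = circ (\<lambda>u. ennreal (pk a (of_real (radius K N) * u)))"
            using nrr(1)[of _ N] by (intro circ_cong) (simp add: kk_def on_disk_def)
          also have "\<dots> \<le> ennreal (2 * pi)"
            by (rule circ_pk_le[OF a radius_nonneg radius_less_1])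
          finally show ?thesis .
        qed
        also have "(ennreal b * Z) * ennreal (2 * pi) = ennreal (2 * pi * b) * Z"
          using ennreal_mult_assoc[of "2 * pi" b Z] by (simp only: mult.commute[of "ennreal b * Z"]) simp
        finally show ?thesis by (simp add: mult_left_mono)
      qed
      have msum: "(\<Sum>i<n. m a (N + i)) \<le> ennreal (L * 400) * Z" for n
      proof -
        have "(\<Sum>i<n. m a (N + i)) = sum (m a) ((+) N ` {..<n})" by (subst sum.reindex) (auto simp: o_def)
        also have "\<dots> \<le> suminf (m a)" by (intro sum_le_suminf) auto
        finally show ?thesis using m_sum[OF a] by (rule order_trans)
      qed
      define B where "B = (2 * pi * b + C5 * (L * 400)) / (1 - kap)"
      have Ysum: "(\<Sum>i<n. Y i) \<le> ennreal B * Z" for n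
      proof -
        have B': "0 \<le> 2 * pi * b" "0 \<le> C5 * (L * 400)" using b C5 L by auto
        have "ennreal (1 - kap) * (\<Sum>i\<le>n. Y i) \<le> ennreal (1 - kap) * (\<Sum>i\<le>n. Y i) + ennreal kap * Y n"
          by (simp add: add_increasing2)
        also have "\<dots> \<le> Y 0 + (\<Sum>i<n. ennreal C5 * m a (N + i))"
          using kap by (intro geometric_recursion Yrec) auto
        also have "\<dots> \<le> ennreal (2 * pi * b) * Z + ennreal C5 * (ennreal (L * 400) * Z)"
          unfolding sum_distrib_left[symmetric] by (intro add_mono Y0 mult_left_mono msum) simp
        also have "\<dots> = ennreal (2 * pi * b + C5 * (L * 400)) * Z"
          using C5 B' by (simp only: ennreal_mult_assoc ennreal_distrib)
        finally have "ennreal (1 / (1 - kap)) * (ennreal (1 - kap) * (\<Sum>i\<le>n. Y i)) \<le> ennreal (1 / (1 - kap)) * (ennreal (2 * pi * b + C5 * (L * 400)) * Z)"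
          by (rule mult_left_mono) simp
        also have "\<dots> = ennreal B * Z" using kap by (subst ennreal_mult_assoc) (auto simp: B_def)
        also have "ennreal (1 / (1 - kap)) * (ennreal (1 - kap) * (\<Sum>i\<le>n. Y i)) = (\<Sum>i\<le>n. Y i)"
          using kap by (subst ennreal_mult_assoc) auto
        finally have "(\<Sum>i\<le>n. Y i) \<le> ennreal B * Z" .
        moreover have "(\<Sum>i<n. Y i) \<le> (\<Sum>i\<le>n. Y i)" by (intro sum_mono2) auto
        ultimately show ?thesis by (rule order_trans[rotated])
      qed
      let ?w = "\<lambda>r. w r * indicator {norm a..} r" and ?G = "\<lambda>z. ?F z * pk a z"
      have Gc: "continuous_on unit_disk ?G" using a by (intro continuous_intros Fc continuous_on_pk)
      define h where "h j = (\<integral>\<^sup>+r\<in>layer K j. ennreal (?w r * r) * cmean ?G r \<partial>lborel)" for j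
      \<comment> \<open>The cut-off weight vanishes on the layers inside |a|, so the sum starts at
        N.\<close>
      have h0: "h j = 0" if "j < N" for j
      proof -
        have "h j = (\<integral>\<^sup>+r. 0 \<partial>(lborel :: real measure))"
          unfolding h_def
        proof (rule nn_integral_cong)
          fix r
          have "r < norm a" if "r \<in> layer K j"
            using that radius_mono[of "Suc j" N] \<open>j < N\<close> N1 by (auto simp: layer_def)
          then show "ennreal (?w r * r) * cmean ?G r * indicator (layer K j) r = 0"
            by (auto simp: indicator_def)
        qed
        then show ?thesis by simp
      qed
      have hN: "h (N + i) \<le> ennreal ((1 + K)\<^sup>2) * (ennreal g * Y i + ennreal C5 * m a (N + i))" for i
      proof -
        let ?j = "N + i"
        have mean: "cmean ?G r \<le> ennreal ((1 + K)\<^sup>2) * (ennreal g * J i + ennreal (e ?j) * H i)" if r: "r \<in> layer K ?j" for r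
        proof -
          have r': "radius K ?j \<le> r" "r \<le> radius K (Suc ?j)" "r < 1" "0 \<le> r" "radius K N \<le> r"
            using r radius_mono[of N ?j] layer_subset[of ?j] by (auto simp: layer_def)
          have "cmean ?G r \<le> circ (\<lambda>u. ennreal ((1 + K)\<^sup>2) * (kk u * on_disk ?F (of_real r * u)))"
            unfolding cmean_def
          proof (rule circ_mono)
            fix u :: complex assume u: "norm u = 1"
            have nr: "norm (of_real r * u) < 1" using u r' by (simp add: norm_mult)
            have "?F (of_real r * u) * pk a (of_real r * u) \<le> ?F (of_real r * u) * ((1 + K)\<^sup>2 * pk a (of_real (radius K N) * u))"
              using r' radius_less_1[of N] by (intro mult_left_mono pkc u) auto
            then have "ennreal (?F (of_real r * u) * pk a (of_real r * u)) \<le> ennreal (?F (of_real r * u) * ((1 + K)\<^sup>2 * pk a (of_real (radius K N) * u)))"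
              by (rule ennreal_leI)
            then show "on_disk ?G (of_real r * u) \<le> ennreal ((1 + K)\<^sup>2) * (kk u * on_disk ?F (of_real r * u))"
              using nr nrr(1)[OF u, of N] pk_nonneg[OF a] by (simp add: on_disk_def kk_def ennreal_mult mult_ac)
          qed
          also have "\<dots> = ennreal ((1 + K)\<^sup>2) * circ (\<lambda>u. kk u * on_disk ?F (of_real r * u))"
            by (rule circ_cmult) measurable
          also have "circ (\<lambda>u. kk u * on_disk ?F (of_real r * u)) = circ (\<lambda>u. kk u * ennreal (?F (of_real r * u)))"
            using r' by (intro circ_cong) (simp add: on_disk_def norm_mult)
          also have "\<dots> \<le> ennreal g * J i + ennreal (e ?j) * H i" by (rule layer_mean[OF r'(1,2)])
          finally show ?thesis by (simp add: mult_left_mono)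
        qed
        have "h ?j \<le> (\<integral>\<^sup>+r\<in>layer K ?j. ennreal (w r * r) * cmean ?G r \<partial>lborel)"
          unfolding h_def
        proof (intro nn_integral_mono)
          fix r
          show "ennreal (?w r * r) * cmean ?G r * indicator (layer K ?j) r \<le> ennreal (w r * r) * cmean ?G r * indicator (layer K ?j) r"
            by (cases "norm a \<le> r") auto
        qed
        also have "\<dots> \<le> ennreal (W ?j) * (ennreal ((1 + K)\<^sup>2) * (ennreal g * J i + ennreal (e ?j) * H i))"
          by (rule nn_integral_layer_le) (rule mean)
        also have "\<dots> = ennreal ((1 + K)\<^sup>2) * (ennreal g * Y i + ennreal (W ?j) * (ennreal (e ?j) * H i))"
          unfolding Y_def by (simp only: distrib_left mult_ac)
        also have "\<dots> \<le> ennreal ((1 + K)\<^sup>2) * (ennreal g * Y i + ennreal C5 * m a ?j)"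
          by (intro mult_left_mono add_left_mono eH) simp
        finally show ?thesis .
      qed
      have "disk_int ?w ?G = (\<Sum>j. h j)"
        unfolding h_def by (rule disk_int_layers[OF Gc]) measurable
      also have "\<dots> \<le> ennreal D * Z"
      proof (rule suminf_le_const)
        fix n
        have "(\<Sum>j<n. h j) \<le> (\<Sum>j<N + n. h j)" by (intro sum_mono2) auto
        also have "\<dots> = (\<Sum>i<n. h (N + i))" using h0 by (simp add: sum_shift)
        also have "\<dots> \<le> (\<Sum>i<n. ennreal ((1 + K)\<^sup>2) * (ennreal g * Y i + ennreal C5 * m a (N + i)))"
          by (intro sum_mono hN)
        also have "\<dots> = ennreal ((1 + K)\<^sup>2) * (ennreal g * (\<Sum>i<n. Y i) + ennreal C5 * (\<Sum>i<n. m a (N + i)))"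
          by (simp add: sum_distrib_left sum.distrib distrib_left)
        also have "\<dots> \<le> ennreal ((1 + K)\<^sup>2) * (ennreal g * (ennreal B * Z) + ennreal C5 * (ennreal (L * 400) * Z))"
          by (intro mult_left_mono add_mono Ysum msum) auto
        also have "\<dots> = ennreal D * Z"
        proof -
          have B: "0 \<le> B" using b C5 L kap unfolding B_def by (intro divide_nonneg_nonneg add_nonneg_nonneg mult_nonneg_nonneg) auto
          have "ennreal g * (ennreal B * Z) + ennreal C5 * (ennreal (L * 400) * Z) = ennreal (g * B + C5 * (L * 400)) * Z"
            using g C5 L B by (subst (1 2) ennreal_mult_assoc) (auto simp: distrib_right)
          then show ?thesis by (simp only: ennreal_mult_assoc zero_le_power2 D_def B_def)
        qed
        finally show "(\<Sum>j<n. h j) \<le> ennreal D * Z" .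
      qed auto
      finally have "disk_int ?w ?G \<le> ennreal D * Z" .
      have "ennreal (1 / (1 - norm a)) * (\<integral>\<^sup>+z\<in>carleson_square a. on_disk ?F z * ennreal (w (norm z)) \<partial>lborel) \<le> 7 * disk_int ?w ?G"
        using w_nonneg by (intro carleson_le_disk_int Fc a) auto
      also have "\<dots> \<le> ennreal 7 * (ennreal D * Z)" using \<open>disk_int ?w ?G \<le> ennreal D * Z\<close> by (simp add: mult_left_mono)
      also have "\<dots> = ennreal (7 * D) * Z" by (rule ennreal_mult_assoc) simp
      also have "\<dots> \<le> ennreal (7 * D + 1) * Z" by (intro mult_right_mono ennreal_leI) auto
      finally show ?thesis .
    qed
    show "carl w ?F \<le> ennreal (7 * D + 1) * (ennreal (?F 0) + carl (\<lambda>r. w r * (1 - r) powr q) ?F')"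
      unfolding X_def[symmetric] Z_def[symmetric] carl_def[of w] using main by (intro SUP_least) simp
  qed
qed

end

section \<open>Radial weights\<close>

text \<open>The weight is only Lebesgue measurable, whereas Tonelli and polar coordinates are
  applied to Borel functions on \<open>lborel\<close>. It is therefore represented on the radius by
  a Borel function that is nonnegative everywhere and correct almost everywhere.\<close>

locale radial_rep =
  fixes \<omega> :: "complex \<Rightarrow> real" and w :: "real \<Rightarrow> real"
  assumes rw: "radial_weight \<omega>"
    and w_meas [measurable]: "w \<in> borel_measurable borel" and w_nonneg: "0 \<le> w r"
    and rep: "AE r in lborel. r \<in> {0..<1} \<longrightarrow> w r = \<omega> (of_real r)"

lemma radial_rep_exists:
  assumes rw: "radial_weight \<omega>"
  shows "\<exists>w. radial_rep \<omega> w"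
proof -
  have "set_integrable lebesgue {norm (0::complex)..<1} (\<lambda>s. \<omega> (of_real s))"
    using rw unfolding radial_weight_def finite_tails_def by (auto dest: bspec[of _ _ "0::complex"])
  then have "(\<lambda>s. indicator {0..<1} s *\<^sub>R \<omega> (of_real s)) \<in> borel_measurable (completion lborel)"
    unfolding set_integrable_def by (simp add: borel_measurable_integrable)
  from completion_ex_borel_measurable_real[OF this]
  obtain g where g: "g \<in> borel_measurable lborel" "AE s in lborel. indicator {0..<1} s *\<^sub>R \<omega> (of_real s) = g s"
    by blast
  have nn: "0 \<le> \<omega> (of_real s)" if "s \<in> {0..<1}" for s
    using rw that by (simp add: radial_weight_def weight_def)
  have [measurable]: "g \<in> borel_measurable borel" using g(1) by simp
  have "radial_rep \<omega> (\<lambda>s. max 0 (g s))"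
  proof
    show "radial_weight \<omega>" by (fact rw)
    show "(\<lambda>s. max 0 (g s)) \<in> borel_measurable borel" by measurable
    show "AE r in lborel. r \<in> {0..<1} \<longrightarrow> max 0 (g r) = \<omega> (of_real r)"
      using g(2)
    proof eventually_elim
      case (elim r)
      show ?case
      proof
        assume r: "r \<in> {0..<1}"
        then have "g r = \<omega> (of_real r)" using elim by simp
        then show "max 0 (g r) = \<omega> (of_real r)" using nn[OF r] by simp
      qed
    qed
  qed simp
  then show ?thesis by blast
qed

section \<open>Powers of extended nonnegative reals\<close>

lemma ennreal_powr_ennreal: "0 \<le> x \<Longrightarrow> ennreal_powr (ennreal x) p = ennreal (x powr p)"
  by (simp add: ennreal_powr_def)

lemma ennreal_powr_top [simp]: "ennreal_powr top p = top"
  by (simp add: ennreal_powr_def)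

lemma ennreal_powr_mono:
  assumes "0 < p" "x \<le> y"
  shows "ennreal_powr x p \<le> ennreal_powr y p"
proof (cases y)
  case (real b)
  then obtain a where "x = ennreal a" "0 \<le> a" "a \<le> b" using assms(2) by (auto simp: le_ennreal_iff)
  then show ?thesis using real assms(1) by (simp add: ennreal_powr_ennreal powr_mono2 ennreal_leI)
qed simp

lemma ennreal_powr_powr: "0 < p \<Longrightarrow> 0 < p' \<Longrightarrow> ennreal_powr (ennreal_powr x p) p' = ennreal_powr x (p * p')"
  by (cases x) (simp_all add: ennreal_powr_ennreal powr_powr)

lemma ennreal_powr_1 [simp]: "ennreal_powr x 1 = x"
  by (cases x) (simp_all add: ennreal_powr_ennreal)

lemma ennreal_powr_inverse:
  "0 < q \<Longrightarrow> ennreal_powr (ennreal_powr x (1/q)) q = x" "0 < q \<Longrightarrow> ennreal_powr (ennreal_powr x q) (1/q) = x"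
  by (simp_all add: ennreal_powr_powr)

lemma ennreal_powr_mult:
  assumes c: "0 < c" and p: "0 < p"
  shows "ennreal_powr (ennreal c * x) p = ennreal (c powr p) * ennreal_powr x p"
proof (cases x)
  case (real a)
  have "ennreal c * x = ennreal (c * a)" unfolding real(2) using c real(1) by (simp add: ennreal_mult)
  then have "ennreal_powr (ennreal c * x) p = ennreal ((c * a) powr p)"
    using c real(1) by (simp only: ennreal_powr_ennreal mult_nonneg_nonneg less_imp_le)
  also have "\<dots> = ennreal (c powr p) * ennreal (a powr p)" by (simp add: powr_mult ennreal_mult)
  finally show ?thesis using real by (simp add: ennreal_powr_ennreal)
next
  case top
  have "ennreal c \<noteq> 0" "ennreal (c powr p) \<noteq> 0" using c by (auto simp: ennreal_eq_0_iff)
  then show ?thesis using top by (simp add: ennreal_mult_top)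
qed

lemma ennreal_powr_finite: "x < top \<Longrightarrow> ennreal_powr x p < top"
  by (cases x) (simp_all add: ennreal_powr_ennreal)

text \<open>The power is an order isomorphism of the extended half-line, inverted by the reciprocal
  exponent.\<close>

lemma ennreal_powr_SUP:
  assumes "0 < q"
  shows "ennreal_powr (SUP a\<in>S. A a) (1/q) = (SUP a\<in>S. ennreal_powr (A a) (1/q))"
proof (rule antisym)
  let ?s = "SUP a\<in>S. ennreal_powr (A a) (1/q)"
  have "(SUP a\<in>S. A a) \<le> ennreal_powr ?s q"
  proof (rule SUP_least)
    fix a assume "a \<in> S"
    then have "ennreal_powr (ennreal_powr (A a) (1/q)) q \<le> ennreal_powr ?s q"
      using assms by (intro ennreal_powr_mono SUP_upper) auto
    then show "A a \<le> ennreal_powr ?s q" using assms by (simp add: ennreal_powr_inverse)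
  qed
  then have "ennreal_powr (SUP a\<in>S. A a) (1/q) \<le> ennreal_powr (ennreal_powr ?s q) (1/q)"
    using assms by (intro ennreal_powr_mono) auto
  then show "ennreal_powr (SUP a\<in>S. A a) (1/q) \<le> ?s" using assms by (simp add: ennreal_powr_inverse)
  show "?s \<le> ennreal_powr (SUP a\<in>S. A a) (1/q)"
    using assms by (intro SUP_least ennreal_powr_mono SUP_upper) auto
qed

section \<open>The tails of a radial weight\<close>

context radial_rep
begin

definition "T r = tail \<omega> (of_real r)"

text \<open>A null set of radii lifts to a planar null set by the formula for functions of the
  norm.\<close>

lemma radial_w: "AE z in lborel. z \<in> unit_disk \<longrightarrow> \<omega> z = w (norm z)"
proof -
  obtain N where N: "N \<in> null_sets lborel" "{r. \<not> (r \<in> {0..<1} \<longrightarrow> w r = \<omega> (of_real r))} \<subseteq> N"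
    using rep unfolding eventually_ae_filter by auto
  have [measurable]: "N \<in> sets borel" using N by (auto simp: null_sets_def)
  have "emeasure lborel {z::complex. norm z \<in> N} = (\<integral>\<^sup>+z. indicator {z. norm z \<in> N} z \<partial>(lborel :: complex measure))"
    by (rule nn_integral_indicator[symmetric]) measurable
  also have "\<dots> = (\<integral>\<^sup>+z. indicator N (norm z) \<partial>(lborel :: complex measure))"
    by (intro nn_integral_cong) (auto simp: indicator_def)
  also have "\<dots> = (\<integral>\<^sup>+r\<in>{0..}. ennreal (2 * pi * r) * indicator N r \<partial>lborel)"
    by (rule nn_integral_lborel_norm) measurable
  also have "\<dots> = (\<integral>\<^sup>+r. 0 \<partial>(lborel :: real measure))"
  proof (rule nn_integral_cong_AE)
    show "AE r in lborel. ennreal (2 * pi * r) * indicator N r * indicator {0..} r = 0"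
      using AE_not_in[OF N(1)] by eventually_elim simp
  qed
  finally have "{z::complex. norm z \<in> N} \<in> null_sets lborel" by (simp add: null_sets_def)
  then show ?thesis
  proof (rule AE_I')
    show "{z \<in> space lborel. \<not> (z \<in> unit_disk \<longrightarrow> \<omega> z = w (norm z))} \<subseteq> {z. norm z \<in> N}"
    proof
      fix z :: complex assume "z \<in> {z \<in> space lborel. \<not> (z \<in> unit_disk \<longrightarrow> \<omega> z = w (norm z))}"
      then have z: "norm z < 1" "\<omega> z \<noteq> w (norm z)" by auto
      have "\<forall>z\<in>unit_disk. \<omega> z = \<omega> (of_real (norm z))" using rw unfolding radial_weight_def radial_def by blast
      then have "\<omega> z = \<omega> (of_real (norm z))" by (rule bspec) (use z(1) in simp)
      then have "norm z \<in> {r. \<not> (r \<in> {0..<1} \<longrightarrow> w r = \<omega> (of_real r))}" using z by simp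
      then show "z \<in> {z. norm z \<in> N}" using N(2) by blast
    qed
  qed
qed

lemma nn_integral_weight:
  assumes G: "continuous_on unit_disk G" and G0: "\<And>z. 0 \<le> G z" and S: "S \<in> sets borel" "S \<subseteq> unit_disk"
  shows "(\<integral>\<^sup>+z\<in>S. ennreal (G z * \<omega> z) \<partial>lebesgue) = (\<integral>\<^sup>+z\<in>S. on_disk G z * ennreal (w (norm z)) \<partial>lborel)"
proof -
  note [measurable] = on_disk_measurable[OF G] S(1)
  have "(\<integral>\<^sup>+z\<in>S. ennreal (G z * \<omega> z) \<partial>lebesgue) = (\<integral>\<^sup>+z\<in>S. on_disk G z * ennreal (w (norm z)) \<partial>lebesgue)"
  proof (rule nn_integral_cong_AE)
    have "AE z in lebesgue. z \<in> unit_disk \<longrightarrow> \<omega> z = w (norm z)"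
      using radial_w by (rule AE_completion)
    then show "AE z in lebesgue. ennreal (G z * \<omega> z) * indicator S z = on_disk G z * ennreal (w (norm z)) * indicator S z"
    proof eventually_elim
      case (elim z)
      then show ?case using S(2) G0[of z] w_nonneg[of "norm z"]
        by (cases "z \<in> S") (auto simp: on_disk_def ennreal_mult)
    qed
  qed
  also have "\<dots> = (\<integral>\<^sup>+z\<in>S. on_disk G z * ennreal (w (norm z)) \<partial>lborel)"
    by (rule nn_integral_completion) measurable
  finally show ?thesis .
qed

lemma tent_norm_eq:
  assumes q: "0 < q" and f: "continuous_on unit_disk f"
  shows "tent_norm q \<omega> f = ennreal_powr (carl w (\<lambda>z. norm (f z) powr q)) (1/q)"
proof -
  have G: "continuous_on unit_disk (\<lambda>z. norm (f z) powr q)"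
    using q f by (intro continuous_on_powr' continuous_on_norm continuous_on_const) auto
  have "(\<integral>\<^sup>+z\<in>carleson_square a. ennreal (norm (f z) powr q * \<omega> z) \<partial>lebesgue)
     = (\<integral>\<^sup>+z\<in>carleson_square a. on_disk (\<lambda>z. norm (f z) powr q) z * ennreal (w (norm z)) \<partial>lborel)"
    if "a \<in> unit_disk" for a
    using that carleson_squareD by (intro nn_integral_weight G carleson_square_measurable) auto
  then show ?thesis
    unfolding tent_norm_def carl_def ennreal_powr_SUP[OF q] by (intro SUP_cong) auto
qed

lemma set_integrable_tail:
  "0 \<le> r \<Longrightarrow> r < 1 \<Longrightarrow> set_integrable lebesgue {r..<1} (\<lambda>s. \<omega> (of_real s))"
  using rw unfolding radial_weight_def finite_tails_def
  by (metis abs_of_nonneg mem_ball_0 norm_of_real)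

lemma nn_integral_tail:
  assumes r: "0 \<le> r" "r < 1"
  shows "(\<integral>\<^sup>+s\<in>{r..<1}. ennreal (w s) \<partial>lborel) = ennreal (T r)"
proof -
  have nn: "0 \<le> \<omega> (of_real s)" if "s \<in> {r..<1}" for s
    using rw that r by (simp add: radial_weight_def weight_def)
  have "ennreal (T r) = (\<integral>\<^sup>+s. ennreal (indicator {r..<1} s *\<^sub>R \<omega> (of_real s)) \<partial>lebesgue)"
    unfolding T_def tail_def set_lebesgue_integral_def
    using set_integrable_tail[OF r] r nn
    by (subst nn_integral_eq_integral) (auto simp: set_integrable_def indicator_def)
  also have "\<dots> = (\<integral>\<^sup>+s\<in>{r..<1}. ennreal (w s) \<partial>lebesgue)"
  proof (rule nn_integral_cong_AE)
    have "AE s in lebesgue. s \<in> {0..<1} \<longrightarrow> w s = \<omega> (of_real s)"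
      using rep by (rule AE_completion)
    then show "AE s in lebesgue. ennreal (indicator {r..<1} s *\<^sub>R \<omega> (of_real s)) = ennreal (w s) * indicator {r..<1} s"
      by eventually_elim (use r in \<open>auto simp: indicator_def\<close>)
  qed
  also have "\<dots> = (\<integral>\<^sup>+s\<in>{r..<1}. ennreal (w s) \<partial>lborel)"
    by (rule nn_integral_completion) measurable
  finally show ?thesis ..
qed

lemma T_nonneg: "0 \<le> r \<Longrightarrow> r < 1 \<Longrightarrow> 0 \<le> T r"
  unfolding T_def tail_def set_lebesgue_integral_def
  using rw by (intro integral_nonneg_AE AE_I2) (auto simp: indicator_def radial_weight_def weight_def)

lemma nn_integral_w_Ico:
  assumes "0 \<le> s" "s \<le> t" "t < 1"
  shows "(\<integral>\<^sup>+r\<in>{s..<t}. ennreal (w r) \<partial>lborel) + ennreal (T t) = ennreal (T s)"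
proof -
  have "ennreal (T s) = (\<integral>\<^sup>+r. ennreal (w r) * indicator {s..<t} r + ennreal (w r) * indicator {t..<1} r \<partial>lborel)"
    using assms by (subst nn_integral_tail[symmetric]) (auto intro!: nn_integral_cong simp: indicator_def)
  also have "\<dots> = (\<integral>\<^sup>+r\<in>{s..<t}. ennreal (w r) \<partial>lborel) + (\<integral>\<^sup>+r\<in>{t..<1}. ennreal (w r) \<partial>lborel)"
    by (rule nn_integral_add) measurable
  finally show ?thesis using assms by (simp add: nn_integral_tail)
qed

lemma T_antimono: "0 \<le> s \<Longrightarrow> s \<le> t \<Longrightarrow> t < 1 \<Longrightarrow> T t \<le> T s"
proof -
  assume st: "0 \<le> s" "s \<le> t" "t < 1"
  have "ennreal (T t) \<le> (\<integral>\<^sup>+r\<in>{s..<t}. ennreal (w r) \<partial>lborel) + ennreal (T t)"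
    by (simp add: add_increasing)
  then have "ennreal (T t) \<le> ennreal (T s)" using nn_integral_w_Ico[OF st] by simp
  then show "T t \<le> T s" using T_nonneg[of s] st by simp
qed

lemma nn_integral_w_Ico':
  assumes "0 \<le> s" "s \<le> t" "t < 1"
  shows "(\<integral>\<^sup>+r\<in>{s..<t}. ennreal (w r) \<partial>lborel) = ennreal (T s - T t)"
proof -
  have "(\<integral>\<^sup>+r\<in>{s..<t}. ennreal (w r) \<partial>lborel) + ennreal (T t) = ennreal (T s - T t) + ennreal (T t)"
    using nn_integral_w_Ico[OF assms] T_antimono[OF assms] T_nonneg[of t] assms
    by (simp add: ennreal_plus[symmetric] del: ennreal_plus)
  then show ?thesis by (simp add: ennreal_add_left_cancel add.commute[of _ "ennreal (T t)"])
qed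

text \<open>If the whole tail vanished, polar coordinates would make the weight vanish almost
  everywhere on the disk, which the definition of a weight excludes.\<close>

lemma T0_pos: "0 < T 0"
proof (rule ccontr)
  assume "\<not> 0 < T 0"
  then have "T 0 = 0" using T_nonneg[of 0] by simp
  then have "(\<integral>\<^sup>+s\<in>{0..<1}. ennreal (w s) \<partial>lborel) = 0" by (subst nn_integral_tail) auto
  then have "AE r in lborel. ennreal (w r) * indicator {0..<1} r = 0"
    by (subst (asm) nn_integral_0_iff_AE) auto
  then have "AE r in lborel. ennreal (w r * r) * cmean (\<lambda>_. 1) r * indicator {0..<1} r = 0"
  proof eventually_elim
    case (elim r)
    show ?case
    proof (cases "r \<in> {0..<1}")
      case True
      then have "ennreal (w r) = 0" using elim by simp
      then have "w r = 0" using w_nonneg[of r] by (simp add: ennreal_eq_0_iff)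
      then show ?thesis by simp
    qed simp
  qed
  then have "(\<integral>\<^sup>+r\<in>{0..<1}. ennreal (w r * r) * cmean (\<lambda>_. 1) r \<partial>lborel) = (\<integral>\<^sup>+r. 0 \<partial>(lborel :: real measure))"
    by (rule nn_integral_cong_AE)
  then have w0: "(\<integral>\<^sup>+r\<in>{0..<1}. ennreal (w r * r) * cmean (\<lambda>_. 1) r \<partial>lborel) = 0" by simp
  have "(\<integral>\<^sup>+z\<in>unit_disk. on_disk (\<lambda>_. 1) z * ennreal (w (norm z)) \<partial>lborel) = (\<integral>\<^sup>+z. on_disk (\<lambda>_. 1) z * ennreal (w (norm z)) \<partial>lborel)"
    by (intro nn_integral_cong) (auto simp: on_disk_def indicator_def)
  also have "\<dots> = 0"
    using w0 w_nonneg by (subst nn_integral_disk) (auto simp: disk_int_def)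
  finally have "(\<integral>\<^sup>+z\<in>unit_disk. ennreal (1 * \<omega> z) \<partial>lebesgue) = 0"
    by (subst nn_integral_weight) auto
  moreover have "(\<lambda>z. ennreal (1 * \<omega> z) * indicator unit_disk z) \<in> borel_measurable lebesgue"
  proof -
    have "(\<lambda>z. indicator unit_disk z *\<^sub>R \<omega> z) \<in> borel_measurable lebesgue"
      using rw unfolding radial_weight_def weight_def set_integrable_def by (auto intro: borel_measurable_integrable)
    then have "(\<lambda>z. ennreal (indicator unit_disk z *\<^sub>R \<omega> z)) \<in> borel_measurable lebesgue" by simp
    also have "(\<lambda>z. ennreal (indicator unit_disk z *\<^sub>R \<omega> z)) = (\<lambda>z. ennreal (1 * \<omega> z) * indicator unit_disk z)"
      by (auto simp: fun_eq_iff indicator_def)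
    finally show ?thesis .
  qed
  ultimately have "AE z in lebesgue. ennreal (1 * \<omega> z) * indicator unit_disk z = 0"
    by (simp add: nn_integral_0_iff_AE)
  then have "AE z in lebesgue. z \<in> unit_disk \<longrightarrow> \<omega> z = 0"
    using rw by (auto elim!: eventually_mono simp: indicator_def ennreal_eq_0_iff radial_weight_def weight_def intro!: order_antisym split: if_splits)
  then have "AE z in lebesgue_on unit_disk. \<omega> z = 0"
    by (subst AE_restrict_space_iff) auto
  then show False using rw by (simp add: radial_weight_def weight_def)
qed

lemma D_hat_iff: "\<omega> \<in> D_hat \<longleftrightarrow> (\<exists>C\<ge>1. \<forall>r. 0 \<le> r \<longrightarrow> r < 1 \<longrightarrow> T r \<le> C * T ((1 + r)/2))"
  unfolding D_hat_def T_def using rw by auto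

lemma D_check_iff: "\<omega> \<in> D_check \<longleftrightarrow> (\<exists>K>1. \<exists>C>1. \<forall>r. 0 \<le> r \<longrightarrow> r < 1 \<longrightarrow> C * T (1 - (1 - r)/K) \<le> T r)"
  unfolding D_check_def T_def using rw by auto

text \<open>K is at least the constant of \<open>D_check\<close>, so one step of the grid decays by
  1 / C0. Iterating the doubling condition i times with 2^i > K bounds the decay from below. The
  mass of a layer is the difference of two consecutive tails, hence the 1 - 1 / C0 in c.\<close>

lemma D_class_regular:
  assumes "\<omega> \<in> D_class"
  shows "\<exists>K lam c. regular_weight K lam c w (\<lambda>j. T (radius K j))"
proof -
  obtain C1 where C1: "C1 \<ge> 1" "\<And>r. 0 \<le> r \<Longrightarrow> r < 1 \<Longrightarrow> T r \<le> C1 * T ((1 + r)/2)"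
    using assms unfolding D_class_def by (auto simp: D_hat_iff)
  obtain K0 C0 where K0: "K0 > 1" "C0 > 1" "\<And>r. 0 \<le> r \<Longrightarrow> r < 1 \<Longrightarrow> C0 * T (1 - (1 - r)/K0) \<le> T r"
    using assms unfolding D_class_def by (auto simp: D_check_iff)
  define K where "K = max 2 K0"
  have K: "2 \<le> K" "K0 \<le> K" by (auto simp: K_def)
  have it: "T r \<le> C1 ^ i * T (1 - (1 - r)/2^i)" if r: "0 \<le> r" "r < 1" for r i
  proof (induction i)
    case (Suc i)
    have r': "0 \<le> 1 - (1 - r)/2^i" "1 - (1 - r)/2^i < 1"
    proof -
      define y where "y = (1 - r)/2^i"
      have "y \<le> (1 - r)/1" unfolding y_def using r by (intro divide_left_mono) auto
      then have "y \<le> 1" using r by simp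
      moreover have "0 < y" using r by (simp add: y_def)
      ultimately show "0 \<le> 1 - (1 - r)/2^i" "1 - (1 - r)/2^i < 1" unfolding y_def[symmetric] by simp_all
    qed
    have "T r \<le> C1 ^ i * T (1 - (1 - r)/2^i)" by (rule Suc)
    also have "\<dots> \<le> C1 ^ i * (C1 * T ((1 + (1 - (1 - r)/2^i))/2))"
      using C1(1) r' by (intro mult_left_mono C1(2)) auto
    also have "(1 + (1 - (1 - r)/2^i))/2 = 1 - (1 - r)/2^Suc i" by (simp add: field_simps)
    finally show ?case by (simp add: mult_ac)
  qed simp
  \<comment> \<open>Starting from 0, doubling passes any r < 1 after finitely many steps, so no tail
    vanishes.\<close>
  have Tpos: "0 < T r" if r: "0 \<le> r" "r < 1" for r
  proof -
    obtain i where "1 / (1 - r) < 2^i" using real_arch_pow[of 2] by auto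
    then have i: "r \<le> 1 - 1/2^i" using r by (simp add: field_simps)
    have "T 0 \<le> C1 ^ i * T (1 - (1 - 0)/2^i)" by (rule it) auto
    also have "\<dots> \<le> C1 ^ i * T r" using C1(1) i r by (intro mult_left_mono T_antimono) auto
    finally have "0 < C1 ^ i * T r" using T0_pos by linarith
    then show ?thesis using C1(1) by (simp add: zero_less_mult_iff)
  qed
  obtain i where i: "K < 2^i" using real_arch_pow[of 2] by auto
  define W where "W j = T (radius K j)" for j
  have rad: "0 \<le> radius K j" "radius K j < 1" "radius K (Suc j) = 1 - (1 - radius K j)/K" "radius K j \<le> radius K (Suc j)" for j
  proof -
    have p: "1 \<le> K^j" "0 < K^j" using K by auto
    show "0 \<le> radius K j" "radius K j < 1" using p by (auto simp: radius_def)
    show "radius K (Suc j) = 1 - (1 - radius K j)/K" by (simp add: radius_def mult.commute)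
    show "radius K j \<le> radius K (Suc j)" using p K by (simp add: radius_def field_simps)
  qed
  have Wc: "C0 * W (Suc j) \<le> W j" for j
  proof -
    have "1 - (1 - radius K j)/K0 \<le> radius K (Suc j)"
      unfolding rad(3) using K K0(1) rad[of j] by (intro diff_left_mono divide_left_mono) auto
    moreover have "0 \<le> 1 - (1 - radius K j)/K0" using K0(1) rad[of j] by (simp add: field_simps)
    ultimately have "T (radius K (Suc j)) \<le> T (1 - (1 - radius K j)/K0)" using rad[of "Suc j"] by (intro T_antimono)
    then have "C0 * W (Suc j) \<le> C0 * T (1 - (1 - radius K j)/K0)" unfolding W_def using K0(2) by (intro mult_left_mono) auto
    also have "\<dots> \<le> W j" unfolding W_def by (intro K0(3) rad)
    finally show ?thesis .
  qed
  have Wl: "W j \<le> C1 ^ i * W (Suc j)" for j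
  proof -
    have "W j \<le> C1 ^ i * T (1 - (1 - radius K j)/2^i)" unfolding W_def by (intro it rad)
    also have "radius K (Suc j) \<le> 1 - (1 - radius K j)/2^i"
      unfolding rad(3) using K i rad[of j] by (intro diff_left_mono divide_left_mono) auto
    then have "C1 ^ i * T (1 - (1 - radius K j)/2^i) \<le> C1 ^ i * W (Suc j)"
      unfolding W_def using C1(1) rad[of "Suc j"] rad[of j] by (intro mult_left_mono T_antimono) auto
    finally show ?thesis .
  qed
  have Wpos: "0 < W j" for j unfolding W_def by (intro Tpos rad)
  define c where "c = min (1 / C1 ^ i) (1 - 1/C0)"
  have c: "0 < c" "c \<le> 1 / C1 ^ i" "c \<le> 1 - 1/C0" using C1(1) K0(2) by (auto simp: c_def)
  have lay: "(\<integral>\<^sup>+r\<in>layer K j. ennreal (w r) \<partial>lborel) = ennreal (W j - W (Suc j))" for j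
    unfolding layer_def W_def by (intro nn_integral_w_Ico' rad)
  have dec: "W (Suc j) \<le> W j / C0" for j using Wc[of j] K0(2) by (simp add: field_simps)
  have "regular_weight K (1/C0) c w W"
  proof
    fix j
    show "W (Suc j) \<le> 1 / C0 * W j" using dec[of j] by simp
    show "c * W j \<le> W (Suc j)"
    proof -
      have "c * W j \<le> (1 / C1 ^ i) * (C1 ^ i * W (Suc j))"
        using c Wl[of j] Wpos[of j] C1(1) by (intro mult_mono) auto
      then show ?thesis using C1(1) by simp
    qed
    have "c * W j \<le> (1 - 1/C0) * W j" using c Wpos[of j] by (intro mult_right_mono) auto
    also have "\<dots> \<le> W j - W (Suc j)" using dec[of j] by (simp add: left_diff_distrib)
    finally show "ennreal (c * W j) \<le> (\<integral>\<^sup>+r\<in>layer K j. ennreal (w r) \<partial>lborel)"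
      unfolding lay by (rule ennreal_leI)
    show "(\<integral>\<^sup>+r\<in>layer K j. ennreal (w r) \<partial>lborel) \<le> ennreal (W j)"
      unfolding lay using Wpos[of "Suc j"] by (intro ennreal_leI) auto
  qed (use K K0(1,2) c Wpos w_nonneg in auto)
  then show ?thesis unfolding W_def[abs_def] by blast
qed

end

lemma carl_cong:
  assumes "\<And>z. norm z < 1 \<Longrightarrow> ennreal (G z) * ennreal (w (norm z)) = ennreal (G' z) * ennreal (w' (norm z))"
  shows "carl w G = carl w' G'"
  unfolding carl_def
proof (rule SUP_cong[OF refl])
  fix a :: complex assume a: "a \<in> unit_disk"
  have "(\<integral>\<^sup>+z\<in>carleson_square a. on_disk G z * ennreal (w (norm z)) \<partial>lborel) =
    (\<integral>\<^sup>+z\<in>carleson_square a. on_disk G' z * ennreal (w' (norm z)) \<partial>lborel)"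
  proof (rule nn_integral_cong)
    fix z :: complex
    show "on_disk G z * ennreal (w (norm z)) * indicator (carleson_square a) z =
      on_disk G' z * ennreal (w' (norm z)) * indicator (carleson_square a) z"
      using assms[of z] carleson_squareD(1)[of a z] a by (cases "z \<in> carleson_square a") (auto simp: on_disk_def)
  qed
  then show "ennreal (1 / (1 - norm a)) * (\<integral>\<^sup>+z\<in>carleson_square a. on_disk G z * ennreal (w (norm z)) \<partial>lborel) =
    ennreal (1 / (1 - norm a)) * (\<integral>\<^sup>+z\<in>carleson_square a. on_disk G' z * ennreal (w' (norm z)) \<partial>lborel)"
    by simp
qed

lemma disk_int_mono_weight:
  assumes "\<And>r. 0 \<le> r \<Longrightarrow> r < 1 \<Longrightarrow> v r \<le> w r"
  shows "disk_int v G \<le> disk_int w G"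
  unfolding disk_int_def
proof (rule nn_integral_mono)
  fix r :: real
  show "ennreal (v r * r) * cmean G r * indicator {0..<1} r \<le> ennreal (w r * r) * cmean G r * indicator {0..<1} r"
    using assms[of r] by (cases "0 \<le> r \<and> r < 1") (auto intro!: mult_right_mono ennreal_leI)
qed

lemma carl_le_disk_int:
  assumes G: "continuous_on unit_disk G" "\<And>z. 0 \<le> G z" and w: "w \<in> borel_measurable borel" "\<And>r. 0 \<le> w r"
    and X: "\<And>a. norm a < 1 \<Longrightarrow> disk_int w (\<lambda>z. G z * pk a z) \<le> X"
  shows "carl w G \<le> 7 * X"
  unfolding carl_def
proof (rule SUP_least)
  fix a :: complex assume "a \<in> unit_disk"
  then have a: "norm a < 1" by simp
  have "ennreal (1 / (1 - norm a)) * (\<integral>\<^sup>+z\<in>carleson_square a. on_disk G z * ennreal (w (norm z)) \<partial>lborel)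
    \<le> 7 * disk_int (\<lambda>r. w r * indicator {norm a..} r) (\<lambda>z. G z * pk a z)"
    by (rule carleson_le_disk_int[OF G w a])
  also have "\<dots> \<le> 7 * disk_int w (\<lambda>z. G z * pk a z)"
    using w(2) by (intro mult_left_mono disk_int_mono_weight) (auto simp: indicator_def)
  also have "\<dots> \<le> 7 * X" by (intro mult_left_mono X a) simp
  finally show "ennreal (1 / (1 - norm a)) * (\<integral>\<^sup>+z\<in>carleson_square a. on_disk G z * ennreal (w (norm z)) \<partial>lborel) \<le> 7 * X" .
qed

section \<open>Derivatives of all orders\<close>

context regular_weight
begin

lemma carl_higher_deriv_le:
  assumes q: "0 < q"
  shows "\<exists>C>0. \<forall>f. f holomorphic_on unit_disk \<longrightarrow>
    carl (\<lambda>r. w r * (1 - r) powr (m * q)) (\<lambda>z. norm ((deriv ^^ m) f z) powr q) \<le> ennreal C * carl w (\<lambda>z. norm (f z) powr q)"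
proof -
  obtain C where C: "C > 0" "\<And>f a. f holomorphic_on unit_disk \<Longrightarrow> norm a < 1 \<Longrightarrow>
    disk_int (\<lambda>r. w r * (1 - r) powr (m * q)) (\<lambda>z. norm ((deriv ^^ m) f z) powr q * pk a z)
      \<le> ennreal C * disk_int w (\<lambda>z. norm (f z) powr q * pk a z)"
    using disk_int_higher_deriv[OF q, of m] by blast
  show ?thesis
  proof (intro exI[of _ "7 * (C * 400)"] conjI allI impI)
    show "0 < 7 * (C * 400)" using C by simp
    fix f assume f: "f holomorphic_on unit_disk"
    let ?N = "carl w (\<lambda>z. norm (f z) powr q)"
    have fm: "(deriv ^^ m) f holomorphic_on unit_disk" by (intro holomorphic_higher_deriv f open_ball)
    have "carl (\<lambda>r. w r * (1 - r) powr (m * q)) (\<lambda>z. norm ((deriv ^^ m) f z) powr q) \<le> 7 * (ennreal C * (ennreal 400 * ?N))"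
    proof (rule carl_le_disk_int)
      fix a :: complex assume a: "norm a < 1"
      have "disk_int w (\<lambda>z. norm (f z) powr q * pk a z) \<le> ennreal 400 * ?N"
        using disk_int_pk_le_carl[OF continuous_on_norm_powr[OF f q] _ w_meas w_nonneg a] by simp
      then show "disk_int (\<lambda>r. w r * (1 - r) powr (m * q)) (\<lambda>z. norm ((deriv ^^ m) f z) powr q * pk a z) \<le> ennreal C * (ennreal 400 * ?N)"
        by (intro order_trans[OF C(2)[OF f a]] mult_left_mono) auto
    qed (use w_nonneg continuous_on_norm_powr[OF fm q] in auto)
    also have "7 * (ennreal C * (ennreal 400 * ?N)) = ennreal 7 * (ennreal C * (ennreal 400 * ?N))" by simp
    also have "\<dots> = ennreal (7 * (C * 400)) * ?N"
      using C(1) by (simp only: ennreal_mult_assoc less_imp_le zero_le_numeral)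
    finally show "carl (\<lambda>r. w r * (1 - r) powr (m * q)) (\<lambda>z. norm ((deriv ^^ m) f z) powr q) \<le> ennreal (7 * (C * 400)) * ?N" .
  qed
qed

lemma carl_deriv_at_0_le:
  assumes q: "0 < q"
  shows "\<exists>C>0. \<forall>f. f holomorphic_on unit_disk \<longrightarrow>
    ennreal (norm ((deriv ^^ m) f 0) powr q) \<le> ennreal C * carl w (\<lambda>z. norm (f z) powr q)"
proof -
  obtain C where C: "C > 0" "\<And>f. f holomorphic_on unit_disk \<Longrightarrow>
    ennreal (norm ((deriv ^^ m) f 0) powr q) \<le> ennreal C * disk_int w (\<lambda>z. norm (f z) powr q * pk 0 z)"
    using higher_deriv_at_0[OF q, of m] by blast
  show ?thesis
  proof (intro exI[of _ "C * 400"] conjI allI impI)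
    show "0 < C * 400" using C by simp
    fix f assume f: "f holomorphic_on unit_disk"
    let ?N = "carl w (\<lambda>z. norm (f z) powr q)"
    have "disk_int w (\<lambda>z. norm (f z) powr q * pk 0 z) \<le> ennreal 400 * ?N"
      using disk_int_pk_le_carl[OF continuous_on_norm_powr[OF f q] _ w_meas w_nonneg, of 0] by simp
    then have "ennreal (norm ((deriv ^^ m) f 0) powr q) \<le> ennreal C * (ennreal 400 * ?N)"
      by (intro order_trans[OF C(2)[OF f]] mult_left_mono) auto
    then show "ennreal (norm ((deriv ^^ m) f 0) powr q) \<le> ennreal (C * 400) * ?N"
      using C(1) by (simp only: ennreal_mult_assoc less_imp_le)
  qed
qed

text \<open>Induction on m: the step applies the first-order estimate to the m-th derivative, with
  the weight multiplied by (1 - r)^(m q), which is regular again by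
  \<open>power_weight\<close>.\<close>

lemma carl_le_higher_deriv:
  assumes q: "0 < q"
  shows "\<exists>C>0. \<forall>f. f holomorphic_on unit_disk \<longrightarrow>
    carl w (\<lambda>z. norm (f z) powr q) \<le> ennreal C * ((\<Sum>j<m. ennreal (norm ((deriv ^^ j) f 0) powr q)) +
      carl (\<lambda>r. w r * (1 - r) powr (m * q)) (\<lambda>z. norm ((deriv ^^ m) f z) powr q))"
proof (induction m)
  case 0
  have "carl w (\<lambda>z. norm (f z) powr q) = carl (\<lambda>r. w r * (1 - r) powr (real 0 * q)) (\<lambda>z. norm ((deriv ^^ 0) f z) powr q)" for f
    by (rule carl_cong) simp
  then show ?case by (intro exI[of _ 1]) simp
next
  case (Suc m)
  obtain C where C: "C > 0" "\<And>f. f holomorphic_on unit_disk \<Longrightarrow>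
    carl w (\<lambda>z. norm (f z) powr q) \<le> ennreal C * ((\<Sum>j<m. ennreal (norm ((deriv ^^ j) f 0) powr q)) +
      carl (\<lambda>r. w r * (1 - r) powr (m * q)) (\<lambda>z. norm ((deriv ^^ m) f z) powr q))"
    using Suc by blast
  interpret V: regular_weight K lam "c * K powr (-(m * q))" "\<lambda>r. w r * (1 - r) powr (m * q)" "\<lambda>j. W j * (1 / K ^ j) powr (m * q)"
    by (rule power_weight) (use q in simp)
  obtain D where D: "D > 0" "\<And>f. f holomorphic_on unit_disk \<Longrightarrow>
    carl (\<lambda>r. w r * (1 - r) powr (m * q)) (\<lambda>z. norm (f z) powr q)
      \<le> ennreal D * (ennreal (norm (f 0) powr q) + carl (\<lambda>r. w r * (1 - r) powr (m * q) * (1 - r) powr q) (\<lambda>z. norm (deriv f z) powr q))"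
    using V.carl_le_deriv[OF q] by blast
  show ?case
  proof (intro exI[of _ "C * (1 + D)"] conjI allI impI)
    show "0 < C * (1 + D)" using C D by simp
    fix f assume f: "f holomorphic_on unit_disk"
    have fm: "(deriv ^^ m) f holomorphic_on unit_disk" by (intro holomorphic_higher_deriv f open_ball)
    define S where "S = (\<Sum>j<m. ennreal (norm ((deriv ^^ j) f 0) powr q))"
    define A where "A = ennreal (norm ((deriv ^^ m) f 0) powr q)"
    define N where "N = carl (\<lambda>r. w r * (1 - r) powr (Suc m * q)) (\<lambda>z. norm ((deriv ^^ Suc m) f z) powr q)"
    have "carl (\<lambda>r. w r * (1 - r) powr (m * q) * (1 - r) powr q) (\<lambda>z. norm (deriv ((deriv ^^ m) f) z) powr q) = N"
      unfolding N_def by (rule carl_cong) (simp add: powr_add[symmetric] distrib_right add.commute mult.assoc)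
    then have "carl (\<lambda>r. w r * (1 - r) powr (m * q)) (\<lambda>z. norm ((deriv ^^ m) f z) powr q) \<le> ennreal D * (A + N)"
      using D(2)[OF fm] by (simp add: A_def)
    then have "carl w (\<lambda>z. norm (f z) powr q) \<le> ennreal C * (S + ennreal D * (A + N))"
      unfolding S_def by (intro order_trans[OF C(2)[OF f]] mult_left_mono add_left_mono) auto
    also have "S + ennreal D * (A + N) \<le> ennreal 1 * (S + A + N) + ennreal D * (S + A + N)"
      by (intro add_mono mult_left_mono) (auto simp: add_increasing2 add.assoc)
    also have "\<dots> = ennreal (1 + D) * (S + A + N)" using D(1) by (intro ennreal_distrib) auto
    finally have "carl w (\<lambda>z. norm (f z) powr q) \<le> ennreal C * (ennreal (1 + D) * (S + A + N))"
      by (simp add: mult_left_mono)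
    then show "carl w (\<lambda>z. norm (f z) powr q) \<le> ennreal (C * (1 + D)) * ((\<Sum>j<Suc m. ennreal (norm ((deriv ^^ j) f 0) powr q)) +
        carl (\<lambda>r. w r * (1 - r) powr (Suc m * q)) (\<lambda>z. norm ((deriv ^^ Suc m) f z) powr q))"
      unfolding N_def[symmetric] using C(1) by (simp only: ennreal_mult_assoc less_imp_le S_def A_def sum.lessThan_Suc)
  qed
qed

end

section \<open>The norm equivalence for weights in D\<close>

context radial_rep
begin

lemma continuous_on_weighted_deriv:
  assumes f: "f holomorphic_on unit_disk"
  shows "continuous_on unit_disk (weighted_deriv m f)"
  unfolding weighted_deriv_def
  by (intro continuous_intros holomorphic_on_imp_continuous_on holomorphic_higher_deriv f open_ball)

lemma tent_norm_weighted_deriv: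
  assumes q: "0 < q" and f: "f holomorphic_on unit_disk"
  shows "tent_norm q \<omega> (weighted_deriv m f) =
    ennreal_powr (carl (\<lambda>r. w r * (1 - r) powr (m * q)) (\<lambda>z. norm ((deriv ^^ m) f z) powr q)) (1/q)"
proof -
  have "carl w (\<lambda>z. norm (weighted_deriv m f z) powr q) =
    carl (\<lambda>r. w r * (1 - r) powr (m * q)) (\<lambda>z. norm ((deriv ^^ m) f z) powr q)"
  proof (rule carl_cong)
    fix z :: complex assume z: "norm z < 1"
    have "norm (weighted_deriv m f z) = norm ((deriv ^^ m) f z) * (1 - norm z) ^ m"
      unfolding weighted_deriv_def norm_mult norm_of_real using z by simp
    then have "norm (weighted_deriv m f z) powr q = norm ((deriv ^^ m) f z) powr q * (1 - norm z) powr (m * q)"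
      using z by (simp add: powr_mult powr_realpow[symmetric] powr_powr)
    then show "ennreal (norm (weighted_deriv m f z) powr q) * ennreal (w (norm z)) =
        ennreal (norm ((deriv ^^ m) f z) powr q) * ennreal (w (norm z) * (1 - norm z) powr (m * q))"
      using w_nonneg[of "norm z"] by (simp add: ennreal_mult mult_ac)
  qed
  then show ?thesis using tent_norm_eq[OF q continuous_on_weighted_deriv[OF f]] by simp
qed

lemma tent_norm_holomorphic:
  assumes q: "0 < q" and f: "f holomorphic_on unit_disk"
  shows "tent_norm q \<omega> f = ennreal_powr (carl w (\<lambda>z. norm (f z) powr q)) (1/q)"
  by (rule tent_norm_eq[OF q holomorphic_on_imp_continuous_on[OF f]])

text \<open>The constants come from the estimates of q-th powers by taking roots. Both sides may be
  infinite, so the result also decides membership in the space.\<close>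

theorem tent_norm_equiv:
  assumes D: "\<omega> \<in> D_class" and q: "0 < q"
  shows "\<exists>C>0. \<forall>f. f holomorphic_on unit_disk \<longrightarrow>
      tent_norm q \<omega> f \<le> ennreal C * (ennreal (\<Sum>j<m. norm ((deriv ^^ j) f 0)) + tent_norm q \<omega> (weighted_deriv m f)) \<and>
      ennreal (\<Sum>j<m. norm ((deriv ^^ j) f 0)) + tent_norm q \<omega> (weighted_deriv m f) \<le> ennreal C * tent_norm q \<omega> f"
proof -
  obtain K lam c where reg: "regular_weight K lam c w (\<lambda>j. T (radius K j))"
    using D_class_regular[OF D] by blast
  interpret regular_weight K lam c w "\<lambda>j. T (radius K j)" by (rule reg)
  obtain C1 where C1: "C1 > 0" "\<And>f. f holomorphic_on unit_disk \<Longrightarrow>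
    carl (\<lambda>r. w r * (1 - r) powr (m * q)) (\<lambda>z. norm ((deriv ^^ m) f z) powr q) \<le> ennreal C1 * carl w (\<lambda>z. norm (f z) powr q)"
    using carl_higher_deriv_le[OF q, of m] by blast
  have "\<forall>j. \<exists>C>0. \<forall>f. f holomorphic_on unit_disk \<longrightarrow>
    ennreal (norm ((deriv ^^ j) f 0) powr q) \<le> ennreal C * carl w (\<lambda>z. norm (f z) powr q)"
    using carl_deriv_at_0_le[OF q] by blast
  then obtain C2 where C2: "\<And>j. C2 j > 0" "\<And>j f. f holomorphic_on unit_disk \<Longrightarrow>
    ennreal (norm ((deriv ^^ j) f 0) powr q) \<le> ennreal (C2 j) * carl w (\<lambda>z. norm (f z) powr q)"
    by metis
  obtain C3 where C3: "C3 > 0" "\<And>f. f holomorphic_on unit_disk \<Longrightarrow>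
    carl w (\<lambda>z. norm (f z) powr q) \<le> ennreal C3 * ((\<Sum>j<m. ennreal (norm ((deriv ^^ j) f 0) powr q)) +
      carl (\<lambda>r. w r * (1 - r) powr (m * q)) (\<lambda>z. norm ((deriv ^^ m) f z) powr q))"
    using carl_le_higher_deriv[OF q, of m] by blast
  define Ca where "Ca = (\<Sum>j<m. C2 j powr (1/q)) + C1 powr (1/q)"
  define Cb where "Cb = (C3 * (real m + 1)) powr (1/q)"
  have Ca: "Ca \<ge> 0" by (simp add: Ca_def sum_nonneg)
  have Cb: "Cb > 0" using C3(1) by (simp add: Cb_def)
  show ?thesis
  proof (intro exI[of _ "Ca + Cb"] conjI allI impI)
    show "0 < Ca + Cb" using Ca Cb by simp
    fix f assume f: "f holomorphic_on unit_disk"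
    define N where "N = carl w (\<lambda>z. norm (f z) powr q)"
    define Nm where "Nm = carl (\<lambda>r. w r * (1 - r) powr (m * q)) (\<lambda>z. norm ((deriv ^^ m) f z) powr q)"
    define x where "x j = norm ((deriv ^^ j) f 0)" for j
    have tf: "tent_norm q \<omega> f = ennreal_powr N (1/q)" unfolding N_def by (rule tent_norm_holomorphic[OF q f])
    have tw: "tent_norm q \<omega> (weighted_deriv m f) = ennreal_powr Nm (1/q)" unfolding Nm_def by (rule tent_norm_weighted_deriv[OF q f])
    have x0: "0 \<le> x j" for j by (simp add: x_def)
    have xs: "ennreal (\<Sum>j<m. norm ((deriv ^^ j) f 0)) = (\<Sum>j<m. ennreal (x j))"
      by (simp add: x_def sum_ennreal)
    have root: "ennreal_powr A (1/q) \<le> ennreal (C powr (1/q)) * ennreal_powr B (1/q)" if "A \<le> ennreal C * B" "0 < C" for A B C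
      using ennreal_powr_mono[of "1/q" A "ennreal C * B"] that q by (simp add: ennreal_powr_mult)
    have xroot: "ennreal_powr (ennreal (x j powr q)) (1/q) = ennreal (x j)" for j
      using q x0[of j] by (simp add: ennreal_powr_ennreal powr_powr)
    show "ennreal (\<Sum>j<m. norm ((deriv ^^ j) f 0)) + tent_norm q \<omega> (weighted_deriv m f) \<le> ennreal (Ca + Cb) * tent_norm q \<omega> f"
    proof -
      have "(\<Sum>j<m. ennreal (x j)) \<le> (\<Sum>j<m. ennreal (C2 j powr (1/q)) * ennreal_powr N (1/q))"
      proof (rule sum_mono)
        fix j
        have "ennreal (x j powr q) \<le> ennreal (C2 j) * N" unfolding x_def N_def by (rule C2(2)[OF f])
        from root[OF this C2(1)] show "ennreal (x j) \<le> ennreal (C2 j powr (1/q)) * ennreal_powr N (1/q)"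
          by (simp only: xroot)
      qed
      also have "\<dots> = ennreal (\<Sum>j<m. C2 j powr (1/q)) * ennreal_powr N (1/q)"
        by (simp add: sum_distrib_right[symmetric] sum_ennreal)
      finally have 1: "(\<Sum>j<m. ennreal (x j)) \<le> ennreal (\<Sum>j<m. C2 j powr (1/q)) * ennreal_powr N (1/q)" .
      have "Nm \<le> ennreal C1 * N" unfolding Nm_def N_def by (rule C1(2)[OF f])
      from root[OF this C1(1)]
      have "(\<Sum>j<m. ennreal (x j)) + ennreal_powr Nm (1/q) \<le>
        ennreal (\<Sum>j<m. C2 j powr (1/q)) * ennreal_powr N (1/q) + ennreal (C1 powr (1/q)) * ennreal_powr N (1/q)"
        by (intro add_mono 1)
      also have "\<dots> = ennreal Ca * ennreal_powr N (1/q)"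
        unfolding Ca_def by (intro ennreal_distrib sum_nonneg) auto
      also have "\<dots> \<le> ennreal (Ca + Cb) * ennreal_powr N (1/q)"
        using Cb by (intro mult_right_mono ennreal_leI) auto
      finally show ?thesis unfolding tf tw xs .
    qed
    show "tent_norm q \<omega> f \<le> ennreal (Ca + Cb) * (ennreal (\<Sum>j<m. norm ((deriv ^^ j) f 0)) + tent_norm q \<omega> (weighted_deriv m f))"
    proof -
      \<comment> \<open>In place of convexity: each of the m + 1 terms is at most S, so their q-th
        powers add up to at most (m + 1) S^q, whatever q is.\<close>
      define S where "S = (\<Sum>j<m. ennreal (x j)) + ennreal_powr Nm (1/q)"
      have xS: "ennreal (x j powr q) \<le> ennreal_powr S q" if "j < m" for j
      proof -
        have "ennreal (x j) \<le> (\<Sum>j<m. ennreal (x j))" using that by (intro member_le_sum) auto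
        also have "\<dots> \<le> S" by (simp add: S_def)
        finally have "ennreal_powr (ennreal (x j)) q \<le> ennreal_powr S q" by (intro ennreal_powr_mono q)
        then show ?thesis by (simp add: ennreal_powr_ennreal x0)
      qed
      have "Nm = ennreal_powr (ennreal_powr Nm (1/q)) q" using q by (simp add: ennreal_powr_inverse)
      also have "\<dots> \<le> ennreal_powr S q" by (intro ennreal_powr_mono q) (simp add: S_def)
      finally have NS: "Nm \<le> ennreal_powr S q" .
      have "N \<le> ennreal C3 * ((\<Sum>j<m. ennreal (x j powr q)) + Nm)"
        unfolding x_def N_def Nm_def by (rule C3(2)[OF f])
      also have "\<dots> \<le> ennreal C3 * ((\<Sum>j<m. ennreal_powr S q) + ennreal_powr S q)"
        by (intro mult_left_mono add_mono sum_mono xS NS) auto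
      also have "(\<Sum>j<m. ennreal_powr S q) + ennreal_powr S q = ennreal (real m + 1) * ennreal_powr S q"
        by (simp add: distrib_right ennreal_of_nat_eq_real_of_nat)
      also have "ennreal C3 * (ennreal (real m + 1) * ennreal_powr S q) = ennreal (C3 * (real m + 1)) * ennreal_powr S q"
        using C3(1) by (intro ennreal_mult_assoc) auto
      finally have "N \<le> ennreal (C3 * (real m + 1)) * ennreal_powr S q" .
      from root[OF this] have "ennreal_powr N (1/q) \<le> ennreal Cb * S"
        using C3(1) q by (simp add: Cb_def ennreal_powr_inverse)
      also have "\<dots> \<le> ennreal (Ca + Cb) * S" using Ca by (intro mult_right_mono ennreal_leI) auto
      finally show ?thesis unfolding tf tw xs S_def .
    qed
  qed
qed

end

section \<open>Moments\<close>

lemma exp_le_one_minus: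
  fixes x :: real
  assumes "0 \<le> x" "x \<le> 1/2"
  shows "exp (- 2 * x) \<le> 1 - x"
proof -
  have "- x - 2 * x\<^sup>2 \<le> ln (1 - x)" using assms by (rule ln_one_minus_pos_lower_bound)
  moreover have "2 * x\<^sup>2 \<le> x" using assms mult_left_mono[of x "1/2" x] by (simp add: power2_eq_square)
  ultimately have "- 2 * x \<le> ln (1 - x)" by linarith
  then have "exp (- 2 * x) \<le> exp (ln (1 - x))" by simp
  then show ?thesis using assms by simp
qed

text \<open>From t <= exp t with t = c y / b, raised to the power b. The true maximum is smaller by
  the factor exp (- b).\<close>

lemma powr_times_exp_le:
  fixes y :: real
  assumes "0 < y" "0 < b" "0 < c"
  shows "y powr b * exp (- c * y) \<le> (b / c) powr b"
proof -
  have "c * y / b \<le> exp (c * y / b)" using exp_ge_add_one_self[of "c * y / b"] by linarith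
  then have "(c * y / b) powr b \<le> exp (c * y / b) powr b" using assms by (intro powr_mono2) auto
  also have "exp (c * y / b) powr b = exp (c * y)" using assms by (simp add: powr_def)
  finally have "(b / c) powr b * (c * y / b) powr b \<le> (b / c) powr b * exp (c * y)" by (intro mult_left_mono) auto
  moreover have "(b / c) powr b * (c * y / b) powr b = y powr b"
    using assms by (simp add: powr_mult[symmetric])
  ultimately have "y powr b \<le> (b / c) powr b * exp (c * y)" by simp
  then have "y powr b * exp (- c * y) \<le> (b / c) powr b * exp (c * y) * exp (- c * y)" by (intro mult_right_mono) auto
  also have "\<dots> = (b / c) powr b" by (simp add: mult.assoc exp_add[symmetric])
  finally show ?thesis .
qed

lemma ex_powr_neg_le:
  fixes C e b :: real
  assumes "0 < C" "0 < e" "0 < b"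
  shows "\<exists>L::nat. 1 \<le> L \<and> C * real L powr (-b) \<le> e"
proof -
  obtain L :: nat where L: "(C / e) powr (1/b) + 1 \<le> real L" using real_arch_simple by blast
  have "0 \<le> (C / e) powr (1/b)" by simp
  then have L1: "1 \<le> L" using L by linarith
  have "((C / e) powr (1/b)) powr b \<le> real L powr b" using L assms by (intro powr_mono2) auto
  then have "C / e \<le> real L powr b" using assms by (simp add: powr_powr)
  then have "C * real L powr (-b) \<le> e" using assms L1 by (simp add: powr_minus field_simps)
  with L1 show ?thesis by blast
qed

text \<open>Records what testing on z^n yields, with b = m q and \<open>M\<close> the weight in
  polar coordinates: the m-th derivative has a coefficient of size n^m and leaves r^(n - m). In
  \<open>upper\<close> this is weakened to r^n, so that both sides carry the same power.\<close>

locale moment_measure = finite_measure M for M :: "real measure" +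
  fixes q b C :: real and m :: nat
  assumes sets_M [measurable_cong]: "sets M = sets borel" and AE01: "AE r in M. 0 < r \<and> r < 1"
    and q: "0 < q" and b: "0 < b" and C: "0 < C" and m: "1 \<le> m"
    and upper: "m \<le> n \<Longrightarrow> (\<integral>r. (real n * (1 - r)) powr b * r powr (real n * q) \<partial>M) \<le> C * (\<integral>r. r powr (real n * q) \<partial>M)"
    and lower: "m \<le> n \<Longrightarrow> (\<integral>r. r powr (real n * q) \<partial>M) \<le> C * (\<integral>r. (real n * (1 - r)) powr b * r powr (real (n - m) * q) \<partial>M)"
    and nontrivial: "emeasure M (space M) \<noteq> 0"
begin

definition "mom n = (\<integral>r. r powr (real n * q) \<partial>M)"

definition "mt s = measure M {s..}"

lemma space_M [simp]: "space M = UNIV"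
  using sets_eq_imp_space_eq[OF sets_M] by simp

lemma bounded_integrable:
  fixes f :: "real \<Rightarrow> real"
  assumes "f \<in> borel_measurable borel" "\<And>r. 0 < r \<Longrightarrow> r < 1 \<Longrightarrow> \<bar>f r\<bar> \<le> B"
  shows "integrable M f"
proof (rule integrable_const_bound)
  show "AE x in M. norm (f x) \<le> B"
    using AE01 by eventually_elim (use assms(2) in auto)
  show "f \<in> borel_measurable M" using assms(1) sets_M by (simp cong: measurable_cong_sets)
qed

lemma integral_le:
  fixes f g :: "real \<Rightarrow> real"
  assumes "integrable M f" "integrable M g" "\<And>r. 0 < r \<Longrightarrow> r < 1 \<Longrightarrow> f r \<le> g r"
  shows "integral\<^sup>L M f \<le> integral\<^sup>L M g"
  using assms(1,2)
proof (rule integral_mono_AE)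
  show "AE x in M. f x \<le> g x" using AE01 by eventually_elim (use assms(3) in auto)
qed

lemma powr_le_1: "0 < r \<Longrightarrow> r < 1 \<Longrightarrow> r powr (real n * q) \<le> 1"
  using q by (intro powr_le1) auto

lemma int_powr: "integrable M (\<lambda>r. r powr (real n * q))"
  by (rule bounded_integrable[where B = 1]) (use powr_le_1 in auto)

lemma int_powr_ind: "A \<in> sets borel \<Longrightarrow> integrable M (\<lambda>r. r powr (real n * q) * indicator A r)"
  by (rule bounded_integrable[where B = 1]) (use powr_le_1 in \<open>auto simp: indicator_def\<close>)

lemma int_ind: "A \<in> sets borel \<Longrightarrow> integrable M (indicator A :: real \<Rightarrow> real)"
  by (rule bounded_integrable[where B = 1]) (auto simp: indicator_def)

lemma integral_ind: "A \<in> sets borel \<Longrightarrow> (\<integral>r. indicator A r \<partial>M) = measure M A"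
  using sets_M by simp

lemma int_main: "integrable M (\<lambda>r. (real n * (1 - r)) powr b * r powr (real k * q))"
proof (rule bounded_integrable[where B = "real n powr b"])
  fix r :: real assume r: "0 < r" "r < 1"
  have "(real n * (1 - r)) powr b \<le> real n powr b" using r b by (intro powr_mono2) (auto simp: mult_left_le)
  then have "(real n * (1 - r)) powr b * r powr (real k * q) \<le> real n powr b * 1"
    using powr_le_1[OF r] by (intro mult_mono) auto
  then show "\<bar>(real n * (1 - r)) powr b * r powr (real k * q)\<bar> \<le> real n powr b" by simp
qed measurable

lemma mom_pos: "0 < mom n"
proof -
  have "0 \<le> mom n" unfolding mom_def by (intro integral_nonneg_AE AE_I2) simp
  moreover have "mom n \<noteq> 0"
  proof
    assume "mom n = 0"
    then have "AE r in M. r powr (real n * q) = 0"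
      unfolding mom_def using int_powr by (subst (asm) integral_nonneg_eq_0_iff_AE) auto
    then have "AE r in M. False" using AE01 by eventually_elim auto
    then show False using nontrivial emeasure_eq_0_AE[where M = M and P = "\<lambda>_. True"] by simp
  qed
  ultimately show ?thesis by simp
qed

text \<open>Chebyshev's inequality: on this range n (1 - r) >= L, so the additional factor in
  \<open>upper\<close> is at least L^b.\<close>

lemma outer_part:
  assumes n: "m \<le> n" and L: "0 < L"
  shows "(\<integral>r. r powr (real n * q) * indicator {..<1 - L / real n} r \<partial>M) \<le> C * L powr (-b) * mom n"
proof -
  have n0: "0 < real n" using n m by simp
  have "(\<integral>r. r powr (real n * q) * indicator {..<1 - L / real n} r \<partial>M)
     \<le> (\<integral>r. L powr (-b) * ((real n * (1 - r)) powr b * r powr (real n * q)) \<partial>M)"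
  proof (rule integral_le)
    fix r :: real assume r: "0 < r" "r < 1"
    show "r powr (real n * q) * indicator {..<1 - L / real n} r \<le> L powr (-b) * ((real n * (1 - r)) powr b * r powr (real n * q))"
    proof (cases "r < 1 - L / real n")
      case True
      then have "L \<le> real n * (1 - r)" using n0 by (simp add: field_simps)
      then have "L powr b \<le> (real n * (1 - r)) powr b" using L b by (intro powr_mono2) auto
      then have "1 \<le> L powr (-b) * (real n * (1 - r)) powr b" using L by (simp add: powr_minus field_simps)
      then have "1 * r powr (real n * q) \<le> (L powr (-b) * (real n * (1 - r)) powr b) * r powr (real n * q)"
        by (intro mult_right_mono) auto
      then show ?thesis using True by (simp add: mult.assoc)
    qed simp
  qed (use int_powr_ind int_main in auto)
  also have "\<dots> = L powr (-b) * (\<integral>r. (real n * (1 - r)) powr b * r powr (real n * q) \<partial>M)" by simp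
  also have "\<dots> \<le> L powr (-b) * (C * mom n)" unfolding mom_def by (intro mult_left_mono upper n) simp
  finally show ?thesis by (simp add: mult_ac)
qed

lemma powr_near_1:
  assumes "0 < \<delta>" "2 * \<delta> \<le> real n" "1 - \<delta> / real n \<le> r" "0 \<le> y"
  shows "exp (- 2 * \<delta> * y) \<le> r powr (real n * y)"
proof -
  have n0: "0 < real n" using assms by linarith
  have "\<delta> / real n \<le> 1/2" using assms n0 by (simp add: field_simps)
  then have "exp (- 2 * (\<delta> / real n)) \<le> 1 - \<delta> / real n" using assms n0 by (intro exp_le_one_minus) auto
  then have "exp (- 2 * (\<delta> / real n)) \<le> r" using assms by linarith
  then have "exp (- 2 * (\<delta> / real n)) powr (real n * y) \<le> r powr (real n * y)"
    using assms by (intro powr_mono2) auto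
  moreover have "exp (- 2 * (\<delta> / real n)) powr (real n * y) = exp (- 2 * \<delta> * y)"
    using n0 by (simp add: powr_def)
  ultimately show ?thesis by simp
qed

lemma mt_le_mom:
  assumes "0 < \<delta>" "2 * \<delta> \<le> real n"
  shows "mt (1 - \<delta> / real n) \<le> exp (2 * \<delta> * q) * mom n"
proof -
  have "mt (1 - \<delta> / real n) = (\<integral>r. indicator {1 - \<delta> / real n..} r \<partial>M)"
    unfolding mt_def by (rule integral_ind[symmetric]) simp
  also have "\<dots> \<le> (\<integral>r. exp (2 * \<delta> * q) * r powr (real n * q) \<partial>M)"
  proof (rule integral_le)
    fix r :: real assume r: "0 < r" "r < 1"
    show "indicator {1 - \<delta> / real n..} r \<le> exp (2 * \<delta> * q) * r powr (real n * q)"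
    proof (cases "1 - \<delta> / real n \<le> r")
      case True
      have "exp (2 * \<delta> * q) * exp (- 2 * \<delta> * q) \<le> exp (2 * \<delta> * q) * r powr (real n * q)"
        using powr_near_1[OF assms True, of q] q by (intro mult_left_mono) auto
      then show ?thesis using True by (simp add: exp_add[symmetric])
    qed simp
  qed (use int_ind int_powr in auto)
  finally show ?thesis by (simp add: mom_def)
qed

text \<open>By \<open>outer_part\<close>, at most a quarter of the n-th moment comes from points
  further than L / n from 1.\<close>

definition "L = (SOME L::nat. 1 \<le> L \<and> C * real L powr (-b) \<le> 1/4)"

lemma L: "1 \<le> L" "C * real L powr (-b) \<le> 1/4"
proof -
  have "\<exists>L::nat. 1 \<le> L \<and> C * real L powr (-b) \<le> 1/4" using C b by (intro ex_powr_neg_le) auto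
  then have "1 \<le> L \<and> C * real L powr (-b) \<le> 1/4" unfolding L_def by (rule someI_ex)
  then show "1 \<le> L" "C * real L powr (-b) \<le> 1/4" by auto
qed

lemma outer_part_quarter:
  assumes n: "m \<le> n"
  shows "(\<integral>r. r powr (real n * q) * indicator {..<1 - real L / real n} r \<partial>M) \<le> mom n / 4"
proof -
  have "(\<integral>r. r powr (real n * q) * indicator {..<1 - real L / real n} r \<partial>M) \<le> C * real L powr (-b) * mom n"
    using L by (intro outer_part n) auto
  also have "\<dots> \<le> 1/4 * mom n" using L mom_pos[of n] by (intro mult_right_mono) auto
  finally show ?thesis by simp
qed

lemma mom_le_mt:
  assumes n: "m \<le> n"
  shows "mom n \<le> 2 * mt (1 - real L / real n)"
proof -
  let ?s = "1 - real L / real n"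
  have "mom n \<le> (\<integral>r. r powr (real n * q) * indicator {..<?s} r + indicator {?s..} r \<partial>M)"
    unfolding mom_def
  proof (rule integral_le)
    fix r :: real assume r: "0 < r" "r < 1"
    show "r powr (real n * q) \<le> r powr (real n * q) * indicator {..<?s} r + indicator {?s..} r"
      using powr_le_1[OF r, of n] by (cases "r < ?s") auto
  qed (use int_powr int_powr_ind int_ind in auto)
  also have "\<dots> = (\<integral>r. r powr (real n * q) * indicator {..<?s} r \<partial>M) + mt ?s"
    unfolding mt_def by (subst Bochner_Integration.integral_add) (use int_powr_ind int_ind integral_ind in auto)
  also have "\<dots> \<le> mom n / 4 + mt ?s" using outer_part_quarter[OF n] by simp
  finally show ?thesis using mom_pos[of n] by linarith
qed

text \<open>At least three quarters of the n-th moment come from r >= 1 - L / n, and there r^n >=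
  exp (- 2 L) bounds r^(A n q) from below by a constant.\<close>

lemma mom_doubling:
  assumes n: "m \<le> n" "2 * L \<le> n" and A: "1 \<le> A"
  shows "mom n \<le> 2 * exp (2 * real L * (real A * q)) * mom (A * n)"
proof -
  let ?s = "1 - real L / real n"
  let ?e = "exp (- 2 * real L * (real A * q))"
  have "(\<integral>r. ?e * (r powr (real n * q) - r powr (real n * q) * indicator {..<?s} r) \<partial>M) \<le> mom (A * n)"
    unfolding mom_def
  proof (rule integral_le)
    fix r :: real assume r: "0 < r" "r < 1"
    show "?e * (r powr (real n * q) - r powr (real n * q) * indicator {..<?s} r) \<le> r powr (real (A * n) * q)"
    proof (cases "r < ?s")
      case False
      have "?e \<le> r powr (real n * (real A * q))"
        using False L n q by (intro powr_near_1) auto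
      then have "?e * r powr (real n * q) \<le> r powr (real n * (real A * q)) * 1"
        using powr_le_1[OF r] by (intro mult_mono) auto
      then show ?thesis using False by (simp add: mult_ac)
    qed simp
  qed (use int_powr[of n] int_powr[of "A * n"] int_powr_ind in auto)
  also have "(\<integral>r. ?e * (r powr (real n * q) - r powr (real n * q) * indicator {..<?s} r) \<partial>M)
     = ?e * (mom n - (\<integral>r. r powr (real n * q) * indicator {..<?s} r \<partial>M))"
    unfolding mom_def by (simp add: Bochner_Integration.integral_diff int_powr int_powr_ind)
  finally have "?e * (mom n - (\<integral>r. r powr (real n * q) * indicator {..<?s} r \<partial>M)) \<le> mom (A * n)" .
  moreover have "?e * (mom n / 2) \<le> ?e * (mom n - (\<integral>r. r powr (real n * q) * indicator {..<?s} r \<partial>M))"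
    using outer_part_quarter[OF n(1)] mom_pos[of n] by (intro mult_left_mono) auto
  ultimately have "?e * (mom n / 2) \<le> mom (A * n)" by linarith
  then have "exp (2 * real L * (real A * q)) * (?e * (mom n / 2)) \<le> exp (2 * real L * (real A * q)) * mom (A * n)"
    by (intro mult_left_mono) auto
  then show ?thesis by (simp add: mult.assoc[symmetric] exp_add[symmetric])
qed

text \<open>The mass within 1 / n of 1 is at most a multiple of the n-th moment, hence of the moment
  of order 4 L n, which is controlled by the mass within L / (4 L n) = 1 / (4 n) of 1. The 4 leaves
  a factor 2 for halving 1 - r and another for rounding 1 / (1 - r).\<close>

theorem mt_doubling:
  "\<exists>n0 D. 1 \<le> n0 \<and> 0 < D \<and> (\<forall>n\<ge>n0. mt (1 - 1 / real n) \<le> D * mt (1 - 1 / (4 * real n)) \<and> 0 < mt (1 - 1 / (4 * real n)))"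
proof (intro exI conjI allI impI)
  let ?n0 = "m + 2 * L + 2"
  let ?D = "exp (2 * q) * (2 * exp (2 * real L * (real (4 * L) * q)) * 2)"
  show "1 \<le> ?n0" by simp
  show "0 < ?D" by simp
  fix n assume n: "?n0 \<le> n"
  have n': "m \<le> n" "2 * L \<le> n" "2 \<le> n" "m \<le> 4 * L * n" using n L by (auto intro: order_trans[of m n])
  have "mom (4 * L * n) \<le> 2 * mt (1 - real L / real (4 * L * n))" by (rule mom_le_mt[OF n'(4)])
  also have "real L / real (4 * L * n) = 1 / (4 * real n)" using L by simp
  finally have le: "mom (4 * L * n) \<le> 2 * mt (1 - 1 / (4 * real n))" .
  then show "0 < mt (1 - 1 / (4 * real n))" using mom_pos[of "4 * L * n"] by linarith
  have "mt (1 - 1 / real n) \<le> exp (2 * 1 * q) * mom n" using n' by (intro mt_le_mom) auto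
  also have "\<dots> \<le> exp (2 * 1 * q) * (2 * exp (2 * real L * (real (4 * L) * q)) * mom (4 * L * n))"
    using L n' by (intro mult_left_mono mom_doubling) auto
  also have "\<dots> \<le> exp (2 * 1 * q) * (2 * exp (2 * real L * (real (4 * L) * q)) * (2 * mt (1 - 1 / (4 * real n))))"
    by (intro mult_left_mono le) auto
  finally show "mt (1 - 1 / real n) \<le> ?D * mt (1 - 1 / (4 * real n))" by (simp add: mult_ac)
qed

text \<open>By \<open>lower\<close>, the moment of order 4 k cannot sit too close to 1, where (4 k
  (1 - r))^b is small; so a fixed part of it is controlled by radii below
  \<open>1 - \<delta> / (4 * real k)\<close>. By \<open>outer_part\<close> little of that comes from
  radii below \<open>1 - real L' / real k\<close>. Hence the mass between the two radii is at least
  a fixed multiple of the mass beyond the larger one.\<close>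

theorem mt_gap:
  "\<exists>k0 (L'::nat) \<delta> \<eta>. 0 < k0 \<and> 1 \<le> L' \<and> 0 < \<delta> \<and> \<delta> \<le> 1 \<and> 0 < \<eta> \<and>
    (\<forall>k\<ge>k0. (1 + \<eta>) * mt (1 - \<delta> / (4 * real k)) \<le> mt (1 - real L' / real k))"
proof -
  define C4 where "C4 = (b / (q/4)) powr b"
  have C4: "0 < C4" using b q by (simp add: C4_def)
  \<comment> \<open>Makes the part of \<open>lower\<close> closer than \<open>\<delta> / n\<close>
    to 1 at most half of the moment of order n, where n = 4 k.\<close>
  define \<delta> where "\<delta> = min 1 ((1 / (2 * C * exp (2 * q))) powr (1/b))"
  have d: "0 < \<delta>" "\<delta> \<le> 1" using C by (auto simp: \<delta>_def)
  have dC: "C * (\<delta> powr b * exp (2 * q)) \<le> 1/2"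
  proof -
    have "\<delta> powr b \<le> ((1 / (2 * C * exp (2 * q))) powr (1/b)) powr b"
      using d b by (intro powr_mono2) (auto simp: \<delta>_def)
    also have "\<dots> = 1 / (2 * C * exp (2 * q))" using b C by (simp add: powr_powr)
    finally show ?thesis using C by (simp add: field_simps)
  qed
  define E where "E = 2 * exp (2 * real L * (real 4 * q))"
  have E: "0 < E" by (simp add: E_def)
  \<comment> \<open>Makes the part below \<open>1 - L' / k\<close> at most half of the moment of
    order 4 k; E is the price for comparing order k with order 4 k.\<close>
  obtain L' :: nat where L': "1 \<le> L'" "(2 * C * C4 * C * E) * real L' powr (-b) \<le> 1/2"
    using ex_powr_neg_le[of "2 * C * C4 * C * E" "1/2" b] C C4 E b by auto
  \<comment> \<open>The reciprocal of the factor by which the mass beyond the larger radius may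
    exceed the mass between the two radii.\<close>
  define \<eta> where "\<eta> = 1 / (exp (2 * q) * (4 * C * C4))"
  have eta: "0 < \<eta>" using C C4 by (simp add: \<eta>_def)
  show ?thesis
  proof (intro exI conjI allI impI)
    let ?k0 = "m + 2 * L + 2"
    show "0 < ?k0" by simp
    show "1 \<le> L'" "0 < \<delta>" "\<delta> \<le> 1" "0 < \<eta>" by (fact L' d eta)+
    fix k assume k0: "?k0 \<le> k"
    let ?s = "1 - real L' / real k" and ?n = "4 * k"
    let ?t = "1 - \<delta> / real ?n"
    have k: "0 < real k" "m \<le> k" "2 * L \<le> k" "m \<le> ?n" using k0 by auto
    have st: "?s \<le> ?t"
    proof -
      have "\<delta> / (4 * real k) \<le> real L' / real k" using k(1) d L' by (simp add: field_simps)
      then show ?thesis by simp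
    qed
    define P where "P = (\<integral>r. r powr (real k * q) * indicator {..<?t} r \<partial>M)"
    have mtn: "mt ?t \<le> exp (2 * q) * mom ?n"
    proof -
      have "mt ?t \<le> exp (2 * \<delta> * q) * mom ?n" using d k0 by (intro mt_le_mom) auto
      also have "\<dots> \<le> exp (2 * q) * mom ?n" using d q mom_pos[of ?n] by (intro mult_right_mono) auto
      finally show ?thesis .
    qed
    have "mom ?n \<le> C * (\<integral>r. (real ?n * (1 - r)) powr b * r powr (real (?n - m) * q) \<partial>M)"
      unfolding mom_def by (rule lower[OF k(4)])
    also have "(\<integral>r. (real ?n * (1 - r)) powr b * r powr (real (?n - m) * q) \<partial>M) \<le>
      (\<integral>r. \<delta> powr b * indicator {?t..} r + C4 * (r powr (real k * q) * indicator {..<?t} r) \<partial>M)"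
    proof (rule integral_le)
      fix r :: real assume r: "0 < r" "r < 1"
      show "(real ?n * (1 - r)) powr b * r powr (real (?n - m) * q) \<le>
         \<delta> powr b * indicator {?t..} r + C4 * (r powr (real k * q) * indicator {..<?t} r)"
      proof (cases "r < ?t")
        case False
        then have "real ?n * (1 - r) \<le> \<delta>" using k(1) by (simp add: field_simps)
        then have "(real ?n * (1 - r)) powr b \<le> \<delta> powr b" using r b k(1) by (intro powr_mono2) auto
        then have "(real ?n * (1 - r)) powr b * r powr (real (?n - m) * q) \<le> \<delta> powr b * 1"
          using powr_le_1[OF r] by (intro mult_mono) auto
        then show ?thesis using False by simp
      next
        case True
        define y where "y = real ?n * (1 - r)"
        have y: "0 < y" using r k(1) by (simp add: y_def)
        \<comment> \<open>As 4 k - m >= 2 k, two factors r^(k q) are available: one absorbs y^b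
          through its exponential decay, the other is kept for \<open>outer_part\<close>.\<close>
        have "real k * q + real k * q \<le> real (?n - m) * q"
        proof -
          have "real k + real k \<le> real (?n - m)" using k by linarith
          then show ?thesis using q by (simp add: distrib_right[symmetric] del: distrib_right)
        qed
        then have "r powr (real (?n - m) * q) \<le> r powr (real k * q + real k * q)"
          using r by (intro powr_mono') auto
        also have "\<dots> = r powr (real k * q) * r powr (real k * q)" by (rule powr_add)
        also have "\<dots> \<le> exp (- (q/4) * y) * r powr (real k * q)"
        proof (intro mult_right_mono)
          have "ln r \<le> r - 1" using r by (intro ln_le_minus_one)
          then have "real k * q * ln r \<le> real k * q * (r - 1)" using q by (intro mult_left_mono) auto
          then show "r powr (real k * q) \<le> exp (- (q/4) * y)"
            using r by (simp add: powr_def y_def algebra_simps)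
        qed simp
        finally have "y powr b * r powr (real (?n - m) * q) \<le> y powr b * (exp (- (q/4) * y) * r powr (real k * q))"
          by (intro mult_left_mono) auto
        also have "\<dots> = (y powr b * exp (- (q/4) * y)) * r powr (real k * q)" by simp
        also have "\<dots> \<le> C4 * r powr (real k * q)"
          unfolding C4_def using y b q by (intro mult_right_mono powr_times_exp_le) auto
        finally show ?thesis using True by (simp add: y_def)
      qed
    qed (use int_main[of ?n "?n - m"] int_ind int_powr_ind in auto)
    also have "\<dots> = \<delta> powr b * mt ?t + C4 * P"
      unfolding P_def mt_def by (subst Bochner_Integration.integral_add) (use int_ind int_powr_ind integral_ind in auto)
    finally have "mom ?n \<le> C * (\<delta> powr b * mt ?t + C4 * P)" using C by (simp add: mult_left_mono)
    moreover have "C * (\<delta> powr b * mt ?t) \<le> 1/2 * mom ?n"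
    proof -
      have "C * (\<delta> powr b * mt ?t) \<le> C * (\<delta> powr b * (exp (2 * q) * mom ?n))"
        using C by (intro mult_left_mono mtn) auto
      also have "\<dots> = C * (\<delta> powr b * exp (2 * q)) * mom ?n" by simp
      also have "\<dots> \<le> 1/2 * mom ?n" using mom_pos[of ?n] by (intro mult_right_mono dC) auto
      finally show ?thesis .
    qed
    ultimately have v1: "mom ?n \<le> 2 * C * C4 * P" by (simp add: distrib_left)
    have "P \<le> (\<integral>r. r powr (real k * q) * indicator {..<?s} r + (indicator {?s..} r - indicator {?t..} r) \<partial>M)"
      unfolding P_def
    proof (rule integral_le)
      fix r :: real assume r: "0 < r" "r < 1"
      show "r powr (real k * q) * indicator {..<?t} r \<le> r powr (real k * q) * indicator {..<?s} r + (indicator {?s..} r - indicator {?t..} r)"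
        using powr_le_1[OF r, of k] st by (auto simp: indicator_def)
    qed (use int_ind int_powr_ind in auto)
    also have "\<dots> = (\<integral>r. r powr (real k * q) * indicator {..<?s} r \<partial>M) + (mt ?s - mt ?t)"
    proof -
      have "(\<integral>r. (indicator {?s..} r - indicator {?t..} r :: real) \<partial>M) = mt ?s - mt ?t"
        unfolding mt_def by (subst Bochner_Integration.integral_diff) (use int_ind integral_ind in auto)
      then show ?thesis
        by (subst Bochner_Integration.integral_add) (use int_ind int_powr_ind in auto)
    qed
    also have "(\<integral>r. r powr (real k * q) * indicator {..<?s} r \<partial>M) \<le> C * real L' powr (-b) * mom k"
      using L' by (intro outer_part k) auto
    also have "\<dots> \<le> C * real L' powr (-b) * (E * mom ?n)"
      unfolding E_def using C k by (intro mult_left_mono mom_doubling) auto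
    finally have P: "P \<le> C * real L' powr (-b) * (E * mom ?n) + (mt ?s - mt ?t)" by simp
    have "mom ?n \<le> 2 * C * C4 * (C * real L' powr (-b) * (E * mom ?n) + (mt ?s - mt ?t))"
      using v1 P C C4 by (intro order_trans[OF v1] mult_left_mono) auto
    also have "\<dots> = (2 * C * C4 * C * E) * real L' powr (-b) * mom ?n + 2 * C * C4 * (mt ?s - mt ?t)"
      by (simp add: algebra_simps)
    also have "(2 * C * C4 * C * E) * real L' powr (-b) * mom ?n \<le> 1/2 * mom ?n"
      using mom_pos[of ?n] by (intro mult_right_mono L') auto
    finally have "mom ?n \<le> 4 * C * C4 * (mt ?s - mt ?t)" by simp
    then have "exp (2 * q) * mom ?n \<le> exp (2 * q) * (4 * C * C4 * (mt ?s - mt ?t))"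
      by (rule mult_left_mono) simp
    with mtn have "mt ?t \<le> exp (2 * q) * (4 * C * C4 * (mt ?s - mt ?t))" by (rule order_trans)
    then have "mt ?t \<le> exp (2 * q) * (4 * C * C4) * (mt ?s - mt ?t)" by (simp only: mult.assoc)
    then have "\<eta> * mt ?t \<le> \<eta> * (exp (2 * q) * (4 * C * C4) * (mt ?s - mt ?t))" using eta by (intro mult_left_mono) auto
    also have "\<dots> = mt ?s - mt ?t" using C C4 by (simp add: \<eta>_def)
    finally have "(1 + \<eta>) * mt ?t \<le> mt ?s" by (simp add: distrib_right)
    then show "(1 + \<eta>) * mt (1 - \<delta> / (4 * real k)) \<le> mt ?s" by simp
  qed
qed

end

section \<open>Moments of a radial weight\<close>

text \<open>Each of the m factors lies between n - m + 1 and n, and n / m <= n - m + 1 because (n -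
  m) (m - 1) >= 0. So the coefficient of the m-th derivative of z^n has size n^m.\<close>

lemma pochhammer_bounds:
  assumes m: "1 \<le> m" and n: "m \<le> n"
  shows "(real n / real m) ^ m \<le> pochhammer (real (Suc n - m)) m" "pochhammer (real (Suc n - m)) m \<le> real n ^ m"
proof -
  have "real n * (real m - 1) \<ge> real m * (real m - 1)" using m n by (intro mult_right_mono) auto
  then have low: "real n / real m \<le> real (Suc n - m)" using m n by (simp add: of_nat_diff field_simps)
  have "(\<Prod>i<m. real n / real m) \<le> (\<Prod>i<m. real (Suc n - m) + real i)"
    using low by (intro prod_mono) (auto intro: add_increasing2)
  then show "(real n / real m) ^ m \<le> pochhammer (real (Suc n - m)) m" by (simp add: pochhammer_prod atLeast0LessThan)
  have "(\<Prod>i<m. real (Suc n - m) + real i) \<le> (\<Prod>i<m. real n)"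
    using m n by (intro prod_mono) (auto simp: of_nat_diff)
  then show "pochhammer (real (Suc n - m)) m \<le> real n ^ m" by (simp add: pochhammer_prod atLeast0LessThan)
qed

lemma cmean_radial:
  assumes "0 \<le> r" "r < 1" and G: "\<And>z. norm z < 1 \<Longrightarrow> G z = \<phi> (norm z)" and p: "0 \<le> \<phi> r" and a: "norm a < 1"
  shows "cmean G r = ennreal (2 * pi) * ennreal (\<phi> r)" "cmean (\<lambda>z. G z * pk a z) r \<le> ennreal (2 * pi) * ennreal (\<phi> r)"
proof -
  have "cmean G r = circ (\<lambda>u. ennreal (\<phi> r))"
    unfolding cmean_def using assms by (intro circ_cong) (simp add: on_disk_def norm_mult)
  then show "cmean G r = ennreal (2 * pi) * ennreal (\<phi> r)" by simp
  note [measurable] = on_disk_measurable[OF continuous_on_pk[OF a]]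
  have "cmean (\<lambda>z. G z * pk a z) r = circ (\<lambda>u. ennreal (\<phi> r) * on_disk (pk a) (of_real r * u))"
    unfolding cmean_def using assms by (intro circ_cong) (simp add: on_disk_def norm_mult ennreal_mult')
  also have "\<dots> = ennreal (\<phi> r) * circ (\<lambda>u. on_disk (pk a) (of_real r * u))"
    by (rule circ_cmult) measurable
  also have "circ (\<lambda>u. on_disk (pk a) (of_real r * u)) = circ (\<lambda>u. ennreal (pk a (of_real r * u)))"
    using assms by (intro circ_cong) (simp add: on_disk_def norm_mult)
  also have "\<dots> \<le> ennreal (2 * pi)" by (rule circ_pk_le[OF a assms(1,2)])
  finally have "cmean (\<lambda>z. G z * pk a z) r \<le> ennreal (\<phi> r) * ennreal (2 * pi)"
    by (simp add: mult_left_mono)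
  then show "cmean (\<lambda>z. G z * pk a z) r \<le> ennreal (2 * pi) * ennreal (\<phi> r)"
    by (simp only: mult.commute)
qed

context radial_rep
begin

definition "radial_measure = density lborel (\<lambda>r. ennreal (w r * r) * indicator {0..<1} r)"

lemma sets_radial_measure [measurable_cong]: "sets radial_measure = sets borel"
  by (simp add: radial_measure_def)

lemma nn_integral_radial_measure:
  assumes [measurable]: "h \<in> borel_measurable borel"
  shows "(\<integral>\<^sup>+r. h r \<partial>radial_measure) = (\<integral>\<^sup>+r\<in>{0..<1}. ennreal (w r * r) * h r \<partial>lborel)"
  unfolding radial_measure_def by (subst nn_integral_density) (auto simp: mult_ac)

lemma finite_radial_measure: "finite_measure radial_measure"
proof
  have "emeasure radial_measure (space radial_measure) = (\<integral>\<^sup>+r. 1 \<partial>radial_measure)" by simp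
  also have "\<dots> = (\<integral>\<^sup>+r\<in>{0..<1}. ennreal (w r * r) \<partial>lborel)"
    by (subst nn_integral_radial_measure) auto
  also have "\<dots> \<le> (\<integral>\<^sup>+r\<in>{0..<1}. ennreal (w r) \<partial>lborel)"
    using w_nonneg by (intro nn_integral_mono) (auto simp: indicator_def mult_left_le intro!: ennreal_leI)
  also have "\<dots> = ennreal (T 0)" by (rule nn_integral_tail) auto
  finally show "emeasure radial_measure (space radial_measure) \<noteq> \<infinity>" by (auto simp: top_unique)
qed

lemma AE_radial_measure: "AE r in radial_measure. 0 < r \<and> r < 1"
  unfolding radial_measure_def
  by (subst AE_density) (auto simp: indicator_def zero_less_iff_neq_zero ennreal_eq_0_iff not_le zero_less_mult_iff w_nonneg not_less intro!: AE_I2)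

text \<open>For a function of the norm the kernel integrates out, as its circle means are at most 2
  pi, and this bounds all squares at once. The square of 0, which is the disk, gives the lower
  bound.\<close>

lemma carl_radial:
  assumes G: "continuous_on unit_disk G" "\<And>z. 0 \<le> G z" "\<And>z. norm z < 1 \<Longrightarrow> G z = \<phi> (norm z)"
    and p [measurable]: "\<phi> \<in> borel_measurable borel" and p0: "\<And>r. 0 \<le> \<phi> r"
  shows "carl w G \<le> ennreal (14 * pi) * (\<integral>\<^sup>+r. ennreal (\<phi> r) \<partial>radial_measure)"
    "(\<integral>\<^sup>+r. ennreal (\<phi> r) \<partial>radial_measure) \<le> carl w G"
proof -
  let ?I = "\<integral>\<^sup>+r. ennreal (\<phi> r) \<partial>radial_measure"
  have I: "?I = (\<integral>\<^sup>+r\<in>{0..<1}. ennreal (w r * r) * ennreal (\<phi> r) \<partial>lborel)"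
    by (rule nn_integral_radial_measure) measurable
  have "carl w G \<le> 7 * (ennreal (2 * pi) * ?I)"
  proof (rule carl_le_disk_int[OF G(1,2) w_meas w_nonneg])
    fix a :: complex assume a: "norm a < 1"
    have "disk_int w (\<lambda>z. G z * pk a z) \<le> (\<integral>\<^sup>+r. ennreal (2 * pi) * (ennreal (w r * r) * ennreal (\<phi> r) * indicator {0..<1} r) \<partial>lborel)"
      unfolding disk_int_def
    proof (rule nn_integral_mono)
      fix r :: real
      show "ennreal (w r * r) * cmean (\<lambda>z. G z * pk a z) r * indicator {0..<1} r \<le>
        ennreal (2 * pi) * (ennreal (w r * r) * ennreal (\<phi> r) * indicator {0..<1} r)"
      proof (cases "0 \<le> r \<and> r < 1")
        case True
        then have "ennreal (w r * r) * cmean (\<lambda>z. G z * pk a z) r \<le> ennreal (w r * r) * (ennreal (2 * pi) * ennreal (\<phi> r))"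
          using cmean_radial(2)[where G = G and \<phi> = \<phi>, OF _ _ G(3) p0 a] by (intro mult_left_mono) auto
        then show ?thesis using True by (simp add: mult_ac)
      qed simp
    qed
    also have "\<dots> = ennreal (2 * pi) * ?I" unfolding I by (rule nn_integral_cmult) measurable
    finally show "disk_int w (\<lambda>z. G z * pk a z) \<le> ennreal (2 * pi) * ?I" .
  qed
  also have "7 * (ennreal (2 * pi) * ?I) = ennreal (7 * (2 * pi)) * ?I"
    using ennreal_mult_assoc[of 7 "2 * pi" ?I] by simp
  finally show "carl w G \<le> ennreal (14 * pi) * ?I" by simp
  have "1 * ?I \<le> ennreal (2 * pi) * ?I" using pi_ge_two by (intro mult_right_mono) auto
  also have "ennreal (2 * pi) * ?I = disk_int w G"
    unfolding disk_int_def I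
    using cmean_radial(1)[where G = G and \<phi> = \<phi> and a = 0, OF _ _ G(3) p0]
    by (subst nn_integral_cmult[symmetric]) (auto intro!: nn_integral_cong simp: indicator_def mult_ac)
  also have "\<dots> = (\<integral>\<^sup>+z. on_disk G z * ennreal (w (norm z)) \<partial>lborel)"
    by (rule nn_integral_disk[OF G(1) w_meas w_nonneg, symmetric])
  also have "\<dots> = ennreal (1 / (1 - norm (0::complex))) * (\<integral>\<^sup>+z\<in>carleson_square 0. on_disk G z * ennreal (w (norm z)) \<partial>lborel)"
    by (auto intro!: nn_integral_cong simp: carleson_square_def indicator_def on_disk_def)
  also have "\<dots> \<le> carl w G" unfolding carl_def by (rule SUP_upper) simp
  finally show "?I \<le> carl w G" by simp
qed

lemma measure_radial_measure:
  assumes s: "0 \<le> s" "s < 1"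
  shows "s * T s \<le> measure radial_measure {s..}" "measure radial_measure {s..} \<le> T s"
proof -
  interpret finite_measure radial_measure by (rule finite_radial_measure)
  have e: "ennreal (measure radial_measure {s..}) = (\<integral>\<^sup>+r\<in>{s..<1}. ennreal (w r * r) \<partial>lborel)"
  proof -
    have "ennreal (measure radial_measure {s..}) = (\<integral>\<^sup>+r. indicator {s..} r \<partial>radial_measure)"
      by (subst nn_integral_indicator) (auto simp: emeasure_eq_measure sets_radial_measure)
    also have "\<dots> = (\<integral>\<^sup>+r\<in>{0..<1}. ennreal (w r * r) * indicator {s..} r \<partial>lborel)"
      by (rule nn_integral_radial_measure) measurable
    also have "\<dots> = (\<integral>\<^sup>+r\<in>{s..<1}. ennreal (w r * r) \<partial>lborel)"
      using s by (intro nn_integral_cong) (auto simp: indicator_def)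
    finally show ?thesis .
  qed
  have "(\<integral>\<^sup>+r\<in>{s..<1}. ennreal (w r * r) \<partial>lborel) \<le> (\<integral>\<^sup>+r\<in>{s..<1}. ennreal (w r) \<partial>lborel)"
    using w_nonneg s by (intro nn_integral_mono) (auto simp: indicator_def mult_left_le intro!: ennreal_leI)
  then show "measure radial_measure {s..} \<le> T s"
    unfolding nn_integral_tail[OF s] e[symmetric] using T_nonneg[OF s] by simp
  have "ennreal s * ennreal (T s) = (\<integral>\<^sup>+r. ennreal s * (ennreal (w r) * indicator {s..<1} r) \<partial>lborel)"
    unfolding nn_integral_tail[OF s, symmetric] by (rule nn_integral_cmult[symmetric]) measurable
  also have "\<dots> \<le> (\<integral>\<^sup>+r\<in>{s..<1}. ennreal (w r * r) \<partial>lborel)"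
  proof (rule nn_integral_mono)
    fix r :: real
    show "ennreal s * (ennreal (w r) * indicator {s..<1} r) \<le> ennreal (w r * r) * indicator {s..<1} r"
    proof (cases "r \<in> {s..<1}")
      case True
      then have "w r * s \<le> w r * r" using w_nonneg[of r] by (intro mult_left_mono) auto
      then have "ennreal (s * w r) \<le> ennreal (w r * r)" by (intro ennreal_leI) (simp add: mult.commute)
      then show ?thesis using True s w_nonneg[of r] by (simp add: ennreal_mult)
    qed simp
  qed
  finally have "ennreal (s * T s) \<le> ennreal (measure radial_measure {s..})"
    unfolding e using s T_nonneg[OF s] by (simp add: ennreal_mult)
  then show "s * T s \<le> measure radial_measure {s..}" by simp
qed

lemma measure_radial_measure_diff:
  assumes "0 \<le> s" "s \<le> t" "t < 1"
  shows "measure radial_measure {s..} - measure radial_measure {t..} \<le> T s - T t"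
proof -
  interpret finite_measure radial_measure by (rule finite_radial_measure)
  have "measure radial_measure {s..} - measure radial_measure {t..} = measure radial_measure ({s..} - {t..})"
    using assms by (intro finite_measure_Diff[symmetric]) (auto simp: sets_radial_measure)
  also have "{s..} - {t..} = {s..<t}" by auto
  also have "measure radial_measure {s..<t} \<le> T s - T t"
  proof -
    have "ennreal (measure radial_measure {s..<t}) = (\<integral>\<^sup>+r. indicator {s..<t} r \<partial>radial_measure)"
      by (subst nn_integral_indicator) (auto simp: emeasure_eq_measure sets_radial_measure)
    also have "\<dots> = (\<integral>\<^sup>+r\<in>{0..<1}. ennreal (w r * r) * indicator {s..<t} r \<partial>lborel)"
      by (rule nn_integral_radial_measure) measurable
    also have "\<dots> \<le> (\<integral>\<^sup>+r\<in>{s..<t}. ennreal (w r) \<partial>lborel)"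
      using assms w_nonneg by (intro nn_integral_mono) (auto simp: indicator_def mult_left_le intro!: ennreal_leI)
    also have "\<dots> = ennreal (T s - T t)" by (rule nn_integral_w_Ico'[OF assms])
    finally show ?thesis using T_antimono[OF assms] by simp
  qed
  finally show ?thesis .
qed

text \<open>The moment estimates concern large n only and radii given by integers. Monotonicity of
  the tails fills the gaps between these radii, and small radii are covered by enlarging the
  constants. \<open>mt\<close> and \<open>T\<close> differ by the polar factor r, which is at least
  1/2 near the boundary.\<close>

lemma moment_measure_D_class:
  assumes "moment_measure radial_measure q b C m"
  shows "\<omega> \<in> D_class"
proof -
  interpret moment_measure radial_measure q b C m by (rule assms)
  have mt: "s * T s \<le> mt s" "mt s \<le> T s" if "0 \<le> s" "s < 1" for s
    using measure_radial_measure[OF that] by (auto simp: mt_def)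
  have half: "T s \<le> 2 * mt s" if "1/2 \<le> s" "s < 1" for s
    using mt(1)[of s] that mult_right_mono[of "1/2" s "T s"] T_nonneg[of s] by auto
  have "\<exists>C\<ge>1. \<forall>r. 0 \<le> r \<longrightarrow> r < 1 \<longrightarrow> T r \<le> C * T ((1 + r)/2)"
  proof -
    obtain n0 D where n0: "1 \<le> n0" "0 < D" "\<And>n. n0 \<le> n \<Longrightarrow> mt (1 - 1 / real n) \<le> D * mt (1 - 1 / (4 * real n))"
      "\<And>n. n0 \<le> n \<Longrightarrow> 0 < mt (1 - 1 / (4 * real n))"
      using mt_doubling by blast
    define N where "N = n0 + 2"
    define r0 where "r0 = 1 - 1 / real N"
    have N: "2 \<le> N" "n0 \<le> N" by (auto simp: N_def)
    have r0: "0 \<le> r0" "r0 < 1" using N by (auto simp: r0_def)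
    define t0 where "t0 = (1 + r0)/2"
    have t0: "0 \<le> t0" "t0 < 1" using r0 by (auto simp: t0_def)
    have T0: "0 < T t0"
    proof -
      have "0 < mt (1 - 1 / (4 * real N))" by (rule n0(4)[OF N(2)])
      also have "\<dots> \<le> T (1 - 1 / (4 * real N))" using N by (intro mt) (auto simp: field_simps)
      also have "\<dots> \<le> T t0" using N t0 by (intro T_antimono) (auto simp: t0_def r0_def field_simps)
      finally show ?thesis .
    qed
    \<comment> \<open>The first entry serves r > r0, the second r <= r0, where T r <= T 0 and T ((1
      + r)/2) >= T t0.\<close>
    define Cc where "Cc = max (2 * D) (T 0 / T t0) + 1"
    show ?thesis
    proof (intro exI[of _ Cc] conjI allI impI)
      show "1 \<le> Cc" using n0(2) by (simp add: Cc_def le_max_iff_disj)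
      fix r :: real assume r: "0 \<le> r" "r < 1"
      have r2: "0 \<le> (1 + r)/2" "(1 + r)/2 < 1" using r by auto
      have Tn: "0 \<le> T ((1 + r)/2)" by (rule T_nonneg[OF r2])
      show "T r \<le> Cc * T ((1 + r)/2)"
      proof (cases "r \<le> r0")
        case True
        have "T r \<le> T 0" using r by (intro T_antimono) auto
        also have "\<dots> = T 0 / T t0 * T t0" using T0 by simp
        also have "\<dots> \<le> T 0 / T t0 * T ((1 + r)/2)"
          using True r r2 t0 T0 T_nonneg[of 0] by (intro mult_left_mono T_antimono) (auto simp: t0_def)
        also have "\<dots> \<le> Cc * T ((1 + r)/2)" by (intro mult_right_mono Tn) (simp add: Cc_def)
        finally show ?thesis .
      next
        case False
        \<comment> \<open>This choice gives 1 / (2 n) <= 1 - r <= 1 / n.\<close>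
        define n where "n = nat \<lfloor>1 / (1 - r)\<rfloor>"
        have x: "real N < 1 / (1 - r)" using False r N by (simp add: r0_def field_simps)
        have n: "real n \<le> 1 / (1 - r)" "1 / (1 - r) < real n + 1" "N \<le> n"
        proof -
          have "0 \<le> \<lfloor>1 / (1 - r)\<rfloor>" using r by simp
          then have "real n = of_int \<lfloor>1 / (1 - r)\<rfloor>" by (simp add: n_def)
          then show "real n \<le> 1 / (1 - r)" "1 / (1 - r) < real n + 1" by linarith+
          with x have "real N < real n + 1" by linarith
          then show "N \<le> n" by linarith
        qed
        have n': "n0 \<le> n" "2 \<le> n" using n(3) N by auto
        have r1: "1 - 1 / real n \<le> r" using n(1) r n' by (simp add: field_simps)
        have "1 \<le> (1 - r) * (real n + 1)" using n(2) r by (simp add: field_simps)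
        also have "\<dots> \<le> (1 - r) * (2 * real n)" using r n' by (intro mult_left_mono) auto
        finally have r3: "(1 + r)/2 \<le> 1 - 1 / (4 * real n)" using n' by (simp add: field_simps)
        have n'': "0 \<le> 1 - 1 / real n" "1/2 \<le> 1 - 1 / real n" "1 - 1 / real n < 1" "0 \<le> 1 - 1 / (4 * real n)" "1 - 1 / (4 * real n) < 1"
          using n' by (auto simp: field_simps)
        have "T r \<le> T (1 - 1 / real n)" using r r1 n'' by (intro T_antimono) auto
        also have "\<dots> \<le> 2 * mt (1 - 1 / real n)" using n'' by (intro half) auto
        also have "\<dots> \<le> 2 * (D * mt (1 - 1 / (4 * real n)))" by (intro mult_left_mono n0(3) n') auto
        also have "\<dots> \<le> 2 * (D * T (1 - 1 / (4 * real n)))" using n0(2) n'' by (intro mult_left_mono mt) auto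
        also have "\<dots> \<le> 2 * (D * T ((1 + r)/2))" using n0(2) r2 r3 n'' by (intro mult_left_mono T_antimono) auto
        also have "\<dots> = (2 * D) * T ((1 + r)/2)" by simp
        also have "\<dots> \<le> Cc * T ((1 + r)/2)" by (intro mult_right_mono Tn) (simp add: Cc_def)
        finally show ?thesis .
      qed
    qed
  qed
  then have "\<omega> \<in> D_hat" by (simp add: D_hat_iff)
  have "\<exists>K>1. \<exists>C>1. \<forall>r. 0 \<le> r \<longrightarrow> r < 1 \<longrightarrow> C * T (1 - (1 - r)/K) \<le> T r"
  proof -
    obtain k0 and L' :: nat and \<delta> \<eta> where g: "0 < k0" "1 \<le> L'" "0 < \<delta>" "\<delta> \<le> 1" "0 < \<eta>"
      "\<And>k. k0 \<le> k \<Longrightarrow> (1 + \<eta>) * mt (1 - \<delta> / (4 * real k)) \<le> mt (1 - real L' / real k)"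
      using mt_gap by blast
    \<comment> \<open>The gap passes from \<open>mt\<close> to \<open>T\<close> by comparing
      differences; bounding \<open>T ?t\<close> by \<open>2 * mt ?t\<close> is what halves
      \<open>\<eta>\<close>.\<close>
    have gap: "(1 + \<eta>/2) * T (1 - \<delta> / (4 * real k)) \<le> T (1 - real L' / real k)" if k: "k0 \<le> k" "L' \<le> k" for k
    proof -
      let ?s = "1 - real L' / real k" and ?t = "1 - \<delta> / (4 * real k)"
      have k1: "1 \<le> real k" "0 < real k" using k g by auto
      have st: "0 \<le> ?s" "?s \<le> ?t" "?t < 1" "1/2 \<le> ?t"
      proof -
        show "0 \<le> ?s" using k k1 by simp
        show "?s \<le> ?t" using g k1 by (simp add: field_simps)
        show "?t < 1" using g k1 by simp
        show "1/2 \<le> ?t" using g k1 by (simp add: field_simps)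
      qed
      have "\<eta>/2 * T ?t \<le> \<eta>/2 * (2 * mt ?t)" using g st by (intro mult_left_mono half) auto
      also have "\<dots> \<le> mt ?s - mt ?t" using g(6)[OF k(1)] by (simp add: distrib_right)
      also have "\<dots> \<le> T ?s - T ?t" unfolding mt_def using st by (intro measure_radial_measure_diff) auto
      finally show ?thesis by (simp add: distrib_right)
    qed
    define k1 where "k1 = k0 + L'"
    define r0 where "r0 = 1 - real L' / real k1"
    have k1: "0 < real k1" "real L' < real k1" using g by (auto simp: k1_def)
    have r0: "0 \<le> r0" "r0 < 1" using k1 g by (auto simp: r0_def)
    \<comment> \<open>Rounding L' / (1 - r) up to k gives k <= 2 L' / (1 - r), so that
      \<open>\<delta> / (4 * real k)\<close> is at least (1 - r) / K1.\<close>
    define K1 where "K1 = 8 * real L' / \<delta>"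
    have K1: "1 < K1"
    proof -
      have "1 \<le> real L'" using g(2) by simp
      then have "\<delta> < 8 * real L'" using g(4) by linarith
      then show ?thesis using g by (simp add: K1_def)
    qed
    have near: "(1 + \<eta>/2) * T (1 - (1 - r)/K1) \<le> T r" if r: "r0 \<le> r" "r < 1" for r
    proof -
      define k where "k = nat \<lceil>real L' / (1 - r)\<rceil>"
      have k: "real L' / (1 - r) \<le> real k" "real k < real L' / (1 - r) + 1" "k1 \<le> k"
      proof -
        have pos: "0 < real L' / (1 - r)" using g r by simp
        then have "real k = of_int \<lceil>real L' / (1 - r)\<rceil>" by (simp add: k_def)
        then show 1: "real L' / (1 - r) \<le> real k" and "real k < real L' / (1 - r) + 1" by linarith+
        have "real k1 \<le> real L' / (1 - r)" using r k1 by (simp add: r0_def field_simps)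
        with 1 show "k1 \<le> k" by linarith
      qed
      have k0: "k0 \<le> k" "L' \<le> k" "0 < real k" using k(3) k1 by (auto simp: k1_def)
      have rs: "r \<le> 1 - real L' / real k" using k(1) k0 r by (simp add: field_simps)
      have "1 \<le> real L' / (1 - r)" using g r r0 by (simp add: field_simps)
      then have "real k \<le> 2 * real L' / (1 - r)" using k(2) by simp
      then have "\<delta> * (real k * (1 - r)) \<le> \<delta> * (2 * real L')" using r g by (intro mult_left_mono) (auto simp: field_simps)
      then have tt: "1 - \<delta> / (4 * real k) \<le> 1 - (1 - r)/K1"
        using k0 g by (simp add: K1_def field_simps)
      have t: "0 \<le> 1 - \<delta> / (4 * real k)" "1 - (1 - r)/K1 < 1" using g k0 r K1 by (auto simp: field_simps)
      have "(1 + \<eta>/2) * T (1 - (1 - r)/K1) \<le> (1 + \<eta>/2) * T (1 - \<delta> / (4 * real k))"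
        using tt t g by (intro mult_left_mono T_antimono) auto
      also have "\<dots> \<le> T (1 - real L' / real k)" by (rule gap[OF k0(1,2)])
      also have "\<dots> \<le> T r" using rs r r0 g k0 by (intro T_antimono) auto
      finally show ?thesis .
    qed
    \<comment> \<open>For r below r0 the estimate at r0 is used; with this K, (1 - r) / K <= 1 / K =
      (1 - r0) / K1.\<close>
    define K where "K = K1 / (1 - r0)"
    have KK: "K1 \<le> K" using K1 r0 by (simp add: K_def field_simps)
    have "1 < K" "1 < 1 + \<eta>/2" using K1 KK g by auto
    moreover have "\<forall>r. 0 \<le> r \<longrightarrow> r < 1 \<longrightarrow> (1 + \<eta>/2) * T (1 - (1 - r)/K) \<le> T r"
    proof (intro allI impI)
      fix r :: real assume r: "0 \<le> r" "r < 1"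
      have Kr: "0 < (1 - r)/K" using K1 KK r by simp
      define r' where "r' = max r r0"
      have r': "r0 \<le> r'" "r' < 1" "r \<le> r'" using r r0 by (auto simp: r'_def)
      have "(1 - r)/K \<le> (1 - r')/K1"
      proof (cases "r \<le> r0")
        case True
        have "(1 - r)/K \<le> 1 / K" using r K1 KK by (intro divide_right_mono) auto
        then show ?thesis using True K1 r0 by (simp add: r'_def K_def max_def)
      next
        case False
        then have "r' = r" by (simp add: r'_def)
        then show ?thesis using r K1 KK by (auto intro!: divide_left_mono)
      qed
      moreover have "0 \<le> 1 - (1 - r')/K1"
      proof -
        have "(1 - r') * 1 \<le> (1 - r') * K1" using K1 r' by (intro mult_left_mono) auto
        then have "(1 - r') / K1 \<le> 1 - r'" using K1 by (simp add: divide_le_eq)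
        then show ?thesis using r' r0 by linarith
      qed
      ultimately have "(1 + \<eta>/2) * T (1 - (1 - r)/K) \<le> (1 + \<eta>/2) * T (1 - (1 - r')/K1)"
        using Kr g(5) by (intro mult_left_mono T_antimono) auto
      also have "\<dots> \<le> T r'" using r' by (intro near)
      also have "\<dots> \<le> T r" using r r' by (intro T_antimono)
      finally show "(1 + \<eta>/2) * T (1 - (1 - r)/K) \<le> T r" .
    qed
    ultimately show ?thesis by blast
  qed
  then have "\<omega> \<in> D_check" by (simp add: D_check_iff)
  with \<open>\<omega> \<in> D_hat\<close> show ?thesis by (simp add: D_class_def)
qed

end

section \<open>Necessity: testing on monomials\<close>

context radial_rep
begin

lemma radial_measure_nontrivial: "emeasure radial_measure (space radial_measure) \<noteq> 0"
proof
  assume zero: "emeasure radial_measure (space radial_measure) = 0"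
  have "(\<integral>\<^sup>+r\<in>{0..<1}. ennreal (w r * r) * 1 \<partial>lborel) = (\<integral>\<^sup>+r. 1 \<partial>radial_measure)"
    by (rule nn_integral_radial_measure[symmetric]) simp
  also have "\<dots> = 0" by (subst nn_integral_const) (simp only: zero mult_zero_right)
  finally have "(\<integral>\<^sup>+r\<in>{0..<1}. ennreal (w r * r) \<partial>lborel) = 0" by simp
  then have "AE r in lborel. ennreal (w r * r) * indicator {0..<1} r = 0"
    by (subst (asm) nn_integral_0_iff_AE) auto
  moreover have "AE r in lborel. r \<noteq> (0::real)" by (rule AE_lborel_singleton)
  ultimately have "AE r in lborel. ennreal (w r) * indicator {0..<1} r = 0"
  proof eventually_elim
    case (elim r)
    show ?case
    proof (cases "r \<in> {0..<1}")
      case True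
      then have "w r * r \<le> 0" "0 < r" using elim by (auto simp: ennreal_eq_0_iff)
      then have "w r \<le> 0" by (simp add: mult_le_0_iff)
      then show ?thesis by (simp add: ennreal_eq_0_iff)
    qed simp
  qed
  then have "(\<integral>\<^sup>+r\<in>{0..<1}. ennreal (w r) \<partial>lborel) = 0" by (subst nn_integral_0_iff_AE) auto
  then have "ennreal (T 0) = 0" using nn_integral_tail[of 0] by simp
  then show False using T0_pos by (simp add: ennreal_eq_0_iff)
qed

text \<open>Both z^n and its weighted derivative have moduli depending on |z| only, so
  \<open>carl_radial\<close> reduces their norms to moments. As m <= n, the derivatives at 0 of
  order below m vanish.\<close>

lemma monomial_norms:
  assumes q: "0 < q" and m: "1 \<le> m" and n: "m \<le> n"
  defines "f \<equiv> \<lambda>z::complex. z ^ n"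
  shows "(\<integral>\<^sup>+r. ennreal (r powr (real n * q)) \<partial>radial_measure) \<le> carl w (\<lambda>z. norm (f z) powr q)"
    "carl w (\<lambda>z. norm (f z) powr q) \<le> ennreal (14 * pi) * (\<integral>\<^sup>+r. ennreal (r powr (real n * q)) \<partial>radial_measure)"
    "(\<integral>\<^sup>+r. ennreal (pochhammer (real (Suc n - m)) m powr q * ((1 - r) powr (m * q) * r powr (real (n - m) * q))) \<partial>radial_measure)
      \<le> carl w (\<lambda>z. norm (weighted_deriv m f z) powr q)"
    "carl w (\<lambda>z. norm (weighted_deriv m f z) powr q) \<le> ennreal (14 * pi) *
      (\<integral>\<^sup>+r. ennreal (pochhammer (real (Suc n - m)) m powr q * ((1 - r) powr (m * q) * r powr (real (n - m) * q))) \<partial>radial_measure)"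
    "j < m \<Longrightarrow> (deriv ^^ j) f 0 = 0"
proof -
  have f: "f holomorphic_on unit_disk" unfolding f_def by (intro holomorphic_intros)
  have deriv: "(deriv ^^ j) f z = pochhammer (of_nat (Suc n - j)) j * z ^ (n - j)" for j z
    using higher_deriv_power[of j 0 n z] by (simp add: f_def)
  show "j < m \<Longrightarrow> (deriv ^^ j) f 0 = 0" using n by (simp add: deriv)
  have G1: "continuous_on unit_disk (\<lambda>z. norm (f z) powr q)" by (rule continuous_on_norm_powr[OF f q])
  have eq1: "norm (f z) powr q = norm z powr (real n * q)" for z
  proof (cases "z = 0")
    case True then show ?thesis using m n q by (simp add: f_def)
  next
    case False then show ?thesis by (simp add: f_def norm_power powr_realpow[symmetric] powr_powr)
  qed
  show "(\<integral>\<^sup>+r. ennreal (r powr (real n * q)) \<partial>radial_measure) \<le> carl w (\<lambda>z. norm (f z) powr q)"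
    "carl w (\<lambda>z. norm (f z) powr q) \<le> ennreal (14 * pi) * (\<integral>\<^sup>+r. ennreal (r powr (real n * q)) \<partial>radial_measure)"
    using carl_radial[OF G1 _ eq1] by auto
  define p where "p = pochhammer (real (Suc n - m)) m"
  have p: "0 \<le> p" unfolding p_def by (rule pochhammer_nonneg) (use n in auto)
  have G2: "continuous_on unit_disk (\<lambda>z. norm (weighted_deriv m f z) powr q)"
    using q continuous_on_weighted_deriv[OF f, of m]
    by (intro continuous_on_powr' continuous_on_norm continuous_on_const) auto
  define \<phi> where "\<phi> r = \<bar>p * r ^ (n - m) * (1 - r) ^ m\<bar> powr q" for r
  have [measurable]: "\<phi> \<in> borel_measurable borel" unfolding \<phi>_def[abs_def] by measurable
  have eq2: "norm (weighted_deriv m f z) powr q = \<phi> (norm z)" if "norm z < 1" for z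
  proof -
    have "(pochhammer (of_nat (Suc n - m)) m :: complex) = of_real p"
      unfolding p_def by (simp add: pochhammer_of_real[symmetric])
    then have "norm (weighted_deriv m f z) = \<bar>p * norm z ^ (n - m) * (1 - norm z) ^ m\<bar>"
      unfolding weighted_deriv_def deriv by (simp only: norm_mult norm_of_real norm_power) (simp add: abs_mult)
    then show ?thesis by (simp add: \<phi>_def)
  qed
  have int: "(\<integral>\<^sup>+r. ennreal (\<phi> r) \<partial>radial_measure) =
    (\<integral>\<^sup>+r. ennreal (p powr q * ((1 - r) powr (m * q) * r powr (real (n - m) * q))) \<partial>radial_measure)"
  proof (rule nn_integral_cong_AE)
    show "AE r in radial_measure. ennreal (\<phi> r) = ennreal (p powr q * ((1 - r) powr (m * q) * r powr (real (n - m) * q)))"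
      using AE_radial_measure
    proof eventually_elim
      case (elim r)
      then have "\<phi> r = (p * r ^ (n - m) * (1 - r) ^ m) powr q" using p by (simp add: \<phi>_def)
      also have "\<dots> = p powr q * ((1 - r) powr (m * q) * r powr (real (n - m) * q))"
        using elim by (simp add: powr_mult powr_realpow[symmetric] powr_powr)
      finally show ?case by simp
    qed
  qed
  have "(\<integral>\<^sup>+r. ennreal (\<phi> r) \<partial>radial_measure) \<le> carl w (\<lambda>z. norm (weighted_deriv m f z) powr q)"
    "carl w (\<lambda>z. norm (weighted_deriv m f z) powr q) \<le> ennreal (14 * pi) * (\<integral>\<^sup>+r. ennreal (\<phi> r) \<partial>radial_measure)"
    using carl_radial[OF G2 _ eq2] by (auto simp: \<phi>_def)
  then show "(\<integral>\<^sup>+r. ennreal (pochhammer (real (Suc n - m)) m powr q * ((1 - r) powr (m * q) * r powr (real (n - m) * q))) \<partial>radial_measure)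
      \<le> carl w (\<lambda>z. norm (weighted_deriv m f z) powr q)"
    "carl w (\<lambda>z. norm (weighted_deriv m f z) powr q) \<le> ennreal (14 * pi) *
      (\<integral>\<^sup>+r. ennreal (pochhammer (real (Suc n - m)) m powr q * ((1 - r) powr (m * q) * r powr (real (n - m) * q))) \<partial>radial_measure)"
    unfolding int p_def by auto
qed

lemma holomorphic_measurable_disk:
  "f holomorphic_on unit_disk \<Longrightarrow> f \<in> borel_measurable (lebesgue_on unit_disk)"
  by (intro continuous_imp_measurable_on_sets_lebesgue holomorphic_on_imp_continuous_on) auto

lemma weighted_deriv_measurable_disk:
  "f holomorphic_on unit_disk \<Longrightarrow> weighted_deriv m f \<in> borel_measurable (lebesgue_on unit_disk)"
  by (intro continuous_imp_measurable_on_sets_lebesgue continuous_on_weighted_deriv) auto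

theorem D_class_necessary:
  assumes q: "0 < q" and m: "1 \<le> m" and C: "0 < C"
    and equiv: "\<And>f. f \<in> analytic_tent_space q \<omega> \<Longrightarrow>
      ennreal (inverse C) * tent_norm q \<omega> f \<le> ennreal (\<Sum>j<m. norm ((deriv ^^ j) f 0)) + tent_norm q \<omega> (weighted_deriv m f) \<and>
      ennreal (\<Sum>j<m. norm ((deriv ^^ j) f 0)) + tent_norm q \<omega> (weighted_deriv m f) \<le> ennreal C * tent_norm q \<omega> f"
  shows "\<omega> \<in> D_class"
proof -
  interpret finite_measure radial_measure by (rule finite_radial_measure)
  \<comment> \<open>C enters with the power q because the moments are q-th powers of norms; 14 pi is
    the constant of \<open>carl_radial\<close>.\<close>
  define D where "D = C powr q * (14 * pi)"
  have D: "0 < D" using C by (simp add: D_def)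
  define p where "p n = pochhammer (real (Suc n - m)) m" for n
  define \<psi> where "\<psi> n r = (1 - r) powr (m * q) * r powr (real (n - m) * q)" for n r
  define \<phi> where "\<phi> n r = r powr (real n * q)" for n r
  have [measurable]: "\<psi> n \<in> borel_measurable borel" "\<phi> n \<in> borel_measurable borel" for n
    unfolding \<psi>_def[abs_def] \<phi>_def[abs_def] by measurable
  have int: "integrable radial_measure g" if [measurable]: "g \<in> borel_measurable borel"
    and "\<And>r. 0 < r \<Longrightarrow> r < 1 \<Longrightarrow> 0 \<le> g r \<and> g r \<le> 1" for g :: "real \<Rightarrow> real"
  proof (rule integrable_const_bound[where B = 1])
    show "AE x in radial_measure. norm (g x) \<le> 1"
      using AE_radial_measure by eventually_elim (use that(2) in auto)
    show "g \<in> borel_measurable radial_measure" using that(1) by (simp cong: measurable_cong_sets add: sets_radial_measure)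
  qed
  have pw: "0 \<le> r powr x \<and> r powr x \<le> 1" if "0 < r" "r < 1" "0 \<le> x" for r x :: real
    using that by (auto intro: powr_le1)
  have int\<phi>: "integrable radial_measure (\<phi> n)" for n
    unfolding \<phi>_def using pw q by (intro int) auto
  have int\<psi>: "integrable radial_measure (\<psi> n)" for n
    unfolding \<psi>_def using pw q by (intro int) (auto intro!: mult_le_one)
  have main: "integral\<^sup>L radial_measure (\<phi> n) \<le> D * (p n powr q * integral\<^sup>L radial_measure (\<psi> n))"
    "p n powr q * integral\<^sup>L radial_measure (\<psi> n) \<le> D * integral\<^sup>L radial_measure (\<phi> n)" if n: "m \<le> n" for n
  proof -
    define f where "f z = z ^ n" for z :: complex
    have f: "f holomorphic_on unit_disk" unfolding f_def[abs_def] by (intro holomorphic_intros)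
    define N where "N = carl w (\<lambda>z. norm (f z) powr q)"
    define Nm where "Nm = carl w (\<lambda>z. norm (weighted_deriv m f z) powr q)"
    have tf: "tent_norm q \<omega> f = ennreal_powr N (1/q)" unfolding N_def by (rule tent_norm_holomorphic[OF q f])
    have tw: "tent_norm q \<omega> (weighted_deriv m f) = ennreal_powr Nm (1/q)"
      unfolding Nm_def by (rule tent_norm_eq[OF q continuous_on_weighted_deriv[OF f]])
    have A: "(\<integral>\<^sup>+r. ennreal (\<phi> n r) \<partial>radial_measure) = ennreal (integral\<^sup>L radial_measure (\<phi> n))"
      by (rule nn_integral_eq_integral[OF int\<phi>]) (simp add: \<phi>_def)
    have B: "(\<integral>\<^sup>+r. ennreal (p n powr q * \<psi> n r) \<partial>radial_measure) = ennreal (p n powr q * integral\<^sup>L radial_measure (\<psi> n))"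
    proof -
      have "(\<integral>\<^sup>+r. ennreal (p n powr q * \<psi> n r) \<partial>radial_measure) = ennreal (\<integral>r. p n powr q * \<psi> n r \<partial>radial_measure)"
      proof (rule nn_integral_eq_integral)
        show "integrable radial_measure (\<lambda>r. p n powr q * \<psi> n r)" using int\<psi>[of n] by simp
        show "AE r in radial_measure. 0 \<le> p n powr q * \<psi> n r" by (simp add: \<psi>_def)
      qed
      then show ?thesis by simp
    qed
    have fz: "(\<lambda>z. z ^ n) = f" by (simp add: f_def fun_eq_iff)
    have N': "carl w (\<lambda>z. norm (z ^ n) powr q) = N" by (simp add: N_def f_def)
    note mono = monomial_norms[OF q m n, unfolded fz N', folded Nm_def p_def \<psi>_def \<phi>_def, unfolded A B]
    \<comment> \<open>The assumed equivalence speaks about members of the space only, so finiteness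
      of the norm comes first.\<close>
    have "N < top" by (rule le_less_trans[OF mono(2)]) (simp add: ennreal_mult_less_top)
    then have "f \<in> analytic_tent_space q \<omega>"
      using f holomorphic_measurable_disk[OF f] by (simp add: analytic_tent_space_def tent_space_def tf ennreal_powr_finite)
    from equiv[OF this] have e: "ennreal (inverse C) * ennreal_powr N (1/q) \<le> ennreal_powr Nm (1/q)"
      "ennreal_powr Nm (1/q) \<le> ennreal C * ennreal_powr N (1/q)"
      unfolding tf tw using mono(5) by auto
    have root: "X \<le> ennreal (C powr q) * Y" if "ennreal_powr X (1/q) \<le> ennreal C * ennreal_powr Y (1/q)" for X Y
    proof -
      have "ennreal_powr (ennreal_powr X (1/q)) q \<le> ennreal_powr (ennreal C * ennreal_powr Y (1/q)) q"
        by (intro ennreal_powr_mono q that)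
      then show ?thesis using q C by (simp add: ennreal_powr_mult ennreal_powr_inverse)
    qed
    have "ennreal C * (ennreal (inverse C) * ennreal_powr N (1/q)) \<le> ennreal C * ennreal_powr Nm (1/q)"
      by (intro mult_left_mono e) simp
    then have "ennreal_powr N (1/q) \<le> ennreal C * ennreal_powr Nm (1/q)"
      using C by (simp add: ennreal_mult_assoc)
    from root[OF this] have NNm: "N \<le> ennreal (C powr q) * Nm" .
    have NmN: "Nm \<le> ennreal (C powr q) * N" by (rule root[OF e(2)])
    have "ennreal (integral\<^sup>L radial_measure (\<phi> n)) \<le> ennreal (C powr q) * (ennreal (14 * pi) * ennreal (p n powr q * integral\<^sup>L radial_measure (\<psi> n)))"
      by (rule order_trans[OF mono(1) order_trans[OF NNm mult_left_mono[OF mono(4)]]]) simp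
    also have "\<dots> = ennreal (D * (p n powr q * integral\<^sup>L radial_measure (\<psi> n)))"
      unfolding D_def by (subst ennreal_mult_assoc) (simp_all add: ennreal_mult'[symmetric])
    finally show "integral\<^sup>L radial_measure (\<phi> n) \<le> D * (p n powr q * integral\<^sup>L radial_measure (\<psi> n))"
    proof (subst (asm) ennreal_le_iff)
      show "0 \<le> D * (p n powr q * integral\<^sup>L radial_measure (\<psi> n))"
        using D by (intro mult_nonneg_nonneg integral_nonneg_AE AE_I2) (auto simp: \<psi>_def)
    qed
    have "ennreal (p n powr q * integral\<^sup>L radial_measure (\<psi> n)) \<le> ennreal (C powr q) * (ennreal (14 * pi) * ennreal (integral\<^sup>L radial_measure (\<phi> n)))"
      by (rule order_trans[OF mono(3) order_trans[OF NmN mult_left_mono[OF mono(2)]]]) simp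
    also have "\<dots> = ennreal (D * integral\<^sup>L radial_measure (\<phi> n))"
      unfolding D_def by (subst ennreal_mult_assoc) (simp_all add: ennreal_mult'[symmetric])
    finally show "p n powr q * integral\<^sup>L radial_measure (\<psi> n) \<le> D * integral\<^sup>L radial_measure (\<phi> n)"
    proof (subst (asm) ennreal_le_iff)
      show "0 \<le> D * integral\<^sup>L radial_measure (\<phi> n)"
        using D by (intro mult_nonneg_nonneg integral_nonneg_AE AE_I2) (auto simp: \<phi>_def)
    qed
  qed
  \<comment> \<open>The loss in (n / m)^m as a lower bound for the coefficient, raised to the power
    q.\<close>
  define mm where "mm = real m powr (m * q)"
  have mm: "1 \<le> mm" unfolding mm_def using m q by (intro ge_one_powr_ge_zero) auto
  have p_le: "p n powr q \<le> real n powr (m * q)" "real n powr (m * q) \<le> mm * p n powr q" if n: "m \<le> n" for n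
  proof -
    have n0: "0 < real n" "0 < real m" using m n by auto
    have p0: "0 \<le> (real n / real m) ^ m" by simp
    have "p n powr q \<le> (real n ^ m) powr q"
      using pochhammer_bounds[OF m n] p0 q unfolding p_def by (intro powr_mono2) linarith+
    also have "\<dots> = real n powr (m * q)" using n0 by (simp add: powr_realpow[symmetric] powr_powr)
    finally show "p n powr q \<le> real n powr (m * q)" .
    have "((real n / real m) ^ m) powr q \<le> p n powr q"
      using pochhammer_bounds[OF m n] q unfolding p_def by (intro powr_mono2) auto
    also have "((real n / real m) ^ m) powr q = real n powr (m * q) / mm"
      unfolding mm_def using n0 by (simp add: powr_realpow[symmetric] powr_powr powr_divide)
    finally show "real n powr (m * q) \<le> mm * p n powr q" using mm by (simp add: field_simps)
  qed
  have split: "(real n * (1 - r)) powr (m * q) * y = real n powr (m * q) * ((1 - r) powr (m * q) * y)" for n r y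
    by (simp add: powr_mult)
  have "moment_measure radial_measure q (m * q) (D * mm) m"
  proof
    show "sets radial_measure = sets borel" by (rule sets_radial_measure)
    show "AE r in radial_measure. 0 < r \<and> r < 1" by (rule AE_radial_measure)
    show "0 < q" "0 < m * q" "0 < D * mm" "1 \<le> m" using q m D mm by auto
    show "emeasure radial_measure (space radial_measure) \<noteq> 0" by (rule radial_measure_nontrivial)
    fix n assume n: "m \<le> n"
    have I0: "0 \<le> integral\<^sup>L radial_measure (\<psi> n)" by (intro integral_nonneg_AE AE_I2) (auto simp: \<psi>_def)
    have "(\<integral>r. (real n * (1 - r)) powr (m * q) * r powr (real n * q) \<partial>radial_measure) \<le> (\<integral>r. real n powr (m * q) * \<psi> n r \<partial>radial_measure)"
    proof (rule integral_mono_AE)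
      show "integrable radial_measure (\<lambda>r. real n powr (m * q) * \<psi> n r)" using int\<psi> by simp
      have "integrable radial_measure (\<lambda>r. (1 - r) powr (m * q) * r powr (real n * q))"
        using pw q by (intro int) (auto intro!: mult_le_one)
      then show "integrable radial_measure (\<lambda>r. (real n * (1 - r)) powr (m * q) * r powr (real n * q))"
        unfolding split by simp
      show "AE r in radial_measure. (real n * (1 - r)) powr (m * q) * r powr (real n * q) \<le> real n powr (m * q) * \<psi> n r"
        using AE_radial_measure
      proof eventually_elim
        case (elim r)
        have "r powr (real n * q) \<le> r powr (real (n - m) * q)"
          using elim q by (intro powr_mono') auto
        then show ?case unfolding split \<psi>_def by (intro mult_left_mono) auto
      qed
    qed
    also have "\<dots> = real n powr (m * q) * integral\<^sup>L radial_measure (\<psi> n)" by simp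
    also have "\<dots> \<le> (mm * p n powr q) * integral\<^sup>L radial_measure (\<psi> n)"
      by (intro mult_right_mono p_le n I0)
    also have "\<dots> \<le> mm * (D * integral\<^sup>L radial_measure (\<phi> n))"
      unfolding mult.assoc using mm by (intro mult_left_mono main n) auto
    finally show "(\<integral>r. (real n * (1 - r)) powr (m * q) * r powr (real n * q) \<partial>radial_measure) \<le> D * mm * (\<integral>r. r powr (real n * q) \<partial>radial_measure)"
      unfolding \<phi>_def by (simp add: mult_ac)
    have "integral\<^sup>L radial_measure (\<phi> n) \<le> D * (p n powr q * integral\<^sup>L radial_measure (\<psi> n))" by (rule main[OF n])
    also have "\<dots> \<le> D * (real n powr (m * q) * integral\<^sup>L radial_measure (\<psi> n))"
      using D by (intro mult_left_mono mult_right_mono p_le n I0) auto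
    also have "\<dots> \<le> (D * mm) * (real n powr (m * q) * integral\<^sup>L radial_measure (\<psi> n))"
      using D mm I0 by (intro mult_right_mono mult_nonneg_nonneg) auto
    also have "real n powr (m * q) * integral\<^sup>L radial_measure (\<psi> n) = (\<integral>r. (real n * (1 - r)) powr (m * q) * r powr (real (n - m) * q) \<partial>radial_measure)"
      unfolding split \<psi>_def by simp
    finally show "(\<integral>r. r powr (real n * q) \<partial>radial_measure) \<le> D * mm * (\<integral>r. (real n * (1 - r)) powr (m * q) * r powr (real (n - m) * q) \<partial>radial_measure)"
      unfolding \<phi>_def .
  qed
  then show ?thesis by (rule moment_measure_D_class)
qed

end

section \<open>The equivalence\<close>

theorem theorem1p2:
  fixes q :: real and m :: nat and \<omega> :: "complex \<Rightarrow> real"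
  assumes "0 < q" and "1 \<le> m" and "radial_weight \<omega>"
  shows
    "((\<forall>f. f holomorphic_on unit_disk \<longrightarrow>
          (f \<in> analytic_tent_space q \<omega> \<longleftrightarrow> weighted_deriv m f \<in> tent_space q \<omega>)) \<and>
      (\<exists>C::real. C > 0 \<and>
         (\<forall>f \<in> analytic_tent_space q \<omega>.
            ennreal (inverse C) * tent_norm q \<omega> f
              \<le> ennreal (\<Sum>j<m. norm ((deriv ^^ j) f 0)) + tent_norm q \<omega> (weighted_deriv m f) \<and>
            ennreal (\<Sum>j<m. norm ((deriv ^^ j) f 0)) + tent_norm q \<omega> (weighted_deriv m f)
              \<le> ennreal C * tent_norm q \<omega> f)))
     \<longleftrightarrow> \<omega> \<in> D_class"
proof -
  obtain w where "radial_rep \<omega> w" using radial_rep_exists[OF assms(3)] by blast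
  then interpret radial_rep \<omega> w .
  show ?thesis
  proof (intro iffI conjI; (elim conjE exE)?)
    fix C :: real
    assume "C > 0" "\<forall>f \<in> analytic_tent_space q \<omega>.
            ennreal (inverse C) * tent_norm q \<omega> f
              \<le> ennreal (\<Sum>j<m. norm ((deriv ^^ j) f 0)) + tent_norm q \<omega> (weighted_deriv m f) \<and>
            ennreal (\<Sum>j<m. norm ((deriv ^^ j) f 0)) + tent_norm q \<omega> (weighted_deriv m f)
              \<le> ennreal C * tent_norm q \<omega> f"
    then show "\<omega> \<in> D_class" by (intro D_class_necessary[OF assms(1,2), of C]) blast+
  next
    assume "\<omega> \<in> D_class"
    then obtain C where C: "C > 0" "\<And>f. f holomorphic_on unit_disk \<Longrightarrow>
      tent_norm q \<omega> f \<le> ennreal C * (ennreal (\<Sum>j<m. norm ((deriv ^^ j) f 0)) + tent_norm q \<omega> (weighted_deriv m f))"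
      "\<And>f. f holomorphic_on unit_disk \<Longrightarrow>
      ennreal (\<Sum>j<m. norm ((deriv ^^ j) f 0)) + tent_norm q \<omega> (weighted_deriv m f) \<le> ennreal C * tent_norm q \<omega> f"
      using tent_norm_equiv[OF _ assms(1), of m] by blast
    show "\<forall>f. f holomorphic_on unit_disk \<longrightarrow>
          (f \<in> analytic_tent_space q \<omega> \<longleftrightarrow> weighted_deriv m f \<in> tent_space q \<omega>)"
    proof (intro allI impI)
      fix f assume f: "f holomorphic_on unit_disk"
      \<comment> \<open>The inequalities hold for infinite norms as well and the sum of derivatives
        at 0 is finite, so finiteness passes both ways.\<close>
      have "tent_norm q \<omega> f < \<infinity> \<longleftrightarrow> tent_norm q \<omega> (weighted_deriv m f) < \<infinity>"
      proof
        assume "tent_norm q \<omega> f < \<infinity>"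
        then have "ennreal C * tent_norm q \<omega> f < \<infinity>" by (simp add: ennreal_mult_less_top)
        with C(3)[OF f] have "ennreal (\<Sum>j<m. norm ((deriv ^^ j) f 0)) + tent_norm q \<omega> (weighted_deriv m f) < \<infinity>"
          by (rule le_less_trans)
        then show "tent_norm q \<omega> (weighted_deriv m f) < \<infinity>" by simp
      next
        assume "tent_norm q \<omega> (weighted_deriv m f) < \<infinity>"
        then have "ennreal C * (ennreal (\<Sum>j<m. norm ((deriv ^^ j) f 0)) + tent_norm q \<omega> (weighted_deriv m f)) < \<infinity>"
          by (simp add: ennreal_mult_less_top)
        with C(2)[OF f] show "tent_norm q \<omega> f < \<infinity>" by (rule le_less_trans)
      qed
      then show "f \<in> analytic_tent_space q \<omega> \<longleftrightarrow> weighted_deriv m f \<in> tent_space q \<omega>"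
        using f holomorphic_measurable_disk[OF f] weighted_deriv_measurable_disk[OF f, of m]
        by (simp add: analytic_tent_space_def tent_space_def)
    qed
    show "\<exists>C::real. C > 0 \<and>
         (\<forall>f \<in> analytic_tent_space q \<omega>.
            ennreal (inverse C) * tent_norm q \<omega> f
              \<le> ennreal (\<Sum>j<m. norm ((deriv ^^ j) f 0)) + tent_norm q \<omega> (weighted_deriv m f) \<and>
            ennreal (\<Sum>j<m. norm ((deriv ^^ j) f 0)) + tent_norm q \<omega> (weighted_deriv m f)
              \<le> ennreal C * tent_norm q \<omega> f)"
    proof (intro exI[of _ C] conjI ballI C(1))
      fix f assume "f \<in> analytic_tent_space q \<omega>"
      then have f: "f holomorphic_on unit_disk" by (simp add: analytic_tent_space_def)
      define X where "X = ennreal (\<Sum>j<m. norm ((deriv ^^ j) f 0)) + tent_norm q \<omega> (weighted_deriv m f)"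
      have "ennreal (inverse C) * tent_norm q \<omega> f \<le> ennreal (inverse C) * (ennreal C * X)"
        unfolding X_def by (intro mult_left_mono C(2)[OF f]) simp
      also have "\<dots> = X" using C(1) by (simp add: ennreal_mult_assoc)
      finally show "ennreal (inverse C) * tent_norm q \<omega> f \<le> ennreal (\<Sum>j<m. norm ((deriv ^^ j) f 0)) + tent_norm q \<omega> (weighted_deriv m f)"
        unfolding X_def .
      show "ennreal (\<Sum>j<m. norm ((deriv ^^ j) f 0)) + tent_norm q \<omega> (weighted_deriv m f) \<le> ennreal C * tent_norm q \<omega> f"
        by (rule C(3)[OF f])
    qed
  qed
qed

end
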